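(* Let $\mathcal{T}^{E}P$ be the prolongation of a Lie algebroid $E\to M$ over a fibration $\pi:P\to M$, endowed with an N-connection $\mathcal{N}=\{\mathcal{N}_a^A\}$ and a d-metric $\overline{\mathbf g}=\mathbf g_{ab}\,\mathcal X^a\otimes\mathcal X^b+\mathbf g_{AB}\,\delta^A\otimes\delta^B$. Then there is a (canonical) d-connection $\widehat{\mathcal D}$ on $\mathcal{T}^{E}P$, completely determined by the data $(\mathcal N,\overline{\mathbf g})$, which is metric compatible, $\widehat{\mathcal D}\,\overline{\mathbf g}=0$, and whose $h$- and $v$-torsion N-adapted coefficients are $\widehat T^{a}_{\ bf}=C^{a}_{\ bf}$ and $\widehat T^{A}_{\ BC}=0$.
   Context: Setting. All objects are smooth. $(E,\lfloor\cdot,\cdot\rfloor,\rho)$ is a Lie algebroid of rank $m$ over $M$, with local coordinates $x^i$ on $M$, a local basis of sections $e_a$, and structure functions $\rho(e_a)=\rho_a^i(x)\partial_i$, $\lfloor e_a,e_b\rfloor=C_{ab}^f(x)e_f$ (also written $C^f_{\ ab}$). $\pi:P\to M$ is a fibration with local coordinates $(x^i,y^A)$. The prolongation $\mathcal T^EP\to P$ is the Lie algebroid with fibre over $p\in P$, $x=\pi(p)$, equal to $\{(b,v)\in E_x\times T_pP:\rho(b)=T_p\pi(v)\}$ and anchor $\rho^\pi(b,v)=v$. It has the local basis $\mathcal X_a=(e_a,\rho_a^i\partial_i)$, $\mathcal V_A=(0,\partial_A)$, with brackets $\lfloor\mathcal X_a,\mathcal X_b\rfloor^\pi=C_{ab}^f\mathcal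 X_f$, $\lfloor\mathcal X_a,\mathcal V_B\rfloor^\pi=0$, $\lfloor\mathcal V_A,\mathcal V_B\rfloor^\pi=0$, and dual basis $\mathcal X^a,\mathcal V^A$. Sections act on functions on $P$ through the anchor. N-connection: a splitting $\mathcal T^EP=h\mathcal T^EP\oplus v\mathcal T^EP$, where $v\mathcal T^EP$ is spanned by the $\mathcal V_A$. Locally it is given by functions $\mathcal N_a^A(x,y)$ such that $h\mathcal T^EP$ is spanned by $\delta_a=\mathcal X_a-\mathcal N_a^A\mathcal V_A$. The N-adapted frame is $(\delta_a,\mathcal V_A)$ and its dual coframe is $(\mathcal X^a,\delta^A=\mathcal V^A+\mathcal N_c^A\mathcal X^c)$. d-metric: a nondegenerate symmetric bilinear form $\overline{\mathbf g}$ on $\mathcal T^EP$ that is block diagonal with respect to the $h$-$v$ splitting, $\overline{\mathbf g}=\mathbf g_{ab}\mathcal X^a\otimes\mathcal X^b+\mathbf g_{AB}\delta^A\otimes\delta^B$. d-connection: a linear connection $\mathcal D$ on the vector bundle $\mathcal T^EP$ (derivatives taken along sections of $\mathcal T^EP$, acting on functions via the anchor) preserving the splitting. Its N-adapted coefficients are defined by $\mathcal D_{\delta_f}\delta_b=\mathbf L^a_{\ bf}\delta_a$, $\mathcal D_{\delta_f}\mathcal V_B=\mathbf L^A_{\ Bf}\mathcal V_A$, $\mathcal D_{\mathcal V_C}\delta_b=\mathbf B^a_{\ bC}\delta_a$, $\mathcal D_{\mathcal V_C}\mathcal V_B=\mathbf B^A_{\ BC}\mathcal V_A$. The $h$- and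 $v$-torsion coefficients are $T^a_{\ bf}=\mathbf L^a_{\ bf}-\mathbf L^a_{\ fb}+C^a_{\ bf}$ and $T^A_{\ BC}=\mathbf B^A_{\ BC}-\mathbf B^A_{\ CB}$. "Completely determined by $(\mathcal N,\overline{\mathbf g})$" means that the N-adapted coefficients of $\widehat{\mathcal D}$ are expressed through $\mathbf g_{ab},\mathbf g_{AB},\mathcal N_a^A$, their derivatives along the frame, and the given Lie algebroid structure functions.
   Formalization: Since the coefficients C^a_bf are not tensorial, the d-connection is given for each chosen local basis e_a over an open U of M, on the part of T^E P over U (all of T^E P if the basis is global), with the torsion identities relative to that basis. *)

theory Defs
  imports "HOL-Analysis.Analysis" "HOL-Library.Function_Algebras"
begin

(* Tangent vectors are modelled as functionals ('p => real) => real, so functions into a real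
   vector space need their pointwise vector space structure. *)

instantiation "fun" :: (type, scaleR) scaleR
begin
definition scaleR_fun_def: "c *\<^sub>R f = (\<lambda>x. c *\<^sub>R f x)"
instance ..
end

lemma scaleR_fun_apply [simp]: "(c *\<^sub>R f) x = c *\<^sub>R f x"
  by (simp add: scaleR_fun_def)

instance "fun" :: (type, real_vector) real_vector
  by standard (auto simp: fun_eq_iff scaleR_add_right scaleR_add_left)


section \<open>Smooth manifolds\<close>

text \<open>\<open>C\<^sup>k\<close> and smooth maps between normed spaces, on an open set.\<close>

fun Ck_on :: "nat \<Rightarrow> ('a::real_normed_vector \<Rightarrow> 'b::real_normed_vector) \<Rightarrow> 'a set \<Rightarrow> bool" where
  "Ck_on 0 f S \<longleftrightarrow> continuous_on S f"
| "Ck_on (Suc k) f S \<longleftrightarrow> (\<forall>x\<in>S. f differentiable (at x)) \<and>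
     (\<forall>v. Ck_on k (\<lambda>x. frechet_derivative f (at x) v) S)"

definition smooth_on :: "('a::real_normed_vector \<Rightarrow> 'b::real_normed_vector) \<Rightarrow> 'a set \<Rightarrow> bool" where
  "smooth_on f S \<longleftrightarrow> (\<forall>k. Ck_on k f S)"

type_synonym ('p, 'a) chart = "'p set \<times> ('p \<Rightarrow> 'a)"
type_synonym ('p, 'a) atlas = "('p, 'a) chart set"

definition is_chart :: "('p::topological_space, 'a::euclidean_space) chart \<Rightarrow> bool" where
  "is_chart c \<longleftrightarrow> (case c of (W, \<psi>) \<Rightarrow>
     open W \<and> open (\<psi> ` W) \<and> homeomorphism W (\<psi> ` W) \<psi> (inv_into W \<psi>))"

text \<open>A manifold whose underlying space is the whole type; Hausdorff and second countable are
  imposed as sort constraints on the point types in the theorem.  The atlas need not be maximal.\<close>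

definition smooth_manifold :: "('p::topological_space, 'a::euclidean_space) atlas \<Rightarrow> bool" where
  "smooth_manifold A \<longleftrightarrow>
     (\<forall>c\<in>A. is_chart c) \<and> (\<Union>(fst ` A)) = UNIV \<and>
     (\<forall>(W, \<psi>)\<in>A. \<forall>(W', \<psi>')\<in>A. smooth_on (\<psi>' \<circ> inv_into W \<psi>) (\<psi> ` (W \<inter> W')))"

definition smooth_fun :: "('p::topological_space, 'a::euclidean_space) atlas \<Rightarrow> 'p set \<Rightarrow> ('p \<Rightarrow> real) \<Rightarrow> bool" where
  "smooth_fun A S f \<longleftrightarrow> (\<forall>(W, \<psi>)\<in>A. smooth_on (f \<circ> inv_into W \<psi>) (\<psi> ` (W \<inter> S)))"

definition smooth_near :: "('p::topological_space, 'a::euclidean_space) atlas \<Rightarrow> 'p \<Rightarrow> ('p \<Rightarrow> real) \<Rightarrow> bool" where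
  "smooth_near A p f \<longleftrightarrow> (\<exists>S. open S \<and> p \<in> S \<and> smooth_fun A S f)"

definition smooth_map ::
  "('p::topological_space, 'a::euclidean_space) atlas \<Rightarrow> ('m::topological_space, 'b::euclidean_space) atlas
    \<Rightarrow> ('p \<Rightarrow> 'm) \<Rightarrow> bool" where
  "smooth_map A B \<pi> \<longleftrightarrow> continuous_on UNIV \<pi> \<and>
     (\<forall>S f. open S \<longrightarrow> smooth_fun B S f \<longrightarrow> smooth_fun A (\<pi> -` S) (f \<circ> \<pi>))"

text \<open>Tangent vectors at \<open>p\<close> are the directional derivatives in the charts around \<open>p\<close>, acting on
  the functions that are smooth near \<open>p\<close> and set to \<open>0\<close> on all other functions.\<close>

type_synonym 'p tangent = "('p \<Rightarrow> real) \<Rightarrow> real"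

definition chart_vec ::
  "('p::topological_space, 'a::euclidean_space) atlas \<Rightarrow> ('p, 'a) chart \<Rightarrow> 'p \<Rightarrow> 'a \<Rightarrow> 'p tangent" where
  "chart_vec A c p w = (\<lambda>f. if smooth_near A p f
     then frechet_derivative (f \<circ> inv_into (fst c) (snd c)) (at (snd c p)) w else 0)"

definition tangent_space :: "('p::topological_space, 'a::euclidean_space) atlas \<Rightarrow> 'p \<Rightarrow> 'p tangent set" where
  "tangent_space A p = {chart_vec A c p w | c w. c \<in> A \<and> p \<in> fst c}"

definition push_forward ::
  "('m::topological_space, 'b::euclidean_space) atlas \<Rightarrow> ('p \<Rightarrow> 'm) \<Rightarrow> 'p \<Rightarrow> 'p tangent \<Rightarrow> 'm tangent" where
  "push_forward B \<pi> p v = (\<lambda>f. if smooth_near B (\<pi> p) f then v (f \<circ> \<pi>) else 0)"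


section \<open>Fibrations\<close>

text \<open>A fibred chart is a pair of charts, of \<open>M\<close> with coordinates \<open>x\<close> and of \<open>P\<close> with coordinates
  \<open>(x, y)\<close>, in which \<open>\<pi>\<close> is the projection \<open>(x, y) \<mapsto> x\<close>.\<close>

type_synonym ('m, 'p, 'n, 'k) fchart =
  "('m, real ^ 'n) chart \<times> ('p, (real ^ 'n) \<times> (real ^ 'k)) chart"

definition fibred_charts ::
  "('m, real ^ 'n) atlas \<Rightarrow> ('p, (real ^ 'n) \<times> (real ^ 'k)) atlas \<Rightarrow> ('p \<Rightarrow> 'm)
    \<Rightarrow> ('m, 'p, 'n, 'k) fchart set" where
  "fibred_charts AM AP \<pi> = {((V, \<phi>), (W, \<psi>)). (V, \<phi>) \<in> AM \<and> (W, \<psi>) \<in> AP \<and>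
     \<pi> ` W \<subseteq> V \<and> (\<forall>p\<in>W. \<phi> (\<pi> p) = fst (\<psi> p))}"

abbreviation fdom :: "('m, 'p, 'n, 'k) fchart \<Rightarrow> 'p set" where
  "fdom c \<equiv> fst (snd c)"

definition fibration ::
  "('m::topological_space, real ^ 'n) atlas \<Rightarrow> ('p::topological_space, (real ^ 'n) \<times> (real ^ 'k)) atlas
    \<Rightarrow> ('p \<Rightarrow> 'm) \<Rightarrow> bool" where
  "fibration AM AP \<pi> \<longleftrightarrow> smooth_manifold AM \<and> smooth_manifold AP \<and> smooth_map AP AM \<pi> \<and> surj \<pi> \<and>
     (\<forall>p. \<exists>c\<in>fibred_charts AM AP \<pi>. p \<in> fdom c)"


section \<open>Lie algebroids\<close>

definition is_basis :: "('i::finite \<Rightarrow> 'v::real_vector) \<Rightarrow> 'v set \<Rightarrow> bool" where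
  "is_basis B S \<longleftrightarrow> inj B \<and> independent (range B) \<and> span (range B) = S"

text \<open>The components of \<open>v\<close> in the basis \<open>B\<close>; meaningful only if \<open>B\<close> is linearly independent
  and \<open>v\<close> is in its span.\<close>

definition coeffs :: "('i::finite \<Rightarrow> 'v::real_vector) \<Rightarrow> 'v \<Rightarrow> 'i \<Rightarrow> real" where
  "coeffs B v = (THE c. v = (\<Sum>i\<in>UNIV. c i *\<^sub>R B i))"

text \<open>\<open>Fib E x\<close> is the fibre at \<open>x\<close>, a subspace of an ambient vector space \<open>'e\<close> that carries no
  further structure; the smooth structure of the bundle is given by the trivialising local frames
  \<open>Frames E\<close>.  The bracket acts on local sections (it is local by the axioms below); values of
  sections outside the open set under consideration are irrelevant.\<close>

record ('m, 'e, 'r) algebroid =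
  Fib :: "'m \<Rightarrow> 'e set"
  Frames :: "('m set \<times> ('r \<Rightarrow> 'm \<Rightarrow> 'e)) set"
  Bracket :: "('m \<Rightarrow> 'e) \<Rightarrow> ('m \<Rightarrow> 'e) \<Rightarrow> 'm \<Rightarrow> 'e"
  Anchor :: "'m \<Rightarrow> 'e \<Rightarrow> 'm tangent"

definition vector_bundle ::
  "('m::topological_space, 'a::euclidean_space) atlas \<Rightarrow> ('m, 'e::real_vector, 'r::finite) algebroid \<Rightarrow> bool" where
  "vector_bundle A E \<longleftrightarrow>
     (\<forall>x. subspace (Fib E x)) \<and>
     (\<Union>(fst ` Frames E)) = UNIV \<and>
     (\<forall>(U, e)\<in>Frames E. open U \<and> (\<forall>x\<in>U. is_basis (\<lambda>a. e a x) (Fib E x))) \<and>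
     (\<forall>(U, e)\<in>Frames E. \<forall>(U', e')\<in>Frames E. \<forall>a b.
        smooth_fun A (U \<inter> U') (\<lambda>x. coeffs (\<lambda>a. e a x) (e' b x) a))"

definition bundle_section ::
  "('m::topological_space, 'a::euclidean_space) atlas \<Rightarrow> ('m, 'e::real_vector, 'r::finite) algebroid
    \<Rightarrow> 'm set \<Rightarrow> ('m \<Rightarrow> 'e) \<Rightarrow> bool" where
  "bundle_section A E S s \<longleftrightarrow> (\<forall>x\<in>S. s x \<in> Fib E x) \<and>
     (\<forall>(U, e)\<in>Frames E. \<forall>a. smooth_fun A (S \<inter> U) (\<lambda>x. coeffs (\<lambda>a. e a x) (s x) a))"

definition local_frame ::
  "('m::topological_space, 'a::euclidean_space) atlas \<Rightarrow> ('m, 'e::real_vector, 'r::finite) algebroid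
    \<Rightarrow> 'm set \<Rightarrow> ('r \<Rightarrow> 'm \<Rightarrow> 'e) \<Rightarrow> bool" where
  "local_frame A E U e \<longleftrightarrow> open U \<and> (\<forall>a. bundle_section A E U (e a)) \<and>
     (\<forall>x\<in>U. is_basis (\<lambda>a. e a x) (Fib E x))"

definition lie_algebroid ::
  "('m::topological_space, 'a::euclidean_space) atlas \<Rightarrow> ('m, 'e::real_vector, 'r::finite) algebroid \<Rightarrow> bool" where
  "lie_algebroid A E \<longleftrightarrow> vector_bundle A E \<and>
     \<comment> \<open>the anchor is a smooth bundle map to the tangent bundle\<close>
     (\<forall>x. \<forall>b\<in>Fib E x. Anchor E x b \<in> tangent_space A x) \<and>
     (\<forall>x. \<forall>b\<in>Fib E x. \<forall>b'\<in>Fib E x. \<forall>c c'.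
        Anchor E x (c *\<^sub>R b + c' *\<^sub>R b') = c *\<^sub>R Anchor E x b + c' *\<^sub>R Anchor E x b') \<and>
     (\<forall>S s f. open S \<longrightarrow> bundle_section A E S s \<longrightarrow> smooth_fun A S f \<longrightarrow>
        smooth_fun A S (\<lambda>x. Anchor E x (s x) f)) \<and>
     \<comment> \<open>the bracket is a local operation on sections\<close>
     (\<forall>S s t. open S \<longrightarrow> bundle_section A E S s \<longrightarrow> bundle_section A E S t \<longrightarrow>
        bundle_section A E S (Bracket E s t)) \<and>
     (\<forall>S s s' t t'. open S \<longrightarrow> bundle_section A E S s \<longrightarrow> bundle_section A E S t \<longrightarrow>
        (\<forall>x\<in>S. s x = s' x \<and> t x = t' x) \<longrightarrow> (\<forall>x\<in>S. Bracket E s t x = Bracket E s' t' x)) \<and>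
     \<comment> \<open>Lie algebra axioms; real homogeneity follows from the Leibniz rule for constant \<open>f\<close>\<close>
     (\<forall>S s t. open S \<longrightarrow> bundle_section A E S s \<longrightarrow> bundle_section A E S t \<longrightarrow>
        (\<forall>x\<in>S. Bracket E s t x = - Bracket E t s x)) \<and>
     (\<forall>S s t t'. open S \<longrightarrow> bundle_section A E S s \<longrightarrow> bundle_section A E S t \<longrightarrow> bundle_section A E S t' \<longrightarrow>
        (\<forall>x\<in>S. Bracket E s (\<lambda>y. t y + t' y) x = Bracket E s t x + Bracket E s t' x)) \<and>
     (\<forall>S s t u. open S \<longrightarrow> bundle_section A E S s \<longrightarrow> bundle_section A E S t \<longrightarrow> bundle_section A E S u \<longrightarrow>
        (\<forall>x\<in>S. Bracket E s (Bracket E t u) x + Bracket E t (Bracket E u s) x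
                + Bracket E u (Bracket E s t) x = 0)) \<and>
     \<comment> \<open>Leibniz rule, and the anchor is a homomorphism of brackets\<close>
     (\<forall>S s t f. open S \<longrightarrow> bundle_section A E S s \<longrightarrow> bundle_section A E S t \<longrightarrow> smooth_fun A S f \<longrightarrow>
        (\<forall>x\<in>S. Bracket E s (\<lambda>y. f y *\<^sub>R t y) x
                 = f x *\<^sub>R Bracket E s t x + Anchor E x (s x) f *\<^sub>R t x)) \<and>
     (\<forall>S s t f. open S \<longrightarrow> bundle_section A E S s \<longrightarrow> bundle_section A E S t \<longrightarrow> smooth_fun A S f \<longrightarrow>
        (\<forall>x\<in>S. Anchor E x (Bracket E s t x) f
                 = Anchor E x (s x) (\<lambda>y. Anchor E y (t y) f)
                   - Anchor E x (t x) (\<lambda>y. Anchor E y (s y) f)))"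

definition anchor_coeff ::
  "('m, 'e, 'r) algebroid \<Rightarrow> ('m, real ^ 'n) chart \<Rightarrow> ('r \<Rightarrow> 'm \<Rightarrow> 'e) \<Rightarrow> 'r \<Rightarrow> 'n \<Rightarrow> 'm \<Rightarrow> real" where
  "anchor_coeff E c e a i x = Anchor E x (e a x) (\<lambda>z. snd c z $ i)"

text \<open>\<open>struct_coeff E e f a b\<close> is \<open>C\<^sup>f\<^sub>a\<^sub>b\<close>.  In all families of coefficients below the upper index is
  likewise the first argument.\<close>

definition struct_coeff ::
  "('m, 'e::real_vector, 'r::finite) algebroid \<Rightarrow> ('r \<Rightarrow> 'm \<Rightarrow> 'e) \<Rightarrow> 'r \<Rightarrow> 'r \<Rightarrow> 'r \<Rightarrow> 'm \<Rightarrow> real" where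
  "struct_coeff E e f a b x = coeffs (\<lambda>f. e f x) (Bracket E (e a) (e b) x) f"


section \<open>The prolongation over a fibration\<close>

type_synonym ('e, 'p) prol = "'e \<times> 'p tangent"

definition prol_fib ::
  "('m::topological_space, real ^ 'n) atlas \<Rightarrow> ('p::topological_space, (real ^ 'n) \<times> (real ^ 'k)) atlas
    \<Rightarrow> ('p \<Rightarrow> 'm) \<Rightarrow> ('m, 'e, 'r) algebroid \<Rightarrow> 'p \<Rightarrow> ('e, 'p) prol set" where
  "prol_fib AM AP \<pi> E p = {(b, v). b \<in> Fib E (\<pi> p) \<and> v \<in> tangent_space AP p \<and>
     Anchor E (\<pi> p) b = push_forward AM \<pi> p v}"

definition prol_vert ::
  "('m::topological_space, real ^ 'n) atlas \<Rightarrow> ('p::topological_space, (real ^ 'n) \<times> (real ^ 'k)) atlas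
    \<Rightarrow> ('p \<Rightarrow> 'm) \<Rightarrow> ('m, 'e::zero, 'r) algebroid \<Rightarrow> 'p \<Rightarrow> ('e, 'p) prol set" where
  "prol_vert AM AP \<pi> E p = {z \<in> prol_fib AM AP \<pi> E p. fst z = 0}"

text \<open>Smooth sections: the \<open>E\<close>-component has smooth components in the frames of \<open>E\<close>, and the
  tangent component is a smooth vector field.  Equivalently, the components in the frames
  \<open>(X_frame, V_frame)\<close> below are smooth.\<close>

definition prol_section ::
  "('m::topological_space, real ^ 'n) atlas \<Rightarrow> ('p::topological_space, (real ^ 'n) \<times> (real ^ 'k)) atlas
    \<Rightarrow> ('p \<Rightarrow> 'm) \<Rightarrow> ('m, 'e::real_vector, 'r::finite) algebroid \<Rightarrow> 'p set \<Rightarrow> ('p \<Rightarrow> ('e, 'p) prol) \<Rightarrow> bool" where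
  "prol_section AM AP \<pi> E S Z \<longleftrightarrow> (\<forall>p\<in>S. Z p \<in> prol_fib AM AP \<pi> E p) \<and>
     (\<forall>(U, e)\<in>Frames E. \<forall>a.
        smooth_fun AP (S \<inter> \<pi> -` U) (\<lambda>p. coeffs (\<lambda>a. e a (\<pi> p)) (fst (Z p)) a)) \<and>
     (\<forall>S' f. open S' \<longrightarrow> S' \<subseteq> S \<longrightarrow> smooth_fun AP S' f \<longrightarrow> smooth_fun AP S' (\<lambda>p. snd (Z p) f))"

definition X_frame ::
  "('p::topological_space, (real ^ 'n) \<times> (real ^ 'k)) atlas \<Rightarrow> ('p \<Rightarrow> 'm) \<Rightarrow> ('m, 'e, 'r) algebroid
    \<Rightarrow> ('m, 'p, 'n, 'k) fchart \<Rightarrow> ('r \<Rightarrow> 'm \<Rightarrow> 'e) \<Rightarrow> 'r \<Rightarrow> 'p \<Rightarrow> ('e, 'p) prol" where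
  "X_frame AP \<pi> E c e a p = (e a (\<pi> p),
     \<Sum>i\<in>UNIV. anchor_coeff E (fst c) e a i (\<pi> p) *\<^sub>R chart_vec AP (snd c) p (axis i 1, 0))"

definition V_frame ::
  "('p::topological_space, (real ^ 'n) \<times> (real ^ 'k)) atlas
    \<Rightarrow> ('m, 'p, 'n, 'k) fchart \<Rightarrow> 'k \<Rightarrow> 'p \<Rightarrow> ('e::zero, 'p) prol" where
  "V_frame AP c A p = (0, chart_vec AP (snd c) p (0, axis A 1))"


section \<open>N-connections, d-metrics and d-connections\<close>

text \<open>\<open>h p\<close> is the horizontal subspace at \<open>p\<close>.  The coefficients \<open>N_coeff \<dots> A a p\<close> are the numbers
  \<open>N\<^sup>A\<^sub>a\<close> for which \<open>X\<^sub>a - N\<^sup>A\<^sub>a V\<^sub>A\<close> is horizontal.\<close>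

definition N_coeff ::
  "('p::topological_space, (real ^ 'n) \<times> (real ^ 'k)) atlas \<Rightarrow> ('p \<Rightarrow> 'm) \<Rightarrow> ('m, 'e::real_vector, 'r) algebroid
    \<Rightarrow> ('p \<Rightarrow> ('e, 'p) prol set) \<Rightarrow> ('m, 'p, 'n, 'k) fchart \<Rightarrow> ('r \<Rightarrow> 'm \<Rightarrow> 'e) \<Rightarrow> 'k \<Rightarrow> 'r \<Rightarrow> 'p \<Rightarrow> real" where
  "N_coeff AP \<pi> E h c e A a p = (THE \<nu> :: 'k \<Rightarrow> real.
     X_frame AP \<pi> E c e a p - (\<Sum>A\<in>UNIV. \<nu> A *\<^sub>R V_frame AP c A p) \<in> h p) A"

definition delta_frame ::
  "('p::topological_space, (real ^ 'n) \<times> (real ^ 'k)) atlas \<Rightarrow> ('p \<Rightarrow> 'm) \<Rightarrow> ('m, 'e::real_vector, 'r) algebroid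
    \<Rightarrow> ('p \<Rightarrow> ('e, 'p) prol set) \<Rightarrow> ('m, 'p, 'n, 'k) fchart \<Rightarrow> ('r \<Rightarrow> 'm \<Rightarrow> 'e) \<Rightarrow> 'r \<Rightarrow> 'p \<Rightarrow> ('e, 'p) prol" where
  "delta_frame AP \<pi> E h c e a p =
     X_frame AP \<pi> E c e a p - (\<Sum>A\<in>UNIV. N_coeff AP \<pi> E h c e A a p *\<^sub>R V_frame AP c A p)"

definition N_connection ::
  "('m::topological_space, real ^ 'n) atlas \<Rightarrow> ('p::topological_space, (real ^ 'n) \<times> (real ^ 'k)) atlas
    \<Rightarrow> ('p \<Rightarrow> 'm) \<Rightarrow> ('m, 'e::real_vector, 'r::finite) algebroid \<Rightarrow> ('p \<Rightarrow> ('e, 'p) prol set) \<Rightarrow> bool" where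
  "N_connection AM AP \<pi> E h \<longleftrightarrow>
     (\<forall>p. subspace (h p) \<and> h p \<inter> prol_vert AM AP \<pi> E p = {0} \<and>
          {u + w | u w. u \<in> h p \<and> w \<in> prol_vert AM AP \<pi> E p} = prol_fib AM AP \<pi> E p) \<and>
     (\<forall>c\<in>fibred_charts AM AP \<pi>. \<forall>U e. local_frame AM E U e \<longrightarrow>
        (\<forall>A a. smooth_fun AP (fdom c \<inter> \<pi> -` U) (N_coeff AP \<pi> E h c e A a)))"

definition d_metric ::
  "('m::topological_space, real ^ 'n) atlas \<Rightarrow> ('p::topological_space, (real ^ 'n) \<times> (real ^ 'k)) atlas
    \<Rightarrow> ('p \<Rightarrow> 'm) \<Rightarrow> ('m, 'e::real_vector, 'r::finite) algebroid \<Rightarrow> ('p \<Rightarrow> ('e, 'p) prol set)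
    \<Rightarrow> ('p \<Rightarrow> ('e, 'p) prol \<Rightarrow> ('e, 'p) prol \<Rightarrow> real) \<Rightarrow> bool" where
  "d_metric AM AP \<pi> E h g \<longleftrightarrow>
     (\<forall>p. \<forall>u\<in>prol_fib AM AP \<pi> E p. \<forall>v\<in>prol_fib AM AP \<pi> E p. g p u v = g p v u) \<and>
     (\<forall>p. \<forall>u\<in>prol_fib AM AP \<pi> E p. \<forall>v\<in>prol_fib AM AP \<pi> E p. \<forall>w\<in>prol_fib AM AP \<pi> E p. \<forall>c c'.
        g p (c *\<^sub>R u + c' *\<^sub>R v) w = c * g p u w + c' * g p v w) \<and>
     (\<forall>p. \<forall>u\<in>prol_fib AM AP \<pi> E p. (\<forall>v\<in>prol_fib AM AP \<pi> E p. g p u v = 0) \<longrightarrow> u = 0) \<and>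
     (\<forall>p. \<forall>u\<in>h p. \<forall>v\<in>prol_vert AM AP \<pi> E p. g p u v = 0) \<and>
     (\<forall>S Y Z. open S \<longrightarrow> prol_section AM AP \<pi> E S Y \<longrightarrow> prol_section AM AP \<pi> E S Z \<longrightarrow>
        smooth_fun AP S (\<lambda>p. g p (Y p) (Z p)))"

text \<open>A d-connection on the restriction of the prolongation to an open set \<open>Q\<close> of \<open>P\<close>: a linear
  connection \<open>D X Y\<close> on local sections that preserves the horizontal and the vertical subbundle.\<close>

definition d_connection ::
  "('m::topological_space, real ^ 'n) atlas \<Rightarrow> ('p::topological_space, (real ^ 'n) \<times> (real ^ 'k)) atlas
    \<Rightarrow> ('p \<Rightarrow> 'm) \<Rightarrow> ('m, 'e::real_vector, 'r::finite) algebroid \<Rightarrow> ('p \<Rightarrow> ('e, 'p) prol set) \<Rightarrow> 'p set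
    \<Rightarrow> (('p \<Rightarrow> ('e, 'p) prol) \<Rightarrow> ('p \<Rightarrow> ('e, 'p) prol) \<Rightarrow> 'p \<Rightarrow> ('e, 'p) prol) \<Rightarrow> bool" where
  "d_connection AM AP \<pi> E h Q D \<longleftrightarrow>
     (\<forall>S X Y. open S \<longrightarrow> S \<subseteq> Q \<longrightarrow> prol_section AM AP \<pi> E S X \<longrightarrow> prol_section AM AP \<pi> E S Y \<longrightarrow>
        prol_section AM AP \<pi> E S (D X Y)) \<and>
     (\<forall>S X Y X' Y'. open S \<longrightarrow> S \<subseteq> Q \<longrightarrow> prol_section AM AP \<pi> E S X \<longrightarrow> prol_section AM AP \<pi> E S Y \<longrightarrow>
        (\<forall>p\<in>S. X p = X' p \<and> Y p = Y' p) \<longrightarrow> (\<forall>p\<in>S. D X Y p = D X' Y' p)) \<and>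
     (\<forall>S X X' Y. open S \<longrightarrow> S \<subseteq> Q \<longrightarrow>
        prol_section AM AP \<pi> E S X \<longrightarrow> prol_section AM AP \<pi> E S X' \<longrightarrow> prol_section AM AP \<pi> E S Y \<longrightarrow>
        (\<forall>p\<in>S. D (\<lambda>q. X q + X' q) Y p = D X Y p + D X' Y p)) \<and>
     (\<forall>S X Y f. open S \<longrightarrow> S \<subseteq> Q \<longrightarrow>
        prol_section AM AP \<pi> E S X \<longrightarrow> prol_section AM AP \<pi> E S Y \<longrightarrow> smooth_fun AP S f \<longrightarrow>
        (\<forall>p\<in>S. D (\<lambda>q. f q *\<^sub>R X q) Y p = f p *\<^sub>R D X Y p)) \<and>
     (\<forall>S X Y Y'. open S \<longrightarrow> S \<subseteq> Q \<longrightarrow>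
        prol_section AM AP \<pi> E S X \<longrightarrow> prol_section AM AP \<pi> E S Y \<longrightarrow> prol_section AM AP \<pi> E S Y' \<longrightarrow>
        (\<forall>p\<in>S. D X (\<lambda>q. Y q + Y' q) p = D X Y p + D X Y' p)) \<and>
     (\<forall>S X Y f. open S \<longrightarrow> S \<subseteq> Q \<longrightarrow>
        prol_section AM AP \<pi> E S X \<longrightarrow> prol_section AM AP \<pi> E S Y \<longrightarrow> smooth_fun AP S f \<longrightarrow>
        (\<forall>p\<in>S. D X (\<lambda>q. f q *\<^sub>R Y q) p = f p *\<^sub>R D X Y p + snd (X p) f *\<^sub>R Y p)) \<and>
     (\<forall>S X Y. open S \<longrightarrow> S \<subseteq> Q \<longrightarrow> prol_section AM AP \<pi> E S X \<longrightarrow> prol_section AM AP \<pi> E S Y \<longrightarrow>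
        (\<forall>p\<in>S. Y p \<in> h p) \<longrightarrow> (\<forall>p\<in>S. D X Y p \<in> h p)) \<and>
     (\<forall>S X Y. open S \<longrightarrow> S \<subseteq> Q \<longrightarrow> prol_section AM AP \<pi> E S X \<longrightarrow> prol_section AM AP \<pi> E S Y \<longrightarrow>
        (\<forall>p\<in>S. Y p \<in> prol_vert AM AP \<pi> E p) \<longrightarrow> (\<forall>p\<in>S. D X Y p \<in> prol_vert AM AP \<pi> E p))"

definition metric_compatible ::
  "('m::topological_space, real ^ 'n) atlas \<Rightarrow> ('p::topological_space, (real ^ 'n) \<times> (real ^ 'k)) atlas
    \<Rightarrow> ('p \<Rightarrow> 'm) \<Rightarrow> ('m, 'e::real_vector, 'r::finite) algebroid
    \<Rightarrow> ('p \<Rightarrow> ('e, 'p) prol \<Rightarrow> ('e, 'p) prol \<Rightarrow> real) \<Rightarrow> 'p set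
    \<Rightarrow> (('p \<Rightarrow> ('e, 'p) prol) \<Rightarrow> ('p \<Rightarrow> ('e, 'p) prol) \<Rightarrow> 'p \<Rightarrow> ('e, 'p) prol) \<Rightarrow> bool" where
  "metric_compatible AM AP \<pi> E g Q D \<longleftrightarrow>
     (\<forall>S X Y Z. open S \<longrightarrow> S \<subseteq> Q \<longrightarrow>
        prol_section AM AP \<pi> E S X \<longrightarrow> prol_section AM AP \<pi> E S Y \<longrightarrow> prol_section AM AP \<pi> E S Z \<longrightarrow>
        (\<forall>p\<in>S. snd (X p) (\<lambda>q. g q (Y q) (Z q)) = g p (D X Y p) (Z p) + g p (Y p) (D X Z p)))"

text \<open>The N-adapted coefficients of a d-connection: \<open>LH a b f\<close>, \<open>LV A B f\<close>, \<open>BH a b C\<close>, \<open>BV A B C\<close>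
  are \<open>L\<^sup>a\<^sub>b\<^sub>f\<close>, \<open>L\<^sup>A\<^sub>B\<^sub>f\<close>, \<open>B\<^sup>a\<^sub>b\<^sub>C\<close>, \<open>B\<^sup>A\<^sub>B\<^sub>C\<close>; the last index is the direction of differentiation.\<close>

record ('k, 'r) conn_coeffs =
  LH :: "'r \<Rightarrow> 'r \<Rightarrow> 'r \<Rightarrow> real"
  LV :: "'k \<Rightarrow> 'k \<Rightarrow> 'r \<Rightarrow> real"
  BH :: "'r \<Rightarrow> 'r \<Rightarrow> 'k \<Rightarrow> real"
  BV :: "'k \<Rightarrow> 'k \<Rightarrow> 'k \<Rightarrow> real"

definition adapted_coeffs ::
  "('p::topological_space, (real ^ 'n) \<times> (real ^ 'k)) atlas \<Rightarrow> ('p \<Rightarrow> 'm) \<Rightarrow> ('m, 'e::real_vector, 'r::finite) algebroid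
    \<Rightarrow> ('p \<Rightarrow> ('e, 'p) prol set) \<Rightarrow> ('m, 'p, 'n, 'k) fchart \<Rightarrow> ('r \<Rightarrow> 'm \<Rightarrow> 'e)
    \<Rightarrow> (('p \<Rightarrow> ('e, 'p) prol) \<Rightarrow> ('p \<Rightarrow> ('e, 'p) prol) \<Rightarrow> 'p \<Rightarrow> ('e, 'p) prol)
    \<Rightarrow> 'p \<Rightarrow> ('k, 'r) conn_coeffs" where
  "adapted_coeffs AP \<pi> E h c e D p =
    (let \<delta> = delta_frame AP \<pi> E h c e; V = V_frame AP c in
     \<lparr> LH = (\<lambda>a b f. coeffs (\<lambda>a. \<delta> a p) (D (\<delta> f) (\<delta> b) p) a),
       LV = (\<lambda>A B f. coeffs (\<lambda>A. V A p) (D (\<delta> f) (V B) p) A),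
       BH = (\<lambda>a b C. coeffs (\<lambda>a. \<delta> a p) (D (V C) (\<delta> b) p) a),
       BV = (\<lambda>A B C. coeffs (\<lambda>A. V A p) (D (V C) (V B) p) A) \<rparr>)"

definition h_torsion :: "('k, 'r) conn_coeffs \<Rightarrow> ('r \<Rightarrow> 'r \<Rightarrow> 'r \<Rightarrow> real) \<Rightarrow> 'r \<Rightarrow> 'r \<Rightarrow> 'r \<Rightarrow> real" where
  "h_torsion \<Gamma> C a b f = LH \<Gamma> a b f - LH \<Gamma> a f b + C a b f"

definition v_torsion :: "('k, 'r) conn_coeffs \<Rightarrow> 'k \<Rightarrow> 'k \<Rightarrow> 'k \<Rightarrow> real" where
  "v_torsion \<Gamma> A B C = BV \<Gamma> A B C - BV \<Gamma> A C B"

text \<open>The values at one point of the N-adapted components of the metric and the N-connection, of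
  their derivatives along the N-adapted frame (\<open>Inl f\<close> stands for \<open>\<delta>\<^sub>f\<close>, \<open>Inr C\<close> for \<open>V\<^sub>C\<close>), and of the
  structure functions of the Lie algebroid.\<close>

record ('n, 'k, 'r) local_data =
  gH :: "'r \<Rightarrow> 'r \<Rightarrow> real"
  gV :: "'k \<Rightarrow> 'k \<Rightarrow> real"
  NN :: "'k \<Rightarrow> 'r \<Rightarrow> real"
  dgH :: "'r + 'k \<Rightarrow> 'r \<Rightarrow> 'r \<Rightarrow> real"
  dgV :: "'r + 'k \<Rightarrow> 'k \<Rightarrow> 'k \<Rightarrow> real"
  dNN :: "'r + 'k \<Rightarrow> 'k \<Rightarrow> 'r \<Rightarrow> real"
  rho :: "'r \<Rightarrow> 'n \<Rightarrow> real"
  CC :: "'r \<Rightarrow> 'r \<Rightarrow> 'r \<Rightarrow> real"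

definition local_data_at ::
  "('p::topological_space, (real ^ 'n) \<times> (real ^ 'k)) atlas \<Rightarrow> ('p \<Rightarrow> 'm) \<Rightarrow> ('m, 'e::real_vector, 'r::finite) algebroid
    \<Rightarrow> ('p \<Rightarrow> ('e, 'p) prol set) \<Rightarrow> ('p \<Rightarrow> ('e, 'p) prol \<Rightarrow> ('e, 'p) prol \<Rightarrow> real)
    \<Rightarrow> ('m, 'p, 'n, 'k) fchart \<Rightarrow> ('r \<Rightarrow> 'm \<Rightarrow> 'e) \<Rightarrow> 'p \<Rightarrow> ('n, 'k, 'r) local_data" where
  "local_data_at AP \<pi> E h g c e p =
    (let \<delta> = delta_frame AP \<pi> E h c e; V = V_frame AP c; \<epsilon> = case_sum \<delta> V;
         gab = (\<lambda>a b q. g q (\<delta> a q) (\<delta> b q)); gAB = (\<lambda>A B q. g q (V A q) (V B q));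
         N = N_coeff AP \<pi> E h c e in
     \<lparr> gH = (\<lambda>a b. gab a b p), gV = (\<lambda>A B. gAB A B p), NN = (\<lambda>A a. N A a p),
       dgH = (\<lambda>\<alpha> a b. snd (\<epsilon> \<alpha> p) (gab a b)),
       dgV = (\<lambda>\<alpha> A B. snd (\<epsilon> \<alpha> p) (gAB A B)),
       dNN = (\<lambda>\<alpha> A a. snd (\<epsilon> \<alpha> p) (N A a)),
       rho = (\<lambda>a i. anchor_coeff E (fst c) e a i (\<pi> p)),
       CC = (\<lambda>f a b. struct_coeff E e f a b (\<pi> p)) \<rparr>)"

end

theory Submission
  imports Defs
begin

text \<open>In an N-adapted frame metric compatibility determines a d-connection up to the skew parts of its
  coefficients. In the \<open>hh\<close> and \<open>vv\<close> blocks symmetry in the lower indices fixes these, as for the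
  Christoffel symbols. In the mixed blocks one asks that \<open>D\<^sub>V\<close> on horizontal sections and
  \<open>V \<mapsto> D\<^sub>\<delta> V - [\<delta>, V]\<close> on vertical sections be self-adjoint. The solution of this linear system is
  an explicit function of the local data, so the coefficients define a d-connection over each
  fibred chart. Since \<open>\<delta>\<^sub>a\<close> does not depend on the chart and the vertical frames differ by a matrix
  \<open>J\<^sup>A\<^sub>B = V'\<^sub>B y\<^sup>A\<close>, the symmetry of second derivatives and \<open>[\<delta>\<^sub>a, V\<^sub>B] = (V\<^sub>B N\<^sup>A\<^sub>a) V\<^sub>A\<close> show that all these
  conditions hold in every other chart as well; by uniqueness the local connections agree on
  overlaps and glue.\<close>

section \<open>Smooth functions on normed spaces\<close>

text \<open>The torsion conditions only say that \<open>LH\<close> and \<open>BV\<close> are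
  symmetric in their lower indices, and the first of these depends on the frame \<open>e\<close>:
  the h-torsion is a tensor while C is not, so T = C in one frame does not in general give T = C in
  another. Hence the frame is fixed from the start, the connection lives over the preimage of its
  domain \<open>U\<close>, and only the fibred chart varies. The mixed blocks are left open by these
  torsions. For each of them there is a derivative that does not involve the metric: the one that
  keeps the \<delta>_b constant in vertical directions, and [\<delta>_f, .] on vertical sections.
  Adding one half of the raised derivative of the metric makes it metric compatible, and this is the
  only self-adjoint correction that does. This is the origin of the halves and of the terms V_B N in
  the mixed coefficients of \<open>canonical_coeffs\<close>. Working with the linear system instead
  of its solution avoids transforming the explicit formulas, with their inverse matrices, from one
  chart to another.\<close>

lemma frechet_derivative_cong_open:
  assumes "open S" "x \<in> S" "\<And>y. y \<in> S \<Longrightarrow> f y = g y"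
  shows "frechet_derivative f (at x) = frechet_derivative g (at x)"
proof -
  \<comment> \<open>\<open>frechet_derivative\<close> is a choice among derivatives, so it suffices
    that both functions have the same ones; this covers points without any derivative.\<close>
  have "(f has_derivative D) (at x) \<longleftrightarrow> (g has_derivative D) (at x)" for D
    using has_derivative_transform_within_open[OF _ assms(1,2), of f D UNIV g]
      has_derivative_transform_within_open[OF _ assms(1,2), of g D UNIV f] assms(3) by auto
  then show ?thesis
    unfolding frechet_derivative_def by simp
qed

lemma differentiable_cong_open:
  assumes "open S" "x \<in> S" "\<And>y. y \<in> S \<Longrightarrow> f y = g y"
  shows "f differentiable (at x) \<longleftrightarrow> g differentiable (at x)"
  using has_derivative_transform_within_open[OF _ assms(1,2), of f _ UNIV g]
    has_derivative_transform_within_open[OF _ assms(1,2), of g _ UNIV f] assms(3)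
  unfolding differentiable_def by metis

lemma Ck_on_cong:
  assumes "open S" "\<And>y. y \<in> S \<Longrightarrow> f y = g y" "Ck_on k f S"
  shows "Ck_on k g S"
  using assms(2,3)
proof (induction k arbitrary: f g)
  case 0
  then show ?case by (metis Ck_on.simps(1) continuous_on_cong)
next
  case (Suc k)
  have "Ck_on k (\<lambda>x. frechet_derivative g (at x) v) S" for v
  proof (rule Suc.IH)
    show "Ck_on k (\<lambda>x. frechet_derivative f (at x) v) S"
      using Suc.prems by simp
    show "frechet_derivative f (at y) v = frechet_derivative g (at y) v" if "y \<in> S" for y
      using frechet_derivative_cong_open[OF assms(1) that, of f g] Suc.prems by simp
  qed
  then show ?case
    using Suc.prems differentiable_cong_open[OF assms(1), of _ f g] by simp
qed

lemma Ck_on_subset: "Ck_on k f S \<Longrightarrow> T \<subseteq> S \<Longrightarrow> Ck_on k f T"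
  by (induction k arbitrary: f) (auto intro: continuous_on_subset)

lemma Ck_on_local:
  assumes "\<And>x. x \<in> S \<Longrightarrow> \<exists>T. open T \<and> x \<in> T \<and> Ck_on k f T"
  shows "Ck_on k f S"
  using assms
proof (induction k arbitrary: f)
  case 0
  show ?case
    unfolding Ck_on.simps
  proof (rule continuous_at_imp_continuous_on, rule ballI)
    fix x assume "x \<in> S"
    then obtain T where "open T" "x \<in> T" "continuous_on T f"
      using 0 by auto
    then show "isCont f x"
      by (simp add: continuous_on_eq_continuous_at)
  qed
next
  case (Suc k)
  have "f differentiable (at x)" if "x \<in> S" for x
    using Suc.prems[OF that] by auto
  moreover have "Ck_on k (\<lambda>x. frechet_derivative f (at x) v) S" for v
    by (rule Suc.IH) (use Suc.prems in fastforce)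
  ultimately show ?case by simp
qed

lemma Ck_on_const [simp]: "Ck_on k (\<lambda>x. c) S"
  by (induction k arbitrary: c) (auto simp: frechet_derivative_const)

lemma Ck_on_bounded_linear:
  assumes "bounded_linear L"
  shows "Ck_on k L S"
proof (cases k)
  case 0
  then show ?thesis using assms by (simp add: linear_continuous_on)
next
  case (Suc n)
  have d: "(L has_derivative L) (at x)" for x
    using assms by (rule bounded_linear_imp_has_derivative)
  have "frechet_derivative L (at x) = L" for x
    by (rule frechet_derivative_at[OF d, symmetric])
  moreover have "L differentiable (at x)" for x
    using d unfolding differentiable_def by blast
  ultimately show ?thesis
    using Suc by simp
qed

text \<open>The successor clause of \<open>Ck_on\<close> mentions differentiability only; continuity
  comes out of it in the base case.\<close>

lemma Ck_on_SucD: "Ck_on (Suc k) f S \<Longrightarrow> Ck_on k f S"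
proof (induction k arbitrary: f)
  case 0
  then show ?case
    by (auto intro!: continuous_at_imp_continuous_on differentiable_imp_continuous_within)
next
  case (Suc k)
  from Suc.prems have "f differentiable (at x)" if "x \<in> S" for x
    using that by simp
  moreover have "Ck_on k (\<lambda>x. frechet_derivative f (at x) v) S" for v
    by (rule Suc.IH) (use Suc.prems in simp)
  ultimately show ?case by simp
qed

lemma Ck_on_linear_comp:
  assumes "bounded_linear L" "open S" "Ck_on k f S"
  shows "Ck_on k (\<lambda>x. L (f x)) S"
  using assms(3)
proof (induction k arbitrary: f)
  case 0
  then show ?case
    using bounded_linear.continuous_on[OF assms(1)] by simp
next
  case (Suc k)
  have d: "((\<lambda>x. L (f x)) has_derivative (\<lambda>v. L (frechet_derivative f (at x) v))) (at x)"
    if "x \<in> S" for x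
    using Suc.prems that
    by (intro bounded_linear.has_derivative[OF assms(1)]) (simp add: frechet_derivative_works[symmetric])
  have "Ck_on k (\<lambda>x. frechet_derivative (\<lambda>x. L (f x)) (at x) v) S" for v
    by (rule Ck_on_cong[OF assms(2) _ Suc.IH[of "\<lambda>x. frechet_derivative f (at x) v"]])
       (use Suc.prems d in \<open>auto simp: frechet_derivative_at[OF d, symmetric]\<close>)
  then show ?case
    using d by (auto simp: differentiable_def)
qed

lemma Ck_on_add:
  assumes "open S" "Ck_on k f S" "Ck_on k g S"
  shows "Ck_on k (\<lambda>x. f x + g x) S"
  using assms(2,3)
proof (induction k arbitrary: f g)
  case 0
  then show ?case by (auto intro: continuous_on_add)
next
  case (Suc k)
  have d: "((\<lambda>x. f x + g x) has_derivative
      (\<lambda>v. frechet_derivative f (at x) v + frechet_derivative g (at x) v)) (at x)"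
    if "x \<in> S" for x
    using Suc.prems that
    by (intro has_derivative_add) (simp_all add: frechet_derivative_works[symmetric])
  have "Ck_on k (\<lambda>x. frechet_derivative (\<lambda>x. f x + g x) (at x) v) S" for v
    by (rule Ck_on_cong[OF assms(1) _ Suc.IH[of "\<lambda>x. frechet_derivative f (at x) v"
          "\<lambda>x. frechet_derivative g (at x) v"]])
       (use Suc.prems d in \<open>auto simp: frechet_derivative_at[OF d, symmetric]\<close>)
  then show ?case
    using d by (auto simp: differentiable_def)
qed

lemma Ck_on_sum:
  assumes "open S" "\<And>i. i \<in> I \<Longrightarrow> Ck_on k (f i) S"
  shows "Ck_on k (\<lambda>x. \<Sum>i\<in>I. f i x) S"
  using assms(2)
  by (induction I rule: infinite_finite_induct) (auto intro: Ck_on_add[OF assms(1)])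

lemma Ck_on_mult:
  fixes f g :: "'a::real_normed_vector \<Rightarrow> real"
  assumes "open S" "Ck_on k f S" "Ck_on k g S"
  shows "Ck_on k (\<lambda>x. f x * g x) S"
  using assms(2,3)
proof (induction k arbitrary: f g)
  case 0
  then show ?case by (auto intro: continuous_on_mult)
next
  case (Suc k)
  have d: "((\<lambda>x. f x * g x) has_derivative
      (\<lambda>v. f x * frechet_derivative g (at x) v + frechet_derivative f (at x) v * g x)) (at x)"
    if "x \<in> S" for x
    using Suc.prems that
    by (intro has_derivative_mult) (simp_all add: frechet_derivative_works[symmetric])
  have "Ck_on k (\<lambda>x. frechet_derivative (\<lambda>x. f x * g x) (at x) v) S" for v
  proof (rule Ck_on_cong[OF assms(1)])
    show "Ck_on k (\<lambda>x. f x * frechet_derivative g (at x) v + frechet_derivative f (at x) v * g x) S"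
      by (intro Ck_on_add Suc.IH assms(1))
         (use Suc.prems in \<open>auto intro: Ck_on_SucD simp del: Ck_on.simps simp: Ck_on.simps(2)[of k]\<close>)
    show "f y * frechet_derivative g (at y) v + frechet_derivative f (at y) v * g y
        = frechet_derivative (\<lambda>x. f x * g x) (at y) v" if "y \<in> S" for y
      by (simp add: frechet_derivative_at[OF d[OF that], symmetric])
  qed
  then show ?case
    using d by (auto simp: differentiable_def)
qed

text \<open>The derivative of 1/f has two factors 1/f and one factor f', so the induction can use
  its own claim for 1/f one level lower.\<close>

lemma Ck_on_inverse:
  fixes f :: "'a::real_normed_vector \<Rightarrow> real"
  assumes "open S" "Ck_on k f S" "\<And>x. x \<in> S \<Longrightarrow> f x \<noteq> 0"
  shows "Ck_on k (\<lambda>x. inverse (f x)) S"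
  using assms(2)
proof (induction k)
  case 0
  then show ?case using assms(3) by (auto intro: continuous_on_inverse)
next
  case (Suc k)
  have d: "((\<lambda>x. inverse (f x)) has_derivative
      (\<lambda>v. - (inverse (f x) * frechet_derivative f (at x) v * inverse (f x)))) (at x)"
    if "x \<in> S" for x
    using Suc.prems that assms(3)[OF that]
    by (intro Deriv.has_derivative_inverse) (simp_all add: frechet_derivative_works[symmetric])
  have "Ck_on k (\<lambda>x. frechet_derivative (\<lambda>x. inverse (f x)) (at x) v) S" for v
  proof (rule Ck_on_cong[OF assms(1)])
    show "Ck_on k (\<lambda>x. - (inverse (f x) * frechet_derivative f (at x) v * inverse (f x))) S"
      by (intro Ck_on_linear_comp[OF bounded_linear_minus[OF bounded_linear_ident] assms(1)]
            Ck_on_mult assms(1) Suc.IH Ck_on_SucD[OF Suc.prems])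
         (use Suc.prems in simp)
    show "- (inverse (f y) * frechet_derivative f (at y) v * inverse (f y))
        = frechet_derivative (\<lambda>x. inverse (f x)) (at y) v" if "y \<in> S" for y
      by (simp add: frechet_derivative_at[OF d[OF that], symmetric])
  qed
  then show ?case
    using d by (auto simp: differentiable_def)
qed

text \<open>By the chain rule f' is applied to the direction g'(x) v, which moves with x, whereas
  the induction hypothesis concerns fixed directions. Expanding the moving direction in
  \<open>Basis\<close> leaves products of its components with derivatives of f in fixed
  directions.\<close>

lemma Ck_on_compose:
  fixes f :: "'b::euclidean_space \<Rightarrow> real" and g :: "'a::real_normed_vector \<Rightarrow> 'b"
  assumes "open S" "open T" "g ` S \<subseteq> T" "Ck_on k g S" "Ck_on k f T"
  shows "Ck_on k (\<lambda>x. f (g x)) S"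
  using assms(4,5)
proof (induction k arbitrary: f)
  case 0
  then show ?case
    using continuous_on_compose2[of T f S g] assms(3) by simp
next
  case (Suc k)
  let ?f' = "\<lambda>x. frechet_derivative f (at x)" and ?g' = "\<lambda>x. frechet_derivative g (at x)"
  have df: "(f has_derivative ?f' x) (at x)" if "x \<in> T" for x
    using Suc.prems that by (simp add: frechet_derivative_works[symmetric])
  have d: "((\<lambda>x. f (g x)) has_derivative (\<lambda>v. ?f' (g x) (?g' x v))) (at x)" if "x \<in> S" for x
  proof -
    have "(g has_derivative ?g' x) (at x)"
      using Suc.prems that by (simp add: frechet_derivative_works[symmetric])
    moreover have "(f has_derivative ?f' (g x)) (at (g x))"
      using df assms(3) that by auto
    ultimately show ?thesis
      by (rule has_derivative_compose)
  qed
  have "Ck_on k (\<lambda>x. frechet_derivative (\<lambda>x. f (g x)) (at x) v) S" for v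
  proof (rule Ck_on_cong[OF assms(1)])
    show "Ck_on k (\<lambda>x. \<Sum>b\<in>Basis. (?g' x v \<bullet> b) * ?f' (g x) b) S"
      by (intro Ck_on_sum Ck_on_mult assms(1) Suc.IH Ck_on_SucD[OF Suc.prems(1)]
            Ck_on_linear_comp[OF bounded_linear_inner_left assms(1)])
         (use Suc.prems in simp_all)
    show "(\<Sum>b\<in>Basis. (?g' y v \<bullet> b) * ?f' (g y) b) = frechet_derivative (\<lambda>x. f (g x)) (at y) v"
      if "y \<in> S" for y
    proof -
      have "linear (?f' (g y))"
        using df assms(3) that by (auto intro: has_derivative_linear)
      then have "?f' (g y) (\<Sum>b\<in>Basis. (?g' y v \<bullet> b) *\<^sub>R b) = (\<Sum>b\<in>Basis. (?g' y v \<bullet> b) * ?f' (g y) b)"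
        by (simp add: linear_sum linear_cmul)
      then show ?thesis
        by (simp add: frechet_derivative_at[OF d[OF that], symmetric] euclidean_representation)
    qed
  qed
  then show ?case
    using d by (auto simp: differentiable_def)
qed

lemma smooth_on_differentiable: "smooth_on f S \<Longrightarrow> x \<in> S \<Longrightarrow> f differentiable (at x)"
  unfolding smooth_on_def by (metis Ck_on.simps(2))

lemma smooth_on_frechet_derivative:
  "smooth_on f S \<Longrightarrow> smooth_on (\<lambda>x. frechet_derivative f (at x) v) S"
  unfolding smooth_on_def by (metis Ck_on.simps(2))

lemma smooth_on_continuous_on: "smooth_on f S \<Longrightarrow> continuous_on S f"
  unfolding smooth_on_def by (metis Ck_on.simps(1))

section \<open>Symmetry of second derivatives\<close>

lemma directional_field_derivative:
  fixes u :: "'a::real_normed_vector \<Rightarrow> real"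
  assumes "u differentiable (at (x + s *\<^sub>R v))"
  shows "((\<lambda>s. u (x + s *\<^sub>R v)) has_field_derivative frechet_derivative u (at (x + s *\<^sub>R v)) v) (at s)"
proof -
  have "((\<lambda>s. x + s *\<^sub>R v) has_derivative (\<lambda>h. h *\<^sub>R v)) (at s)"
    by (auto intro!: derivative_eq_intros)
  moreover have "(u has_derivative frechet_derivative u (at (x + s *\<^sub>R v))) (at (x + s *\<^sub>R v))"
    using assms by (simp add: frechet_derivative_works[symmetric])
  ultimately have "((\<lambda>s. u (x + s *\<^sub>R v)) has_derivative
      (\<lambda>h. frechet_derivative u (at (x + s *\<^sub>R v)) (h *\<^sub>R v))) (at s)"
    by (rule has_derivative_compose)
  moreover have "(\<lambda>h. frechet_derivative u (at (x + s *\<^sub>R v)) (h *\<^sub>R v))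
      = (*) (frechet_derivative u (at (x + s *\<^sub>R v)) v)"
    using linear_frechet_derivative[OF assms] by (auto simp: linear_cmul fun_eq_iff)
  ultimately show ?thesis
    by (simp add: has_field_derivative_def)
qed

text \<open>The mean value theorem is applied twice: along v to the increment of \<open>u\<close> in
  direction w, then along w to the first derivative. The bound on \<open>e\<close> keeps the whole
  parallelogram inside the ball.\<close>

lemma second_difference_mvt:
  fixes u :: "'a::real_normed_vector \<Rightarrow> real"
  assumes "smooth_on u S" "ball x r \<subseteq> S" "0 < e" "e * (norm v + norm w) < r"
  shows "\<exists>s t. 0 < s \<and> s < e \<and> 0 < t \<and> t < e \<and>
    u (x + e *\<^sub>R v + e *\<^sub>R w) - u (x + e *\<^sub>R v) - u (x + e *\<^sub>R w) + u x
    = e * (e * frechet_derivative (\<lambda>y. frechet_derivative u (at y) v) (at (x + s *\<^sub>R v + t *\<^sub>R w)) w)"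
proof -
  have in_S: "x + s *\<^sub>R v + t *\<^sub>R w \<in> S" if "0 \<le> s" "s \<le> e" "0 \<le> t" "t \<le> e" for s t
  proof -
    have "norm (s *\<^sub>R v + t *\<^sub>R w) \<le> s * norm v + t * norm w"
      using that norm_triangle_ineq[of "s *\<^sub>R v" "t *\<^sub>R w"] by simp
    also have "\<dots> \<le> e * (norm v + norm w)"
      using that by (simp add: distrib_left add_mono mult_right_mono)
    also have "\<dots> < r" by (rule assms(4))
    finally have "dist x (x + (s *\<^sub>R v + t *\<^sub>R w)) < r"
      by (subst dist_commute) (simp add: dist_norm)
    then show ?thesis
      using assms(2) by (auto simp: add.assoc)
  qed
  let ?u' = "\<lambda>y. frechet_derivative u (at y) v"
  define p where "p s = u (x + e *\<^sub>R w + s *\<^sub>R v) - u (x + s *\<^sub>R v)" for s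
  have "(p has_field_derivative ?u' (x + e *\<^sub>R w + s *\<^sub>R v) - ?u' (x + s *\<^sub>R v)) (at s)"
    if "0 \<le> s" "s \<le> e" for s
    unfolding p_def
    using in_S[OF that, of e] in_S[OF that, of 0] assms(1,3)
    by (intro DERIV_diff directional_field_derivative smooth_on_differentiable[OF assms(1)])
       (simp_all add: ac_simps)
  then obtain s where s: "0 < s" "s < e"
    "p e - p 0 = (e - 0) * (?u' (x + e *\<^sub>R w + s *\<^sub>R v) - ?u' (x + s *\<^sub>R v))"
    using MVT2[of 0 e p "\<lambda>s. ?u' (x + e *\<^sub>R w + s *\<^sub>R v) - ?u' (x + s *\<^sub>R v)"] assms(3) by blast
  have "((\<lambda>t. ?u' (x + s *\<^sub>R v + t *\<^sub>R w)) has_field_derivative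
      frechet_derivative ?u' (at (x + s *\<^sub>R v + t *\<^sub>R w)) w) (at t)"
    if "0 \<le> t" "t \<le> e" for t
    using in_S[of s t] s that
    by (intro directional_field_derivative
        smooth_on_differentiable[OF smooth_on_frechet_derivative[OF assms(1)]]) simp
  then obtain t where t: "0 < t" "t < e"
    "?u' (x + s *\<^sub>R v + e *\<^sub>R w) - ?u' (x + s *\<^sub>R v + 0 *\<^sub>R w)
      = (e - 0) * frechet_derivative ?u' (at (x + s *\<^sub>R v + t *\<^sub>R w)) w"
    using MVT2[of 0 e "\<lambda>t. ?u' (x + s *\<^sub>R v + t *\<^sub>R w)"
        "\<lambda>t. frechet_derivative ?u' (at (x + s *\<^sub>R v + t *\<^sub>R w)) w"] assms(3) by blast
  have "u (x + e *\<^sub>R v + e *\<^sub>R w) - u (x + e *\<^sub>R v) - u (x + e *\<^sub>R w) + u x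
    = e * (e * frechet_derivative ?u' (at (x + s *\<^sub>R v + t *\<^sub>R w)) w)"
    using s(3) t(3) by (simp add: p_def ac_simps)
  then show ?thesis
    using s t by blast
qed

text \<open>The second difference is symmetric in v and w, so the two mixed derivatives share a
  value, taken at two points close to \<open>x\<close>; continuity at \<open>x\<close> closes the
  gap.\<close>

lemma frechet_derivative_commute:
  fixes u :: "'a::real_normed_vector \<Rightarrow> real"
  assumes "smooth_on u S" "open S" "x \<in> S"
  shows "frechet_derivative (\<lambda>y. frechet_derivative u (at y) v) (at x) w
       = frechet_derivative (\<lambda>y. frechet_derivative u (at y) w) (at x) v"
proof -
  define F where "F v w y = frechet_derivative (\<lambda>z. frechet_derivative u (at z) v) (at y) w" for v w y
  have cont: "isCont (F v w) x" for v w
    using smooth_on_continuous_on[OF smooth_on_frechet_derivative[OF smooth_on_frechet_derivative[OF assms(1)]]]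
      assms(2,3) unfolding F_def by (auto simp: continuous_on_eq_continuous_at)
  obtain r where r: "0 < r" "ball x r \<subseteq> S"
    using assms(2,3) by (meson openE)
  have "dist (F v w x) (F w v x) < 2 * e" if e: "0 < e" for e
  proof -
    from cont[of v w] obtain d1 where d1: "0 < d1" "\<And>y. dist y x < d1 \<Longrightarrow> dist (F v w y) (F v w x) < e"
      using e by (auto simp: continuous_at_eps_delta)
    from cont[of w v] obtain d2 where d2: "0 < d2" "\<And>y. dist y x < d2 \<Longrightarrow> dist (F w v y) (F w v x) < e"
      using e by (auto simp: continuous_at_eps_delta)
    define d where "d = min r (min d1 d2)"
    \<comment> \<open>The summand 1 keeps the denominator positive when v and w vanish. With this
      side length the parallelogram stays within distance \<open>d\<close> of
      \<open>x\<close>.\<close>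
    define h where "h = d / (norm v + norm w + 1)"
    have pos: "0 < norm v + norm w + 1"
      by (simp add: add_nonneg_pos)
    have h: "0 < h"
      using r d1 d2 pos by (simp add: h_def d_def)
    have "h * (norm v + norm w) < h * (norm v + norm w + 1)"
      using h by simp
    also have "\<dots> = d"
      using pos by (simp add: h_def)
    finally have hd: "h * (norm v + norm w) < d" .
    have close: "dist (x + s *\<^sub>R v + t *\<^sub>R w) x < d" if "0 < s" "s < h" "0 < t" "t < h" for s t
    proof -
      have "norm (s *\<^sub>R v + t *\<^sub>R w) \<le> s * norm v + t * norm w"
        using that norm_triangle_ineq[of "s *\<^sub>R v" "t *\<^sub>R w"] by simp
      also have "\<dots> \<le> h * (norm v + norm w)"
        using that by (simp add: distrib_left add_mono mult_right_mono)
      finally show ?thesis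
        using hd by (simp add: dist_norm add.assoc)
    qed
    have hr: "h * (norm v + norm w) < r" "h * (norm w + norm v) < r"
      using hd by (simp_all add: d_def add.commute)
    obtain s t where 1: "0 < s" "s < h" "0 < t" "t < h"
      "u (x + h *\<^sub>R v + h *\<^sub>R w) - u (x + h *\<^sub>R v) - u (x + h *\<^sub>R w) + u x
        = h * (h * F v w (x + s *\<^sub>R v + t *\<^sub>R w))"
      using second_difference_mvt[OF assms(1) r(2) h hr(1)] unfolding F_def by blast
    obtain s' t' where 2: "0 < s'" "s' < h" "0 < t'" "t' < h"
      "u (x + h *\<^sub>R w + h *\<^sub>R v) - u (x + h *\<^sub>R w) - u (x + h *\<^sub>R v) + u x
        = h * (h * F w v (x + s' *\<^sub>R w + t' *\<^sub>R v))"
      using second_difference_mvt[OF assms(1) r(2) h hr(2)] unfolding F_def by blast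
    have "h * (h * F v w (x + s *\<^sub>R v + t *\<^sub>R w)) = h * (h * F w v (x + s' *\<^sub>R w + t' *\<^sub>R v))"
      using 1(5) 2(5) by (simp only: add.assoc[of x] add.commute[of "h *\<^sub>R w" "h *\<^sub>R v"])
    then have "F v w (x + s *\<^sub>R v + t *\<^sub>R w) = F w v (x + s' *\<^sub>R w + t' *\<^sub>R v)"
      using h by simp
    moreover have "dist (F v w (x + s *\<^sub>R v + t *\<^sub>R w)) (F v w x) < e"
      using d1(2) close[OF 1(1-4)] by (simp add: d_def)
    moreover have "dist (F w v (x + s' *\<^sub>R w + t' *\<^sub>R v)) (F w v x) < e"
      using d2(2) close[OF 2(3,4,1,2)] by (simp add: d_def ac_simps)
    ultimately show ?thesis
      by (simp add: dist_real_def)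
  qed
  \<comment> \<open>For half of the distance the bound says that the distance is smaller than
    itself, so the distance cannot be positive.\<close>
  from this[of "dist (F v w x) (F w v x) / 2"] have "F v w x = F w v x"
    by (cases "dist (F v w x) (F w v x) = 0") auto
  then show ?thesis
    by (simp add: F_def)
qed

section \<open>Manifolds and tangent vectors\<close>

locale manifold =
  fixes A :: "('p::topological_space, 'a::euclidean_space) atlas"
  assumes manifold: "smooth_manifold A"
begin

lemma chart_open: "(W, \<psi>) \<in> A \<Longrightarrow> open W"
  using manifold by (auto simp: smooth_manifold_def is_chart_def)

lemma chart_homeomorphism: "(W, \<psi>) \<in> A \<Longrightarrow> homeomorphism W (\<psi> ` W) \<psi> (inv_into W \<psi>)"
  using manifold by (auto simp: smooth_manifold_def is_chart_def)

lemma chart_inv [simp]: "(W, \<psi>) \<in> A \<Longrightarrow> p \<in> W \<Longrightarrow> inv_into W \<psi> (\<psi> p) = p"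
  using chart_homeomorphism by (auto simp: homeomorphism_def)

lemma chart_image_open:
  assumes "(W, \<psi>) \<in> A" "open S"
  shows "open (\<psi> ` (W \<inter> S))"
proof -
  have "openin (top_of_set (\<psi> ` W)) (\<psi> ` (W \<inter> S))"
    by (rule homeomorphism_imp_open_map[OF chart_homeomorphism[OF assms(1)]])
       (use assms(2) in \<open>auto simp: openin_open\<close>)
  moreover have "open (\<psi> ` W)"
    using assms(1) manifold by (auto simp: smooth_manifold_def is_chart_def)
  ultimately show ?thesis
    using openin_open_trans by blast
qed

lemma chart_cover: "\<exists>W \<psi>. (W, \<psi>) \<in> A \<and> p \<in> W"
proof -
  have "p \<in> \<Union>(fst ` A)"
    using manifold by (simp add: smooth_manifold_def)
  then show ?thesis by force
qed

lemma transition_smooth: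
  "(W, \<psi>) \<in> A \<Longrightarrow> (W', \<psi>') \<in> A \<Longrightarrow> smooth_on (\<psi>' \<circ> inv_into W \<psi>) (\<psi> ` (W \<inter> W'))"
  using manifold by (auto simp: smooth_manifold_def)

section \<open>Smooth functions on open subsets of a manifold\<close>

lemma smooth_fun_alt:
  "smooth_fun A S f \<longleftrightarrow> (\<forall>W \<psi> k. (W, \<psi>) \<in> A \<longrightarrow> Ck_on k (\<lambda>x. f (inv_into W \<psi> x)) (\<psi> ` (W \<inter> S)))"
  by (auto simp: smooth_fun_def smooth_on_def comp_def)

lemma smooth_fun_subset: "smooth_fun A S f \<Longrightarrow> T \<subseteq> S \<Longrightarrow> smooth_fun A T f"
  unfolding smooth_fun_alt by (meson Ck_on_subset Int_mono image_mono order_refl)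

lemma smooth_fun_cong:
  assumes "open S" "\<And>p. p \<in> S \<Longrightarrow> f p = g p" "smooth_fun A S f"
  shows "smooth_fun A S g"
  unfolding smooth_fun_alt
proof (intro allI impI)
  fix W \<psi> k assume W: "(W, \<psi>) \<in> A"
  show "Ck_on k (\<lambda>x. g (inv_into W \<psi> x)) (\<psi> ` (W \<inter> S))"
    by (rule Ck_on_cong[OF chart_image_open[OF W assms(1)], of "\<lambda>x. f (inv_into W \<psi> x)"])
       (use assms W in \<open>auto simp: smooth_fun_alt\<close>)
qed

lemma smooth_fun_local:
  assumes "\<And>p. p \<in> S \<Longrightarrow> \<exists>T. open T \<and> p \<in> T \<and> smooth_fun A T f"
  shows "smooth_fun A S f"
  unfolding smooth_fun_alt
proof (intro allI impI)
  fix W \<psi> k assume W: "(W, \<psi>) \<in> A"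
  show "Ck_on k (\<lambda>x. f (inv_into W \<psi> x)) (\<psi> ` (W \<inter> S))"
  proof (rule Ck_on_local)
    fix x assume "x \<in> \<psi> ` (W \<inter> S)"
    then obtain p where p: "p \<in> W" "p \<in> S" "x = \<psi> p" by blast
    then obtain T where "open T" "p \<in> T" "smooth_fun A T f"
      using assms by blast
    then show "\<exists>T. open T \<and> x \<in> T \<and> Ck_on k (\<lambda>x. f (inv_into W \<psi> x)) T"
      using chart_image_open[OF W] W p by (intro exI[of _ "\<psi> ` (W \<inter> T)"]) (auto simp: smooth_fun_alt)
  qed
qed

text \<open>One chart around \<open>S\<close> suffices: in any other chart the coordinate expression
  is the given one composed with a smooth transition map.\<close>

lemma smooth_fun_chartI:
  assumes "(W, \<psi>) \<in> A" "open S" "S \<subseteq> W" "smooth_on (\<lambda>x. f (inv_into W \<psi> x)) (\<psi> ` S)"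
  shows "smooth_fun A S f"
  unfolding smooth_fun_alt
proof (intro allI impI)
  fix W' \<psi>' k assume W': "(W', \<psi>') \<in> A"
  let ?t = "\<psi> \<circ> inv_into W' \<psi>'"
  show "Ck_on k (\<lambda>x. f (inv_into W' \<psi>' x)) (\<psi>' ` (W' \<inter> S))"
  proof (rule Ck_on_cong)
    show "open (\<psi>' ` (W' \<inter> S))"
      by (rule chart_image_open[OF W' assms(2)])
    show "Ck_on k (\<lambda>x. f (inv_into W \<psi> (?t x))) (\<psi>' ` (W' \<inter> S))"
    proof (rule Ck_on_compose[of _ "\<psi> ` S" ?t k "\<lambda>x. f (inv_into W \<psi> x)"])
      show "open (\<psi> ` S)"
        using chart_image_open[OF assms(1,2)] assms(3) by (simp add: inf_absorb2)
      show "Ck_on k ?t (\<psi>' ` (W' \<inter> S))"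
        using transition_smooth[OF W' assms(1)] assms(3)
        unfolding smooth_on_def by (meson Ck_on_subset Int_mono image_mono order_refl)
    qed (use assms W' chart_image_open[OF W' assms(2)] in \<open>auto simp: smooth_on_def\<close>)
    show "f (inv_into W \<psi> (?t y)) = f (inv_into W' \<psi>' y)" if "y \<in> \<psi>' ` (W' \<inter> S)" for y
      using that W' assms(1,3) by auto
  qed
qed

lemma smooth_fun_chartD:
  "(W, \<psi>) \<in> A \<Longrightarrow> smooth_fun A S f \<Longrightarrow> smooth_on (\<lambda>x. f (inv_into W \<psi> x)) (\<psi> ` (W \<inter> S))"
  by (auto simp: smooth_fun_alt smooth_on_def)

lemma smooth_fun_const [simp]: "smooth_fun A S (\<lambda>p. c)"
  by (simp add: smooth_fun_alt)

lemma smooth_fun_add: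
  "open S \<Longrightarrow> smooth_fun A S f \<Longrightarrow> smooth_fun A S g \<Longrightarrow> smooth_fun A S (\<lambda>p. f p + g p)"
  using Ck_on_add chart_image_open unfolding smooth_fun_alt by blast

lemma smooth_fun_mult:
  "open S \<Longrightarrow> smooth_fun A S f \<Longrightarrow> smooth_fun A S g \<Longrightarrow> smooth_fun A S (\<lambda>p. f p * g p)"
  using Ck_on_mult chart_image_open unfolding smooth_fun_alt by blast

lemma smooth_fun_uminus: "open S \<Longrightarrow> smooth_fun A S f \<Longrightarrow> smooth_fun A S (\<lambda>p. - f p)"
  using smooth_fun_mult[of S "\<lambda>_. -1" f] by simp

lemma smooth_fun_diff:
  "open S \<Longrightarrow> smooth_fun A S f \<Longrightarrow> smooth_fun A S g \<Longrightarrow> smooth_fun A S (\<lambda>p. f p - g p)"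
  using smooth_fun_add[of S f "\<lambda>p. - g p"] smooth_fun_uminus[of S g] by simp

lemma smooth_fun_sum:
  "open S \<Longrightarrow> (\<And>i. i \<in> I \<Longrightarrow> smooth_fun A S (f i)) \<Longrightarrow> smooth_fun A S (\<lambda>p. \<Sum>i\<in>I. f i p)"
  by (induction I rule: infinite_finite_induct) (auto intro: smooth_fun_add)

lemma smooth_fun_prod:
  "open S \<Longrightarrow> (\<And>i. i \<in> I \<Longrightarrow> smooth_fun A S (f i)) \<Longrightarrow> smooth_fun A S (\<lambda>p. \<Prod>i\<in>I. f i p)"
  by (induction I rule: infinite_finite_induct) (auto intro: smooth_fun_mult)

lemma smooth_fun_divide:
  assumes "open S" "smooth_fun A S f" "smooth_fun A S g" "\<And>p. p \<in> S \<Longrightarrow> g p \<noteq> 0"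
  shows "smooth_fun A S (\<lambda>p. f p / g p)"
proof -
  have "smooth_fun A S (\<lambda>p. inverse (g p))"
    unfolding smooth_fun_alt
  proof (intro allI impI)
    fix W \<psi> k assume W: "(W, \<psi>) \<in> A"
    show "Ck_on k (\<lambda>x. inverse (g (inv_into W \<psi> x))) (\<psi> ` (W \<inter> S))"
      by (rule Ck_on_inverse[OF chart_image_open[OF W assms(1)]])
         (use assms W in \<open>auto simp: smooth_fun_alt\<close>)
  qed
  from smooth_fun_mult[OF assms(1,2) this] show ?thesis
    by (simp add: divide_inverse)
qed

lemma smooth_fun_det:
  fixes M :: "'p \<Rightarrow> real ^ 'i ^ 'i::finite"
  assumes "open S" "\<And>i j. smooth_fun A S (\<lambda>p. M p $ i $ j)"
  shows "smooth_fun A S (\<lambda>p. det (M p))"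
  unfolding det_def by (intro smooth_fun_sum smooth_fun_mult smooth_fun_prod smooth_fun_const assms)

text \<open>Cramer's rule exhibits the solution as a quotient of smooth functions.\<close>

lemma smooth_fun_linear_system:
  fixes M :: "'p \<Rightarrow> real ^ 'i ^ 'i::finite"
  assumes "open S" "\<And>i j. smooth_fun A S (\<lambda>p. M p $ i $ j)" "\<And>i. smooth_fun A S (\<lambda>p. b p $ i)"
    and "\<And>p. p \<in> S \<Longrightarrow> invertible (M p)" "\<And>p. p \<in> S \<Longrightarrow> M p *v x p = b p"
  shows "smooth_fun A S (\<lambda>p. x p $ k)"
proof (rule smooth_fun_cong[OF assms(1)])
  let ?N = "\<lambda>p. (\<chi> i j. if j = k then b p $ i else M p $ i $ j) :: real ^ 'i ^ 'i"
  have *: "smooth_fun A S (\<lambda>p. ?N p $ i $ j)" for i j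
    using assms(2,3) by (cases "j = k") auto
  show "smooth_fun A S (\<lambda>p. det (?N p) / det (M p))"
    by (intro smooth_fun_divide smooth_fun_det assms *) (use assms(4) in \<open>simp add: invertible_det_nz\<close>)
  show "det (?N p) / det (M p) = x p $ k" if "p \<in> S" for p
    using cramer[of "M p" "x p" "b p"] assms(4,5)[OF that] by (simp add: invertible_det_nz)
qed

lemma smooth_fun_coord:
  assumes "(W, \<psi>) \<in> A"
  shows "smooth_fun A W (\<lambda>p. \<psi> p \<bullet> b)"
proof (rule smooth_fun_chartI[OF assms chart_open[OF assms] order_refl])
  have "Ck_on k (\<lambda>x. \<psi> (inv_into W \<psi> x) \<bullet> b) (\<psi> ` W)" for k
    by (rule Ck_on_cong[OF _ _ Ck_on_bounded_linear[OF bounded_linear_inner_left[of b]]])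
       (use chart_image_open[OF assms open_UNIV] assms in auto)
  then show "smooth_on (\<lambda>x. \<psi> (inv_into W \<psi> x) \<bullet> b) (\<psi> ` W)"
    by (simp add: smooth_on_def)
qed

section \<open>Germs of smooth functions\<close>

lemma smooth_nearI: "open S \<Longrightarrow> p \<in> S \<Longrightarrow> smooth_fun A S f \<Longrightarrow> smooth_near A p f"
  unfolding smooth_near_def by blast

text \<open>Tangent vectors test \<open>smooth_near\<close> before they differentiate, so they can
  be local only if this test is.\<close>

lemma smooth_near_cong:
  assumes "open T" "p \<in> T" "\<And>q. q \<in> T \<Longrightarrow> f q = g q"
  shows "smooth_near A p f = smooth_near A p g"
proof -
  have "smooth_near A p g" if "smooth_near A p f" "\<And>q. q \<in> T \<Longrightarrow> f q = g q" for f g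
  proof -
    from that(1) obtain S where "open S" "p \<in> S" "smooth_fun A S f"
      unfolding smooth_near_def by blast
    then show ?thesis
      using assms(1,2) that(2) smooth_fun_cong[of "S \<inter> T" f g] smooth_fun_subset[of S f "S \<inter> T"]
      by (intro smooth_nearI[of "S \<inter> T"]) auto
  qed
  then show ?thesis using assms(3) by metis
qed

lemma smooth_near_join:
  assumes "smooth_near A p f" "smooth_near A p g"
  obtains S where "open S" "p \<in> S" "smooth_fun A S f" "smooth_fun A S g"
proof -
  from assms obtain S T where "open S" "p \<in> S" "smooth_fun A S f" "open T" "p \<in> T" "smooth_fun A T g"
    unfolding smooth_near_def by blast
  then show ?thesis
    by (intro that[of "S \<inter> T"]) (auto intro: smooth_fun_subset)
qed

lemma smooth_near_const [simp]: "smooth_near A p (\<lambda>q. c)"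
  by (rule smooth_nearI[of UNIV]) auto

lemma smooth_near_add:
  "smooth_near A p f \<Longrightarrow> smooth_near A p g \<Longrightarrow> smooth_near A p (\<lambda>q. f q + g q)"
  by (metis smooth_near_join smooth_nearI smooth_fun_add)

lemma smooth_near_mult:
  "smooth_near A p f \<Longrightarrow> smooth_near A p g \<Longrightarrow> smooth_near A p (\<lambda>q. f q * g q)"
  by (metis smooth_near_join smooth_nearI smooth_fun_mult)

lemma smooth_near_sum:
  "(\<And>i. i \<in> I \<Longrightarrow> smooth_near A p (f i)) \<Longrightarrow> smooth_near A p (\<lambda>q. \<Sum>i\<in>I. f i q)"
  by (induction I rule: infinite_finite_induct) (auto intro: smooth_near_add)

lemma smooth_near_differentiable:
  assumes "(W, \<psi>) \<in> A" "p \<in> W" "smooth_near A p f"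
  shows "(\<lambda>x. f (inv_into W \<psi> x)) differentiable (at (\<psi> p))"
proof -
  from assms(3) obtain S where "open S" "p \<in> S" "smooth_fun A S f"
    unfolding smooth_near_def by blast
  then show ?thesis
    using smooth_on_differentiable[OF smooth_fun_chartD[OF assms(1)]] assms(2) by blast
qed

section \<open>Coordinate vectors of a chart\<close>

lemma chart_vec_eq:
  "smooth_near A p f \<Longrightarrow> chart_vec A (W, \<psi>) p w f
     = frechet_derivative (\<lambda>x. f (inv_into W \<psi> x)) (at (\<psi> p)) w"
  by (simp add: chart_vec_def comp_def)

lemma chart_vec_not_smooth: "\<not> smooth_near A p f \<Longrightarrow> chart_vec A c p w f = 0"
  by (simp add: chart_vec_def)

lemma chart_vec_works:
  assumes "(W, \<psi>) \<in> A" "p \<in> W" "smooth_near A p f"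
  shows "((\<lambda>x. f (inv_into W \<psi> x)) has_derivative (\<lambda>w. chart_vec A (W, \<psi>) p w f)) (at (\<psi> p))"
proof -
  have "(\<lambda>w. chart_vec A (W, \<psi>) p w f) = frechet_derivative (\<lambda>x. f (inv_into W \<psi> x)) (at (\<psi> p))"
    using chart_vec_eq[OF assms(3)] by auto
  then show ?thesis
    using smooth_near_differentiable[OF assms] by (simp add: frechet_derivative_works)
qed

lemma chart_vec_unique:
  assumes "(W, \<psi>) \<in> A" "p \<in> W" "smooth_near A p f"
    and "((\<lambda>x. f (inv_into W \<psi> x)) has_derivative D) (at (\<psi> p))"
  shows "chart_vec A (W, \<psi>) p w f = D w"
  using has_derivative_unique[OF chart_vec_works[OF assms(1-3)] assms(4)] by meson

text \<open>On a function that is not smooth near \<open>p\<close> all chart vectors give 0, so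
  linearity extends to functionals on arbitrary functions.\<close>

lemma chart_vec_linear:
  assumes "(W, \<psi>) \<in> A" "p \<in> W"
  shows "linear (chart_vec A (W, \<psi>) p)"
proof -
  have "linear (\<lambda>w. chart_vec A (W, \<psi>) p w f)" for f
  proof (cases "smooth_near A p f")
    case True
    then show ?thesis
      using chart_vec_works[OF assms True] has_derivative_linear by blast
  qed (simp add: chart_vec_not_smooth linear_zero)
  then show ?thesis
    unfolding linear_iff by (auto simp: fun_eq_iff)
qed

lemma chart_vec_cong:
  assumes "(W, \<psi>) \<in> A" "p \<in> W" "open T" "p \<in> T" "\<And>q. q \<in> T \<Longrightarrow> f q = g q"
  shows "chart_vec A (W, \<psi>) p w f = chart_vec A (W, \<psi>) p w g"
proof -
  have "frechet_derivative (\<lambda>x. f (inv_into W \<psi> x)) (at (\<psi> p))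
      = frechet_derivative (\<lambda>x. g (inv_into W \<psi> x)) (at (\<psi> p))"
    by (rule frechet_derivative_cong_open[OF chart_image_open[OF assms(1,3)]]) (use assms in auto)
  then show ?thesis
    using smooth_near_cong[OF assms(3-5)] by (simp add: chart_vec_def comp_def)
qed

lemma smooth_fun_chart_vec:
  assumes "(W, \<psi>) \<in> A" "open S" "S \<subseteq> W" "smooth_fun A S f"
  shows "smooth_fun A S (\<lambda>p. chart_vec A (W, \<psi>) p w f)"
proof (rule smooth_fun_chartI[OF assms(1-3)])
  have o: "open (\<psi> ` S)"
    using chart_image_open[OF assms(1,2)] assms(3) by (simp add: inf_absorb2)
  have "smooth_on (\<lambda>x. f (inv_into W \<psi> x)) (\<psi> ` S)"
    using smooth_fun_chartD[OF assms(1,4)] assms(3) by (simp add: inf_absorb2)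
  then have "smooth_on (\<lambda>x. frechet_derivative (\<lambda>x. f (inv_into W \<psi> x)) (at x) w) (\<psi> ` S)"
    by (rule smooth_on_frechet_derivative)
  moreover have "frechet_derivative (\<lambda>x. f (inv_into W \<psi> x)) (at x) w
      = chart_vec A (W, \<psi>) (inv_into W \<psi> x) w f" if "x \<in> \<psi> ` S" for x
    using that assms by (auto simp: chart_vec_eq[OF smooth_nearI[OF assms(2) _ assms(4)]] subset_iff)
  ultimately show "smooth_on (\<lambda>x. chart_vec A (W, \<psi>) (inv_into W \<psi> x) w f) (\<psi> ` S)"
    unfolding smooth_on_def using Ck_on_cong[OF o] by (metis (no_types, lifting))
qed

text \<open>Vector fields with constant components in one chart commute; in coordinates this is
  \<open>frechet_derivative_commute\<close>.\<close>

lemma chart_vec_commute: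
  assumes "(W, \<psi>) \<in> A" "p \<in> W" "smooth_near A p f"
  shows "chart_vec A (W, \<psi>) p v (\<lambda>q. chart_vec A (W, \<psi>) q w f)
       = chart_vec A (W, \<psi>) p w (\<lambda>q. chart_vec A (W, \<psi>) q v f)"
proof -
  from assms(3) obtain S' where S': "open S'" "p \<in> S'" "smooth_fun A S' f"
    unfolding smooth_near_def by blast
  \<comment> \<open>The inner derivative is differentiated again, so its coordinate form must be
    known on a whole neighbourhood and not just at \<open>p\<close>.\<close>
  define S where "S = W \<inter> S'"
  have S: "open S" "p \<in> S" "S \<subseteq> W" "smooth_fun A S f"
    using S' chart_open[OF assms(1)] assms(2) smooth_fun_subset[OF S'(3)] by (auto simp: S_def)
  have o: "open (\<psi> ` S)"
    using chart_image_open[OF assms(1) S(1)] S(3) by (simp add: inf_absorb2)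
  let ?u = "\<lambda>x. f (inv_into W \<psi> x)"
  have "chart_vec A (W, \<psi>) p v (\<lambda>q. chart_vec A (W, \<psi>) q w f)
      = frechet_derivative (\<lambda>x. frechet_derivative ?u (at x) w) (at (\<psi> p)) v" for v w
  proof -
    have "chart_vec A (W, \<psi>) p v (\<lambda>q. chart_vec A (W, \<psi>) q w f)
        = frechet_derivative (\<lambda>x. chart_vec A (W, \<psi>) (inv_into W \<psi> x) w f) (at (\<psi> p)) v"
      by (rule chart_vec_eq[OF smooth_nearI[OF S(1,2) smooth_fun_chart_vec[OF assms(1) S(1,3,4)]]])
    also have "\<dots> = frechet_derivative (\<lambda>x. frechet_derivative ?u (at x) w) (at (\<psi> p)) v"
      by (subst frechet_derivative_cong_open[OF o,
            where g = "\<lambda>x. frechet_derivative ?u (at x) w"])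
         (use S assms(1) in \<open>auto simp: chart_vec_eq[OF smooth_nearI[OF S(1) _ S(4)]] subset_iff\<close>)
    finally show ?thesis .
  qed
  moreover have "smooth_on ?u (\<psi> ` S)"
    using smooth_fun_chartD[OF assms(1) S(4)] S(3) by (simp add: inf_absorb2)
  ultimately show ?thesis
    using frechet_derivative_commute[OF _ o, of ?u "\<psi> p" w v] S(2) by simp
qed

lemma chart_vec_coord:
  assumes "(W, \<psi>) \<in> A" "p \<in> W"
  shows "chart_vec A (W, \<psi>) p w (\<lambda>q. \<psi> q \<bullet> b) = w \<bullet> b"
proof (rule chart_vec_unique[OF assms smooth_nearI[OF chart_open[OF assms(1)] assms(2) smooth_fun_coord[OF assms(1)]]])
  have "((\<lambda>x. x \<bullet> b) has_derivative (\<lambda>w. w \<bullet> b)) (at (\<psi> p))"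
    by (auto intro!: derivative_eq_intros)
  then show "((\<lambda>x. \<psi> (inv_into W \<psi> x) \<bullet> b) has_derivative (\<lambda>w. w \<bullet> b)) (at (\<psi> p))"
    by (rule has_derivative_transform_within_open[OF _ chart_image_open[OF assms(1) open_UNIV]])
       (use assms in auto)
qed

text \<open>The witness is the image of w under the derivative of the transition map. Both
  functionals vanish on functions that are not smooth near \<open>p\<close>, hence they agree
  everywhere.\<close>

lemma chart_vec_change:
  assumes "(W, \<psi>) \<in> A" "(W', \<psi>') \<in> A" "p \<in> W" "p \<in> W'"
  shows "\<exists>w'. chart_vec A (W', \<psi>') p w = chart_vec A (W, \<psi>) p w'"
proof -
  let ?t = "\<psi> \<circ> inv_into W' \<psi>'"
  have "(?t has_derivative frechet_derivative ?t (at (\<psi>' p))) (at (\<psi>' p))"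
    using smooth_on_differentiable[OF transition_smooth[OF assms(2,1)]] assms(3,4)
    by (simp add: frechet_derivative_works[symmetric])
  note dt = this
  have tp: "?t (\<psi>' p) = \<psi> p"
    using assms by simp
  have "chart_vec A (W', \<psi>') p w f = chart_vec A (W, \<psi>) p (frechet_derivative ?t (at (\<psi>' p)) w) f" for f
  proof (cases "smooth_near A p f")
    case True
    have "((\<lambda>x. f (inv_into W \<psi> (?t x))) has_derivative
        (\<lambda>w. chart_vec A (W, \<psi>) p (frechet_derivative ?t (at (\<psi>' p)) w) f)) (at (\<psi>' p))"
      by (rule has_derivative_compose[OF dt]) (use chart_vec_works[OF assms(1,3) True] tp in simp)
    then have "((\<lambda>x. f (inv_into W' \<psi>' x)) has_derivative
        (\<lambda>w. chart_vec A (W, \<psi>) p (frechet_derivative ?t (at (\<psi>' p)) w) f)) (at (\<psi>' p))"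
      by (rule has_derivative_transform_within_open[OF _ chart_image_open[OF assms(2) chart_open[OF assms(1)]]])
         (use assms in auto)
    from chart_vec_unique[OF assms(2,4) True this] show ?thesis .
  qed (simp add: chart_vec_not_smooth)
  then show ?thesis by blast
qed

section \<open>The tangent space and its vectors as derivations\<close>

lemma tangent_space_eq:
  assumes "(W, \<psi>) \<in> A" "p \<in> W"
  shows "tangent_space A p = range (chart_vec A (W, \<psi>) p)"
proof
  show "tangent_space A p \<subseteq> range (chart_vec A (W, \<psi>) p)"
    unfolding tangent_space_def using chart_vec_change[OF assms(1) _ assms(2)] by fastforce
  show "range (chart_vec A (W, \<psi>) p) \<subseteq> tangent_space A p"
    unfolding tangent_space_def using assms by fastforce
qed

lemma chart_vec_tangent: "(W, \<psi>) \<in> A \<Longrightarrow> p \<in> W \<Longrightarrow> chart_vec A (W, \<psi>) p w \<in> tangent_space A p"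
  by (simp add: tangent_space_eq)

lemma subspace_tangent_space: "subspace (tangent_space A p)"
proof -
  obtain W \<psi> where "(W, \<psi>) \<in> A" "p \<in> W"
    using chart_cover by blast
  then show ?thesis
    using linear_subspace_image[OF chart_vec_linear subspace_UNIV] by (simp add: tangent_space_eq)
qed

lemma tangent_obtain:
  assumes "v \<in> tangent_space A p"
  obtains W \<psi> w where "(W, \<psi>) \<in> A" "p \<in> W" "v = chart_vec A (W, \<psi>) p w"
  using assms unfolding tangent_space_def by force

lemma tangent_cong:
  assumes "v \<in> tangent_space A p" "open T" "p \<in> T" "\<And>q. q \<in> T \<Longrightarrow> f q = g q"
  shows "v f = v g"
  using assms(1)
proof (rule tangent_obtain)
  fix W \<psi> w assume *: "(W, \<psi>) \<in> A" "p \<in> W" "v = chart_vec A (W, \<psi>) p w"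
  show ?thesis
    unfolding *(3) by (rule chart_vec_cong[OF *(1,2) assms(2-4)])
qed

lemma tangent_add:
  assumes "v \<in> tangent_space A p" "smooth_near A p f" "smooth_near A p g"
  shows "v (\<lambda>q. f q + g q) = v f + v g"
  using assms(1)
proof (rule tangent_obtain)
  fix W \<psi> w assume *: "(W, \<psi>) \<in> A" "p \<in> W" "v = chart_vec A (W, \<psi>) p w"
  show ?thesis
    unfolding *(3)
    by (rule chart_vec_unique[OF *(1,2) smooth_near_add[OF assms(2,3)]])
       (intro has_derivative_add chart_vec_works * assms)
qed

lemma tangent_mult:
  assumes "v \<in> tangent_space A p" "smooth_near A p f" "smooth_near A p g"
  shows "v (\<lambda>q. f q * g q) = f p * v g + v f * g p"
  using assms(1)
proof (rule tangent_obtain)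
  fix W \<psi> w assume *: "(W, \<psi>) \<in> A" "p \<in> W" "v = chart_vec A (W, \<psi>) p w"
  show ?thesis
    using chart_vec_unique[OF *(1,2) smooth_near_mult[OF assms(2,3)]
        has_derivative_mult[OF chart_vec_works[OF *(1,2) assms(2)] chart_vec_works[OF *(1,2) assms(3)]]] *
    by simp
qed

lemma tangent_const [simp]:
  assumes "v \<in> tangent_space A p"
  shows "v (\<lambda>q. c) = 0"
  using assms
proof (rule tangent_obtain)
  fix W \<psi> w assume *: "(W, \<psi>) \<in> A" "p \<in> W" "v = chart_vec A (W, \<psi>) p w"
  show ?thesis
    unfolding *(3) by (rule chart_vec_unique[OF *(1,2) smooth_near_const]) simp
qed

lemma tangent_uminus:
  assumes "v \<in> tangent_space A p" "smooth_near A p f"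
  shows "v (\<lambda>q. - f q) = - v f"
  using tangent_mult[OF assms(1) smooth_near_const[of p "-1"] assms(2)] tangent_const[OF assms(1)]
  by simp

lemma tangent_sum:
  assumes "v \<in> tangent_space A p" "\<And>i. i \<in> I \<Longrightarrow> smooth_near A p (f i)"
  shows "v (\<lambda>q. \<Sum>i\<in>I. f i q) = (\<Sum>i\<in>I. v (f i))"
  using assms(2)
  by (induction I rule: infinite_finite_induct)
     (simp_all add: tangent_const[OF assms(1)] tangent_add[OF assms(1)] smooth_near_sum)

text \<open>Reading off components by means of the coordinate functions is how anchors and vertical
  vectors are expanded later on.\<close>

lemma tangent_chart_vec:
  assumes "v \<in> tangent_space A p" "(W, \<psi>) \<in> A" "p \<in> W"
  shows "v = (\<Sum>b\<in>Basis. v (\<lambda>q. \<psi> q \<bullet> b) *\<^sub>R chart_vec A (W, \<psi>) p b)"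
proof -
  from assms obtain w where w: "v = chart_vec A (W, \<psi>) p w"
    by (auto simp: tangent_space_eq)
  have "chart_vec A (W, \<psi>) p w = chart_vec A (W, \<psi>) p (\<Sum>b\<in>Basis. (w \<bullet> b) *\<^sub>R b)"
    by (simp add: euclidean_representation)
  also have "\<dots> = (\<Sum>b\<in>Basis. (w \<bullet> b) *\<^sub>R chart_vec A (W, \<psi>) p b)"
    by (simp only: linear_sum[OF chart_vec_linear[OF assms(2,3)]]
        linear_cmul[OF chart_vec_linear[OF assms(2,3)]])
  finally show ?thesis
    unfolding w chart_vec_coord[OF assms(2,3)] .
qed

end

section \<open>Bases and sections of the prolongation\<close>

lemma is_basis_unique:
  assumes "is_basis B S" "(\<Sum>i\<in>UNIV. c i *\<^sub>R B i) = (\<Sum>i\<in>UNIV. d i *\<^sub>R B i)"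
  shows "c = d"
proof
  fix i
  have inj: "inj B" and ind: "independent (range B)"
    using assms(1) by (auto simp: is_basis_def)
  have "(\<Sum>v\<in>range B. (c (inv B v) - d (inv B v)) *\<^sub>R v) = (\<Sum>i\<in>UNIV. (c i - d i) *\<^sub>R B i)"
    using sum.reindex[OF inj, of "\<lambda>v. (c (inv B v) - d (inv B v)) *\<^sub>R v"] inj by simp
  also have "\<dots> = 0"
    using assms(2) by (simp add: scaleR_left_diff_distrib sum_subtractf)
  finally have "c (inv B (B i)) - d (inv B (B i)) = 0"
    using ind by (intro independentD[OF ind, of "range B"]) auto
  then show "c i = d i"
    using inj by simp
qed

lemma coeffs_eq:
  assumes "is_basis B S" "v = (\<Sum>i\<in>UNIV. c i *\<^sub>R B i)"
  shows "coeffs B v = c"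
  unfolding coeffs_def using assms is_basis_unique[OF assms(1)] by (intro the_equality) auto

lemma is_basis_sum:
  assumes "is_basis B S" "v \<in> S"
  shows "(\<Sum>i\<in>UNIV. coeffs B v i *\<^sub>R B i) = v"
proof -
  have inj: "inj B" and "v \<in> span (range B)"
    using assms by (auto simp: is_basis_def)
  then obtain u where "v = (\<Sum>x\<in>range B. u x *\<^sub>R x)"
    by (auto simp: span_finite)
  then have "v = (\<Sum>i\<in>UNIV. u (B i) *\<^sub>R B i)"
    by (simp add: sum.reindex[OF inj])
  with coeffs_eq[OF assms(1) this] show ?thesis by simp
qed

lemma is_basisI:
  fixes B :: "'i::finite \<Rightarrow> 'v::real_vector"
  assumes "subspace S" "\<And>i. B i \<in> S" "\<And>v. v \<in> S \<Longrightarrow> \<exists>c. v = (\<Sum>i\<in>UNIV. c i *\<^sub>R B i)"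
    and zero: "\<And>c. (\<Sum>i\<in>UNIV. c i *\<^sub>R B i) = 0 \<Longrightarrow> c = (\<lambda>_. 0)"
  shows "is_basis B S"
  unfolding is_basis_def
proof (intro conjI)
  have d: "(\<Sum>i\<in>UNIV. (if i = k then a else 0) *\<^sub>R B i) = a *\<^sub>R B k" for k a
    by (simp add: if_distrib[of "\<lambda>c. c *\<^sub>R _"] sum.delta cong: if_cong)
  show inj: "inj B"
  proof (rule injI, rule ccontr)
    fix i j assume ij: "B i = B j" "i \<noteq> j"
    have "(\<Sum>k\<in>UNIV. ((if k = i then 1 else 0) - (if k = j then 1 else 0)) *\<^sub>R B k) = 0"
      by (simp add: scaleR_left_diff_distrib sum_subtractf d ij)
    from fun_cong[OF zero[OF this], of i] show False
      using ij by simp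
  qed
  show "independent (range B)"
  proof (rule independent_if_scalars_zero)
    fix u v assume u: "(\<Sum>x\<in>range B. u x *\<^sub>R x) = 0" and "v \<in> range B"
    then obtain i where i: "v = B i" by blast
    have "(\<Sum>i\<in>UNIV. u (B i) *\<^sub>R B i) = 0"
      using u by (simp add: sum.reindex[OF inj])
    from zero[OF this] show "u v = 0"
      using i by meson
  qed simp
  show "span (range B) = S"
  proof
    show "span (range B) \<subseteq> S"
      using assms(1,2) by (intro span_minimal) auto
    show "S \<subseteq> span (range B)"
    proof
      fix v assume "v \<in> S"
      then obtain c where "v = (\<Sum>i\<in>UNIV. c i *\<^sub>R B i)"
        using assms(3) by blast
      then show "v \<in> span (range B)"
        by (auto intro: span_sum span_scale span_base)
    qed
  qed
qed

lemma is_basis_mem: "is_basis B S \<Longrightarrow> B i \<in> S"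
  unfolding is_basis_def using span_base[of "B i" "range B"] by auto

lemma is_basis_subspace: "is_basis B S \<Longrightarrow> subspace S"
  unfolding is_basis_def using subspace_span by auto

lemma coeffs_linear:
  assumes "is_basis B S" "v \<in> S" "w \<in> S"
  shows "coeffs B (r *\<^sub>R v + s *\<^sub>R w) i = r * coeffs B v i + s * coeffs B w i"
proof -
  have "r *\<^sub>R v + s *\<^sub>R w = r *\<^sub>R (\<Sum>i\<in>UNIV. coeffs B v i *\<^sub>R B i) + s *\<^sub>R (\<Sum>i\<in>UNIV. coeffs B w i *\<^sub>R B i)"
    using is_basis_sum[OF assms(1)] assms(2,3) by simp
  also have "\<dots> = (\<Sum>i\<in>UNIV. (r * coeffs B v i + s * coeffs B w i) *\<^sub>R B i)"
    by (simp add: scaleR_sum_right scaleR_left_distrib sum.distrib)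
  finally show ?thesis
    using coeffs_eq[OF assms(1)] by metis
qed

lemma coeffs_sum:
  assumes "is_basis B S" "finite I" "\<And>k. k \<in> I \<Longrightarrow> v k \<in> S"
  shows "coeffs B (\<Sum>k\<in>I. r k *\<^sub>R v k) i = (\<Sum>k\<in>I. r k * coeffs B (v k) i)"
  using assms(2,3)
proof (induction I)
  case empty
  have "coeffs B 0 = (\<lambda>_. 0)"
    by (rule coeffs_eq[OF assms(1)]) simp
  then show ?case by simp
next
  case (insert k I)
  have "(\<Sum>k\<in>I. r k *\<^sub>R v k) \<in> S"
    using insert.prems is_basis_subspace[OF assms(1)] by (auto intro!: subspace_sum subspace_scale)
  with coeffs_linear[OF assms(1), of "v k" "\<Sum>k\<in>I. r k *\<^sub>R v k" "r k" 1] insert show ?case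
    by simp
qed

lemma coeffs_basis:
  assumes "is_basis B S"
  shows "coeffs B (B j) = (\<lambda>i. if i = j then 1 else 0)"
  by (rule coeffs_eq[OF assms]) (simp add: if_distrib[of "\<lambda>c. c *\<^sub>R _"] sum.delta cong: if_cong)

lemma fst_sum: "fst (\<Sum>i\<in>I. f i) = (\<Sum>i\<in>I. fst (f i))"
  by (induction I rule: infinite_finite_induct) auto

lemma snd_sum: "snd (\<Sum>i\<in>I. f i) = (\<Sum>i\<in>I. snd (f i))"
  by (induction I rule: infinite_finite_induct) auto

lemma sum_fun_apply: "(\<Sum>i\<in>I. f i) x = (\<Sum>i\<in>I. f i x)"
  by (induction I rule: infinite_finite_induct) auto

lemma sum_Basis_vec: "(\<Sum>b\<in>(Basis :: (real ^ 'n) set). f b) = (\<Sum>i\<in>(UNIV :: 'n::finite set). f (axis i 1))"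
proof -
  have "(Basis :: (real ^ 'n) set) = range (\<lambda>i. axis i 1)"
    by (auto simp: Basis_vec_def)
  moreover have "inj (\<lambda>i::'n. axis i (1::real))"
    by (auto simp: inj_def axis_eq_axis)
  ultimately show ?thesis
    by (metis (no_types, lifting) sum.reindex_cong)
qed

lemma sum_UNIV_Plus:
  "(\<Sum>\<alpha>\<in>(UNIV :: ('a::finite + 'b::finite) set). f \<alpha>) = (\<Sum>a\<in>UNIV. f (Inl a)) + (\<Sum>b\<in>UNIV. f (Inr b))"
  by (simp add: UNIV_Plus_UNIV[symmetric] sum.Plus del: UNIV_Plus_UNIV)

section \<open>The fibration, the anchor and the fibres of the prolongation\<close>

locale n_connection =
  fixes AM :: "('m::topological_space, real ^ 'n::finite) atlas"
    and AP :: "('p::topological_space, (real ^ 'n) \<times> (real ^ 'k::finite)) atlas"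
    and \<pi> :: "'p \<Rightarrow> 'm"
    and E :: "('m, 'e::real_vector, 'r::finite) algebroid"
    and h :: "'p \<Rightarrow> ('e, 'p) prol set"
  assumes fibration: "fibration AM AP \<pi>"
    and algebroid: "lie_algebroid AM E"
    and N_conn: "N_connection AM AP \<pi> E h"
begin

sublocale M: manifold AM
  by unfold_locales (use fibration in \<open>simp add: fibration_def\<close>)

sublocale P: manifold AP
  by unfold_locales (use fibration in \<open>simp add: fibration_def\<close>)

lemma open_preimage: "open S \<Longrightarrow> open (\<pi> -` S)"
  using fibration by (auto simp: fibration_def smooth_map_def intro: open_vimage)

lemma smooth_fun_pullback:
  assumes "open S" "smooth_fun AM S f"
  shows "smooth_fun AP (\<pi> -` S) (\<lambda>p. f (\<pi> p))"
proof -
  have "smooth_fun AP (\<pi> -` S) (f \<circ> \<pi>)"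
    using fibration assms unfolding fibration_def smooth_map_def by blast
  then show ?thesis by (simp add: comp_def)
qed

lemma smooth_near_pullback: "smooth_near AM (\<pi> p) f \<Longrightarrow> smooth_near AP p (\<lambda>q. f (\<pi> q))"
  unfolding smooth_near_def using smooth_fun_pullback open_preimage by blast

lemma vector_bundle: "vector_bundle AM E"
  using algebroid by (simp add: lie_algebroid_def)

lemma subspace_Fib: "subspace (Fib E x)"
  using vector_bundle by (simp add: vector_bundle_def)

lemma Frames_basis: "(U, e) \<in> Frames E \<Longrightarrow> x \<in> U \<Longrightarrow> is_basis (\<lambda>a. e a x) (Fib E x)"
  using vector_bundle unfolding vector_bundle_def by blast

lemma Frames_open: "(U, e) \<in> Frames E \<Longrightarrow> open U"
  using vector_bundle unfolding vector_bundle_def by blast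

lemma Frames_cover: "\<exists>U e. (U, e) \<in> Frames E \<and> x \<in> U"
proof -
  have "x \<in> \<Union>(fst ` Frames E)"
    using vector_bundle by (simp add: vector_bundle_def)
  then show ?thesis by force
qed

lemma Anchor_tangent: "b \<in> Fib E x \<Longrightarrow> Anchor E x b \<in> tangent_space AM x"
  using algebroid by (simp add: lie_algebroid_def)

lemma Anchor_linear:
  "b \<in> Fib E x \<Longrightarrow> b' \<in> Fib E x \<Longrightarrow>
    Anchor E x (r *\<^sub>R b + s *\<^sub>R b') = r *\<^sub>R Anchor E x b + s *\<^sub>R Anchor E x b'"
  using algebroid by (simp add: lie_algebroid_def)

lemma Anchor_zero: "Anchor E x 0 = 0"
  using Anchor_linear[of 0 x 0 0 0] subspace_0[OF subspace_Fib] by simp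

lemma Anchor_smooth:
  assumes "open S" "bundle_section AM E S s" "smooth_fun AM S f"
  shows "smooth_fun AM S (\<lambda>x. Anchor E x (s x) f)"
proof -
  have "\<forall>S s f. open S \<longrightarrow> bundle_section AM E S s \<longrightarrow> smooth_fun AM S f \<longrightarrow>
        smooth_fun AM S (\<lambda>x. Anchor E x (s x) f)"
    using algebroid unfolding lie_algebroid_def by (elim conjE)
  with assms show ?thesis by blast
qed

lemma push_forward_linear:
  "push_forward AM \<pi> p (r *\<^sub>R v + s *\<^sub>R w) = r *\<^sub>R push_forward AM \<pi> p v + s *\<^sub>R push_forward AM \<pi> p w"
  by (auto simp: push_forward_def fun_eq_iff)

lemma subspace_prol_fib: "subspace (prol_fib AM AP \<pi> E p)"
proof (rule subspaceI)
  show "0 \<in> prol_fib AM AP \<pi> E p"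
    using subspace_0[OF subspace_Fib, of "\<pi> p"] subspace_0[OF P.subspace_tangent_space, of p]
      push_forward_linear[of p 0 0 0 0]
    by (simp add: prol_fib_def Anchor_zero zero_prod_def)
  have *: "r *\<^sub>R x + s *\<^sub>R y \<in> prol_fib AM AP \<pi> E p"
    if "x \<in> prol_fib AM AP \<pi> E p" "y \<in> prol_fib AM AP \<pi> E p" for x y r s
    using that subspace_Fib[of "\<pi> p"] P.subspace_tangent_space[of p]
    by (cases x; cases y)
       (auto simp: prol_fib_def push_forward_linear Anchor_linear
          intro!: subspace_add subspace_scale)
  show "x + y \<in> prol_fib AM AP \<pi> E p"
    if "x \<in> prol_fib AM AP \<pi> E p" "y \<in> prol_fib AM AP \<pi> E p" for x y
    using *[OF that, of 1 1] by simp
  show "r *\<^sub>R x \<in> prol_fib AM AP \<pi> E p" if "x \<in> prol_fib AM AP \<pi> E p" for x r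
    using *[OF that that, of r 0] by simp
qed

lemma subspace_prol_vert: "subspace (prol_vert AM AP \<pi> E p)"
  using subspace_prol_fib[of p] unfolding prol_vert_def
  by (auto simp: subspace_def)

lemma subspace_h: "subspace (h p)"
  using N_conn by (simp add: N_connection_def)

lemma h_vert_disjoint: "z \<in> h p \<Longrightarrow> z \<in> prol_vert AM AP \<pi> E p \<Longrightarrow> z = 0"
  using N_conn unfolding N_connection_def by blast

lemma h_vert_sum: "{u + w | u w. u \<in> h p \<and> w \<in> prol_vert AM AP \<pi> E p} = prol_fib AM AP \<pi> E p"
  using N_conn by (simp add: N_connection_def)

lemma h_subset: "z \<in> h p \<Longrightarrow> z \<in> prol_fib AM AP \<pi> E p"
proof -
  assume "z \<in> h p"
  then have "z + 0 \<in> {u + w | u w. u \<in> h p \<and> w \<in> prol_vert AM AP \<pi> E p}"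
    using subspace_0[OF subspace_prol_vert] by blast
  then show ?thesis
    by (simp only: h_vert_sum add_0_right)
qed

lemma vert_subset: "z \<in> prol_vert AM AP \<pi> E p \<Longrightarrow> z \<in> prol_fib AM AP \<pi> E p"
  by (simp add: prol_vert_def)

lemma prol_fib_tangent: "z \<in> prol_fib AM AP \<pi> E p \<Longrightarrow> snd z \<in> tangent_space AP p"
  by (auto simp: prol_fib_def)

section \<open>Smooth sections of the prolongation\<close>

lemma prol_section_mem: "prol_section AM AP \<pi> E S Z \<Longrightarrow> p \<in> S \<Longrightarrow> Z p \<in> prol_fib AM AP \<pi> E p"
  by (simp add: prol_section_def)

lemma prol_section_subset: "prol_section AM AP \<pi> E S Z \<Longrightarrow> T \<subseteq> S \<Longrightarrow> prol_section AM AP \<pi> E T Z"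
  unfolding prol_section_def
proof (elim conjE, intro conjI)
  assume T: "T \<subseteq> S" and
    S: "\<forall>(U, e)\<in>Frames E. \<forall>a. smooth_fun AP (S \<inter> \<pi> -` U) (\<lambda>p. coeffs (\<lambda>a. e a (\<pi> p)) (fst (Z p)) a)"
  show "\<forall>(U, e)\<in>Frames E. \<forall>a. smooth_fun AP (T \<inter> \<pi> -` U) (\<lambda>p. coeffs (\<lambda>a. e a (\<pi> p)) (fst (Z p)) a)"
  proof clarify
    fix U e a assume "(U, e) \<in> Frames E"
    then have "smooth_fun AP (S \<inter> \<pi> -` U) (\<lambda>p. coeffs (\<lambda>a. e a (\<pi> p)) (fst (Z p)) a)"
      using S by blast
    then show "smooth_fun AP (T \<inter> \<pi> -` U) (\<lambda>p. coeffs (\<lambda>a. e a (\<pi> p)) (fst (Z p)) a)"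
      by (rule P.smooth_fun_subset) (use T in blast)
  qed
qed blast+

lemma prol_section_smooth:
  "prol_section AM AP \<pi> E S Z \<Longrightarrow> open T \<Longrightarrow> T \<subseteq> S \<Longrightarrow> smooth_fun AP T f \<Longrightarrow>
    smooth_fun AP T (\<lambda>p. snd (Z p) f)"
  unfolding prol_section_def by blast

lemma prol_section_cong:
  assumes "open S" "\<And>p. p \<in> S \<Longrightarrow> Y p = Z p" "prol_section AM AP \<pi> E S Y"
  shows "prol_section AM AP \<pi> E S Z"
  unfolding prol_section_def
proof (intro conjI ballI allI impI)
  show "Z p \<in> prol_fib AM AP \<pi> E p" if "p \<in> S" for p
    using prol_section_mem[OF assms(3) that] assms(2)[OF that] by simp
  show "case Ue of (U, e) \<Rightarrow> \<forall>a. smooth_fun AP (S \<inter> \<pi> -` U) (\<lambda>p. coeffs (\<lambda>a. e a (\<pi> p)) (fst (Z p)) a)"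
    if "Ue \<in> Frames E" for Ue
  proof (cases Ue)
    case (Pair U e)
    have "smooth_fun AP (S \<inter> \<pi> -` U) (\<lambda>p. coeffs (\<lambda>a. e a (\<pi> p)) (fst (Z p)) a)" for a
      by (rule P.smooth_fun_cong[of _ "\<lambda>p. coeffs (\<lambda>a. e a (\<pi> p)) (fst (Y p)) a"])
         (use Pair that assms Frames_open open_preimage in \<open>auto simp: prol_section_def\<close>)
    then show ?thesis using Pair by simp
  qed
  show "smooth_fun AP T (\<lambda>p. snd (Z p) f)" if "open T" "T \<subseteq> S" "smooth_fun AP T f" for T f
    by (rule P.smooth_fun_cong[OF that(1) _ prol_section_smooth[OF assms(3) that]])
       (use that assms(2) in auto)
qed

text \<open>Needed for gluing: smoothness of the glued derivative of a section is checked in one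
  chart after the other.\<close>

lemma prol_section_local:
  assumes "\<And>p. p \<in> S \<Longrightarrow> \<exists>T. open T \<and> p \<in> T \<and> prol_section AM AP \<pi> E T Z"
  shows "prol_section AM AP \<pi> E S Z"
  unfolding prol_section_def
proof (intro conjI ballI allI impI)
  show "Z p \<in> prol_fib AM AP \<pi> E p" if "p \<in> S" for p
    using assms[OF that] prol_section_mem by blast
  show "case Ue of (U, e) \<Rightarrow> \<forall>a. smooth_fun AP (S \<inter> \<pi> -` U) (\<lambda>p. coeffs (\<lambda>a. e a (\<pi> p)) (fst (Z p)) a)"
    if Ue: "Ue \<in> Frames E" for Ue
  proof (cases Ue)
    case (Pair U e)
    have "smooth_fun AP (S \<inter> \<pi> -` U) (\<lambda>p. coeffs (\<lambda>a. e a (\<pi> p)) (fst (Z p)) a)" for a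
    proof (rule P.smooth_fun_local)
      fix p assume "p \<in> S \<inter> \<pi> -` U"
      moreover then obtain T where T: "open T" "p \<in> T" "prol_section AM AP \<pi> E T Z"
        using assms by blast
      moreover have "smooth_fun AP (T \<inter> \<pi> -` U) (\<lambda>p. coeffs (\<lambda>a. e a (\<pi> p)) (fst (Z p)) a)"
        using T(3) Ue Pair unfolding prol_section_def by blast
      moreover have "open (T \<inter> \<pi> -` U)"
        using T(1) Ue Pair Frames_open open_preimage by blast
      ultimately show "\<exists>T. open T \<and> p \<in> T \<and> smooth_fun AP T (\<lambda>p. coeffs (\<lambda>a. e a (\<pi> p)) (fst (Z p)) a)"
        by (intro exI[of _ "T \<inter> \<pi> -` U"]) auto
    qed
    then show ?thesis using Pair by simp
  qed
  show "smooth_fun AP S' (\<lambda>p. snd (Z p) f)" if S': "open S'" "S' \<subseteq> S" "smooth_fun AP S' f" for S' f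
  proof (rule P.smooth_fun_local)
    fix p assume "p \<in> S'"
    moreover then obtain T where T: "open T" "p \<in> T" "prol_section AM AP \<pi> E T Z"
      using assms S'(2) by blast
    ultimately show "\<exists>T. open T \<and> p \<in> T \<and> smooth_fun AP T (\<lambda>p. snd (Z p) f)"
      using S'(1) P.smooth_fun_subset[OF S'(3), of "S' \<inter> T"] prol_section_smooth[OF T(3), of "S' \<inter> T" f]
      by (intro exI[of _ "S' \<inter> T"]) auto
  qed
qed

end

text \<open>The frame gets a layer of its own, below the fibred chart: the final connection depends
  on the frame, while two charts over the same frame have to be compared.\<close>

locale framed_n_connection = n_connection AM AP \<pi> E h
  for AM :: "('m::topological_space, real ^ 'n::finite) atlas"
    and AP :: "('p::topological_space, (real ^ 'n) \<times> (real ^ 'k::finite)) atlas"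
    and \<pi> :: "'p \<Rightarrow> 'm"
    and E :: "('m, 'e::real_vector, 'r::finite) algebroid"
    and h :: "'p \<Rightarrow> ('e, 'p) prol set" +
  fixes U :: "'m set" and e :: "'r \<Rightarrow> 'm \<Rightarrow> 'e"
  assumes frame: "local_frame AM E U e"
begin

lemma U_open: "open U"
  using frame by (simp add: local_frame_def)

lemma frame_basis: "x \<in> U \<Longrightarrow> is_basis (\<lambda>a. e a x) (Fib E x)"
  using frame by (simp add: local_frame_def)

lemma frame_section: "bundle_section AM E U (e a)"
  using frame by (simp add: local_frame_def)

lemma frame_transition_smooth:
  assumes "(U', e') \<in> Frames E"
  shows "smooth_fun AP (\<pi> -` (U \<inter> U')) (\<lambda>p. coeffs (\<lambda>a. e' a (\<pi> p)) (e b (\<pi> p)) a)"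
proof -
  have "smooth_fun AM (U \<inter> U') (\<lambda>x. coeffs (\<lambda>a. e' a x) (e b x) a)"
    using frame_section[of b] assms unfolding bundle_section_def by blast
  from smooth_fun_pullback[OF _ this] show ?thesis
    using U_open Frames_open[OF assms] by auto
qed

text \<open>The components in the frame \<open>e\<close> solve the linear system given by the transition matrix to a
  frame of the atlas.\<close>

lemma section_coeffs_smooth:
  assumes "open S" "S \<subseteq> \<pi> -` U" "prol_section AM AP \<pi> E S Z"
  shows "smooth_fun AP S (\<lambda>p. coeffs (\<lambda>a. e a (\<pi> p)) (fst (Z p)) a)"
proof (rule P.smooth_fun_local)
  fix p assume p: "p \<in> S"
  obtain U' e' where U': "(U', e') \<in> Frames E" "\<pi> p \<in> U'"
    using Frames_cover by blast
  define T where "T = S \<inter> \<pi> -` U'"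
  have T: "open T" "p \<in> T" "T \<subseteq> \<pi> -` (U \<inter> U')"
    using assms(1,2) p U' Frames_open[OF U'(1)] open_preimage by (auto simp: T_def)
  let ?c' = "\<lambda>p. coeffs (\<lambda>a. e' a (\<pi> p))" and ?c = "\<lambda>p. coeffs (\<lambda>a. e a (\<pi> p))"
  let ?M = "\<lambda>p. (\<chi> b a. ?c' p (e a (\<pi> p)) b)"
  \<comment> \<open>Multiplication by the transition matrix turns components in \<open>e\<close>
    into components in \<open>e'\<close>.\<close>
  have mv: "(\<chi> b. ?c' q (\<Sum>a\<in>UNIV. x $ a *\<^sub>R e a (\<pi> q)) b) = ?M q *v x" if "q \<in> T" for q x
  proof -
    have U: "\<pi> q \<in> U" "\<pi> q \<in> U'"
      using that T(3) by auto
    have "?c' q (\<Sum>a\<in>UNIV. x $ a *\<^sub>R e a (\<pi> q)) b = (\<Sum>a\<in>UNIV. x $ a * ?c' q (e a (\<pi> q)) b)" for b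
      by (rule coeffs_sum[OF Frames_basis[OF U'(1) U(2)] finite])
         (rule is_basis_mem[OF frame_basis[OF U(1)]])
    then show ?thesis
      by (simp add: vec_eq_iff matrix_vector_mult_def mult.commute)
  qed
  have "smooth_fun AP T (\<lambda>p. (\<chi> a. ?c p (fst (Z p)) a) $ a)"
  proof (rule P.smooth_fun_linear_system[OF T(1)])
    show "smooth_fun AP T (\<lambda>p. ?M p $ i $ j)" for i j
      using P.smooth_fun_subset[OF frame_transition_smooth[OF U'(1)] T(3)] by simp
    show "smooth_fun AP T (\<lambda>p. (\<chi> b. ?c' p (fst (Z p)) b) $ i)" for i
      using assms(3) U'(1) unfolding prol_section_def T_def by auto
    fix q assume q: "q \<in> T"
    have Fib: "fst (Z q) \<in> Fib E (\<pi> q)"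
      using prol_section_mem[OF assms(3), of q] q by (auto simp: T_def prol_fib_def)
    have U: "\<pi> q \<in> U" "\<pi> q \<in> U'"
      using q T(3) by auto
    show "?M q *v (\<chi> a. ?c q (fst (Z q)) a) = (\<chi> b. ?c' q (fst (Z q)) b)"
      unfolding mv[OF q, symmetric] using is_basis_sum[OF frame_basis[OF U(1)] Fib] by simp
    \<comment> \<open>The transition matrix has trivial kernel: a vector without components in the
      basis \<open>e'\<close> is zero, and \<open>e\<close> is linearly independent.\<close>
    have "x = 0" if "?M q *v x = 0" for x
    proof -
      have *: "?c' q (\<Sum>a\<in>UNIV. x $ a *\<^sub>R e a (\<pi> q)) = (\<lambda>_. 0)"
        using that unfolding mv[OF q, symmetric] by (simp add: vec_eq_iff fun_eq_iff)
      have "(\<Sum>a\<in>UNIV. x $ a *\<^sub>R e a (\<pi> q)) \<in> Fib E (\<pi> q)"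
        using is_basis_mem[OF frame_basis[OF U(1)]] subspace_Fib
        by (auto intro!: subspace_sum subspace_scale)
      from is_basis_sum[OF Frames_basis[OF U'(1) U(2)] this]
      have "(\<Sum>a\<in>UNIV. x $ a *\<^sub>R e a (\<pi> q)) = (\<Sum>a\<in>UNIV. 0 *\<^sub>R e a (\<pi> q))"
        unfolding * by simp
      from is_basis_unique[OF frame_basis[OF U(1)] this] show ?thesis
        by (auto simp: vec_eq_iff fun_eq_iff)
    qed
    then have "\<exists>B. B ** ?M q = mat 1"
      by (simp only: matrix_left_invertible_ker) blast
    then show "invertible (?M q)"
      by (simp add: invertible_left_inverse)
  qed
  then show "\<exists>T. open T \<and> p \<in> T \<and> smooth_fun AP T (\<lambda>p. ?c p (fst (Z p)) a)"
    using T by auto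
qed

end

section \<open>The N-adapted frame of a fibred chart\<close>

lemma sum_Basis_prod:
  "(\<Sum>b\<in>(Basis :: ('a::euclidean_space \<times> 'b::euclidean_space) set). f b)
    = (\<Sum>b\<in>Basis. f (b, 0)) + (\<Sum>b\<in>Basis. f (0, b))"
proof -
  have "inj_on (\<lambda>u. (u::'a, 0::'b)) Basis" "inj_on (\<lambda>u. (0::'a, u::'b)) Basis"
    by (auto intro!: inj_onI)
  then show ?thesis
    unfolding Basis_prod_def
    by (subst sum.union_disjoint) (auto simp: Basis_prod_def sum.reindex)
qed

locale charted_n_connection = framed_n_connection AM AP \<pi> E h U e
  for AM :: "('m::topological_space, real ^ 'n::finite) atlas"
    and AP :: "('p::topological_space, (real ^ 'n) \<times> (real ^ 'k::finite)) atlas"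
    and \<pi> :: "'p \<Rightarrow> 'm"
    and E :: "('m, 'e::real_vector, 'r::finite) algebroid"
    and h :: "'p \<Rightarrow> ('e, 'p) prol set"
    and U :: "'m set" and e :: "'r \<Rightarrow> 'm \<Rightarrow> 'e" +
  fixes V :: "'m set" and \<phi> :: "'m \<Rightarrow> real ^ 'n" and W :: "'p set" and \<psi> :: "'p \<Rightarrow> (real ^ 'n) \<times> (real ^ 'k)"
  assumes fibred: "((V, \<phi>), (W, \<psi>)) \<in> fibred_charts AM AP \<pi>"
begin

abbreviation "chart \<equiv> ((V, \<phi>), (W, \<psi>))"
abbreviation dx :: "'n \<Rightarrow> 'p \<Rightarrow> 'p tangent" where "dx i p \<equiv> chart_vec AP (W, \<psi>) p (axis i 1, 0)"
abbreviation dy :: "'k \<Rightarrow> 'p \<Rightarrow> 'p tangent" where "dy A p \<equiv> chart_vec AP (W, \<psi>) p (0, axis A 1)"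
abbreviation y :: "'k \<Rightarrow> 'p \<Rightarrow> real" where "y A \<equiv> \<lambda>q. \<psi> q \<bullet> (0, axis A 1)"
abbreviation \<rho> :: "'r \<Rightarrow> 'n \<Rightarrow> 'p \<Rightarrow> real" where "\<rho> a i p \<equiv> anchor_coeff E (V, \<phi>) e a i (\<pi> p)"
abbreviation N :: "'k \<Rightarrow> 'r \<Rightarrow> 'p \<Rightarrow> real" where "N \<equiv> N_coeff AP \<pi> E h chart e"
abbreviation X :: "'r \<Rightarrow> 'p \<Rightarrow> ('e, 'p) prol" where "X \<equiv> X_frame AP \<pi> E chart e"
abbreviation \<V> :: "'k \<Rightarrow> 'p \<Rightarrow> ('e, 'p) prol" where "\<V> \<equiv> V_frame AP chart"
abbreviation \<delta> :: "'r \<Rightarrow> 'p \<Rightarrow> ('e, 'p) prol" where "\<delta> \<equiv> delta_frame AP \<pi> E h chart e"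
abbreviation \<epsilon> :: "'r + 'k \<Rightarrow> 'p \<Rightarrow> ('e, 'p) prol" where "\<epsilon> \<equiv> case_sum \<delta> \<V>"
abbreviation Q :: "'p set" where "Q \<equiv> W \<inter> \<pi> -` U"

lemma M_chart: "(V, \<phi>) \<in> AM" and P_chart: "(W, \<psi>) \<in> AP"
  and chart_maps: "p \<in> W \<Longrightarrow> \<pi> p \<in> V" and chart_fst: "p \<in> W \<Longrightarrow> \<phi> (\<pi> p) = fst (\<psi> p)"
  using fibred by (auto simp: fibred_charts_def)

lemma open_W: "open W"
  using P.chart_open[OF P_chart] .

lemma open_Q: "open Q"
  using open_W open_preimage[OF U_open] by blast

text \<open>In a fibred chart \<pi> is the linear projection \<open>fst\<close>, so by the chain
  rule only the first part of the direction survives.\<close>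

lemma push_forward_chart_vec:
  assumes "p \<in> W"
  shows "push_forward AM \<pi> p (chart_vec AP (W, \<psi>) p w) = chart_vec AM (V, \<phi>) (\<pi> p) (fst w)"
proof
  fix f
  show "push_forward AM \<pi> p (chart_vec AP (W, \<psi>) p w) f = chart_vec AM (V, \<phi>) (\<pi> p) (fst w) f"
  proof (cases "smooth_near AM (\<pi> p) f")
    case True
    have "((\<lambda>x. f (inv_into V \<phi> (fst x))) has_derivative
        (\<lambda>w. chart_vec AM (V, \<phi>) (\<pi> p) (fst w) f)) (at (\<psi> p))"
    proof (rule has_derivative_compose[of fst])
      show "(fst has_derivative fst) (at (\<psi> p))"
        by (intro derivative_eq_intros) auto
      show "((\<lambda>x. f (inv_into V \<phi> x)) has_derivative (\<lambda>w. chart_vec AM (V, \<phi>) (\<pi> p) w f)) (at (fst (\<psi> p)))"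
        using M.chart_vec_works[OF M_chart chart_maps[OF assms] True] chart_fst[OF assms] by simp
    qed
    then have "((\<lambda>x. f (\<pi> (inv_into W \<psi> x))) has_derivative
        (\<lambda>w. chart_vec AM (V, \<phi>) (\<pi> p) (fst w) f)) (at (\<psi> p))"
      by (rule has_derivative_transform_within_open[OF _ P.chart_image_open[OF P_chart open_UNIV]])
         (use assms P_chart M_chart chart_maps chart_fst[symmetric] in auto)
    from P.chart_vec_unique[OF P_chart assms smooth_near_pullback[OF True] this]
    show ?thesis
      using True by (simp add: push_forward_def comp_def)
  qed (simp add: push_forward_def M.chart_vec_not_smooth)
qed

lemma Anchor_frame:
  assumes "p \<in> Q"
  shows "Anchor E (\<pi> p) (e a (\<pi> p)) = (\<Sum>i\<in>UNIV. \<rho> a i p *\<^sub>R chart_vec AM (V, \<phi>) (\<pi> p) (axis i 1))"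
proof -
  have "Anchor E (\<pi> p) (e a (\<pi> p)) \<in> tangent_space AM (\<pi> p)"
    using assms Anchor_tangent is_basis_mem[OF frame_basis] by blast
  from M.tangent_chart_vec[OF this M_chart] chart_maps assms show ?thesis
    by (auto simp: sum_Basis_vec anchor_coeff_def cart_eq_inner_axis)
qed

lemma chart_vec_sum:
  assumes "p \<in> W"
  shows "chart_vec AP (W, \<psi>) p (\<Sum>i\<in>I. r i *\<^sub>R w i) = (\<Sum>i\<in>I. r i *\<^sub>R chart_vec AP (W, \<psi>) p (w i))"
  by (simp only: linear_sum[OF P.chart_vec_linear[OF P_chart assms]]
      linear_cmul[OF P.chart_vec_linear[OF P_chart assms]])

text \<open>The coefficients \<open>\<rho>\<close> are the components of the anchor of e_a, so the
  tangent part of X_a projects to exactly that anchor.\<close>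

lemma X_prol_fib:
  assumes "p \<in> Q"
  shows "X a p \<in> prol_fib AM AP \<pi> E p"
proof -
  let ?w = "\<Sum>i\<in>UNIV. \<rho> a i p *\<^sub>R (axis i 1, 0) :: (real ^ 'n) \<times> (real ^ 'k)"
  have p: "p \<in> W" "\<pi> p \<in> U" using assms by auto
  have v: "snd (X a p) = chart_vec AP (W, \<psi>) p ?w"
    unfolding chart_vec_sum[OF p(1)] by (simp add: X_frame_def)
  have "chart_vec AM (V, \<phi>) (\<pi> p) (fst ?w) = Anchor E (\<pi> p) (e a (\<pi> p))"
    unfolding Anchor_frame[OF assms] fst_sum
    by (simp add: linear_sum[OF M.chart_vec_linear[OF M_chart chart_maps[OF p(1)]]]
      linear_cmul[OF M.chart_vec_linear[OF M_chart chart_maps[OF p(1)]]])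
  then have "Anchor E (\<pi> p) (e a (\<pi> p)) = push_forward AM \<pi> p (snd (X a p))"
    unfolding v push_forward_chart_vec[OF p(1)] by simp
  moreover have "snd (X a p) \<in> tangent_space AP p"
    unfolding v by (rule P.chart_vec_tangent[OF P_chart p(1)])
  ultimately show ?thesis
    using is_basis_mem[OF frame_basis[OF p(2)]] by (auto simp: prol_fib_def X_frame_def)
qed

lemma \<V>_prol_vert:
  assumes "p \<in> W"
  shows "\<V> A p \<in> prol_vert AM AP \<pi> E p"
proof -
  have "push_forward AM \<pi> p (dy A p) = 0"
    using push_forward_chart_vec[OF assms] linear_0[OF M.chart_vec_linear[OF M_chart chart_maps[OF assms]]]
    by simp
  then show ?thesis
    using P.chart_vec_tangent[OF P_chart assms] subspace_0[OF subspace_Fib]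
    by (simp add: V_frame_def prol_vert_def prol_fib_def Anchor_zero)
qed

lemma y_smooth: "smooth_fun AP W (y A)"
  by (rule P.smooth_fun_coord[OF P_chart])

lemma y_smooth_near: "p \<in> W \<Longrightarrow> smooth_near AP p (y A)"
  using P.smooth_nearI[OF open_W _ y_smooth] .

lemma dx_y: "p \<in> W \<Longrightarrow> dx i p (y A) = 0"
  by (simp add: P.chart_vec_coord[OF P_chart])

lemma dy_y: "p \<in> W \<Longrightarrow> dy B p (y A) = (if A = B then 1 else 0)"
  by (simp add: P.chart_vec_coord[OF P_chart] inner_axis_axis)

text \<open>A vertical element has E-component 0, so its tangent part pushes forward to the anchor
  of 0.\<close>

lemma vertical_pullback:
  assumes "z \<in> prol_vert AM AP \<pi> E p" "smooth_near AM (\<pi> p) f"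
  shows "snd z (\<lambda>q. f (\<pi> q)) = 0"
proof -
  have "push_forward AM \<pi> p (snd z) = 0"
    using assms(1) by (cases z) (auto simp: prol_vert_def prol_fib_def Anchor_zero)
  from fun_cong[OF this, of f] show ?thesis
    using assms(2) by (simp add: push_forward_def comp_def)
qed

text \<open>The x-coordinates are pulled back from the base and hence killed by vertical vectors;
  only the y-components of the coordinate expansion remain.\<close>

lemma vertical_sum:
  assumes "z \<in> prol_vert AM AP \<pi> E p" "p \<in> W"
  shows "z = (\<Sum>A\<in>UNIV. snd z (y A) *\<^sub>R \<V> A p)"
proof -
  have t: "snd z \<in> tangent_space AP p"
    using assms(1) prol_fib_tangent vert_subset by blast
  have "snd z (\<lambda>q. \<psi> q \<bullet> (axis i 1, 0)) = 0" for i
  proof -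
    have "snd z (\<lambda>q. \<psi> q \<bullet> (axis i 1, 0)) = snd z (\<lambda>q. \<phi> (\<pi> q) \<bullet> axis i 1)"
      by (rule P.tangent_cong[OF t open_W assms(2)]) (simp add: chart_fst inner_prod_def)
    also have "\<dots> = 0"
      using vertical_pullback[OF assms(1) M.smooth_nearI[OF M.chart_open[OF M_chart] _ M.smooth_fun_coord[OF M_chart]]]
        chart_maps[OF assms(2)] by blast
    finally show ?thesis .
  qed
  then have "(\<Sum>b\<in>Basis. snd z (\<lambda>q. \<psi> q \<bullet> b) *\<^sub>R chart_vec AP (W, \<psi>) p b)
      = (\<Sum>A\<in>UNIV. snd z (y A) *\<^sub>R dy A p)"
    by (simp add: sum_Basis_prod sum_Basis_vec)
  then have "snd z = (\<Sum>A\<in>UNIV. snd z (y A) *\<^sub>R dy A p)"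
    using P.tangent_chart_vec[OF t P_chart assms(2)] by (rule trans[rotated])
  moreover have "fst z = 0"
    using assms(1) by (simp add: prol_vert_def)
  ultimately show ?thesis
    by (intro prod_eqI) (simp_all add: fst_sum snd_sum V_frame_def)
qed

lemma \<V>_basis:
  assumes "p \<in> W"
  shows "is_basis (\<lambda>A. \<V> A p) (prol_vert AM AP \<pi> E p)"
proof (rule is_basisI[OF subspace_prol_vert \<V>_prol_vert[OF assms]])
  show "\<exists>c. z = (\<Sum>A\<in>UNIV. c A *\<^sub>R \<V> A p)" if "z \<in> prol_vert AM AP \<pi> E p" for z
    by (rule exI, rule vertical_sum[OF that assms])
  show "c = (\<lambda>_. 0)" if "(\<Sum>A\<in>UNIV. c A *\<^sub>R \<V> A p) = 0" for c
  proof
    fix A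
    have "0 = snd (\<Sum>B\<in>UNIV. c B *\<^sub>R \<V> B p) (y A)"
      by (simp add: that)
    also have "\<dots> = c A"
      by (simp add: snd_sum sum_fun_apply V_frame_def dy_y[OF assms] if_distrib sum.delta cong: if_cong)
    finally show "c A = 0" by simp
  qed
qed

text \<open>This gives meaning to the definite description in \<open>N_coeff\<close>. Existence: the
  coefficients are the components of the vertical part of X_a. Uniqueness: two candidates differ by
  an element that is both horizontal and vertical.\<close>

lemma \<delta>_horizontal:
  assumes "p \<in> Q"
  shows "\<delta> a p \<in> h p"
proof -
  have "X a p \<in> {u + w | u w. u \<in> h p \<and> w \<in> prol_vert AM AP \<pi> E p}"
    unfolding h_vert_sum by (rule X_prol_fib[OF assms])
  then obtain u w where uw: "X a p = u + w" "u \<in> h p" "w \<in> prol_vert AM AP \<pi> E p" by blast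
  have p: "p \<in> W" using assms by auto
  define \<nu> where "\<nu> = coeffs (\<lambda>A. \<V> A p) w"
  let ?P = "\<lambda>\<nu>. X a p - (\<Sum>A\<in>UNIV. \<nu> A *\<^sub>R \<V> A p) \<in> h p"
  have w: "w = (\<Sum>A\<in>UNIV. \<nu> A *\<^sub>R \<V> A p)"
    using is_basis_sum[OF \<V>_basis[OF p] uw(3)] by (simp add: \<nu>_def)
  have "?P \<nu>"
    using uw(1,2) by (simp add: w[symmetric])
  moreover have "\<mu> = \<nu>" if "?P \<mu>" for \<mu>
  proof -
    have "(X a p - (\<Sum>A\<in>UNIV. \<mu> A *\<^sub>R \<V> A p)) - u \<in> h p"
      using that uw(2) subspace_diff[OF subspace_h] by blast
    moreover have "(X a p - (\<Sum>A\<in>UNIV. \<mu> A *\<^sub>R \<V> A p)) - u = w - (\<Sum>A\<in>UNIV. \<mu> A *\<^sub>R \<V> A p)"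
      by (simp add: uw(1))
    moreover have "w - (\<Sum>A\<in>UNIV. \<mu> A *\<^sub>R \<V> A p) \<in> prol_vert AM AP \<pi> E p"
      using uw(3) subspace_prol_vert \<V>_prol_vert[OF p]
      by (intro subspace_diff subspace_sum subspace_scale) auto
    ultimately have "w - (\<Sum>A\<in>UNIV. \<mu> A *\<^sub>R \<V> A p) = 0"
      by (intro h_vert_disjoint[of _ p]) simp_all
    then have "(\<Sum>A\<in>UNIV. \<mu> A *\<^sub>R \<V> A p) = (\<Sum>A\<in>UNIV. \<nu> A *\<^sub>R \<V> A p)"
      using w by simp
    from is_basis_unique[OF \<V>_basis[OF p] this] show ?thesis .
  qed
  ultimately have "(THE \<nu>. ?P \<nu>) = \<nu>"
    by (rule the_equality)
  then have "N A a p = \<nu> A" for A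
    by (simp add: N_coeff_def)
  then show ?thesis
    using \<open>?P \<nu>\<close> by (simp add: delta_frame_def)
qed

lemma fst_\<delta>: "fst (\<delta> a p) = e a (\<pi> p)"
  by (simp add: delta_frame_def X_frame_def fst_sum V_frame_def)

lemma fst_\<V>: "fst (\<V> A p) = 0"
  by (simp add: V_frame_def)

lemma snd_\<delta>: "snd (\<delta> a p) u = (\<Sum>i\<in>UNIV. \<rho> a i p * dx i p u) - (\<Sum>A\<in>UNIV. N A a p * dy A p u)"
  by (simp add: delta_frame_def X_frame_def snd_sum sum_fun_apply V_frame_def)

lemma snd_\<V>: "snd (\<V> A p) u = dy A p u"
  by (simp add: V_frame_def)

text \<open>The y-coordinates read N off from \<delta>_a. This yields the vertical components of a
  vector below, and relates the functions N of two charts.\<close>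

lemma \<delta>_y: "p \<in> W \<Longrightarrow> snd (\<delta> a p) (y A) = - N A a p"
  by (simp add: snd_\<delta> dx_y dy_y if_distrib sum.delta cong: if_cong)

section \<open>Components in the N-adapted frame\<close>

lemma \<epsilon>_prol_fib: "p \<in> Q \<Longrightarrow> \<epsilon> \<alpha> p \<in> prol_fib AM AP \<pi> E p"
  by (cases \<alpha>) (auto intro: h_subset[OF \<delta>_horizontal] vert_subset[OF \<V>_prol_vert])

lemma \<epsilon>_tangent: "p \<in> Q \<Longrightarrow> snd (\<epsilon> \<alpha> p) \<in> tangent_space AP p"
  by (rule prol_fib_tangent[OF \<epsilon>_prol_fib])

text \<open>Evaluation of the dual coframe (X^a, V^A + N^A_a X^a). It agrees with
  \<open>coeffs\<close> in the adapted frame on the fibres over \<open>Q\<close>, but unlike that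
  definite description the explicit form makes smoothness visible.\<close>

definition comp :: "'p \<Rightarrow> ('e, 'p) prol \<Rightarrow> 'r + 'k \<Rightarrow> real" where
  "comp p z = (\<lambda>\<alpha>. case \<alpha> of Inl a \<Rightarrow> coeffs (\<lambda>a. e a (\<pi> p)) (fst z) a
     | Inr A \<Rightarrow> snd z (y A) + (\<Sum>a\<in>UNIV. N A a p * coeffs (\<lambda>a. e a (\<pi> p)) (fst z) a))"

text \<open>Subtracting the horizontal combination with the same E-component leaves a vertical
  vector. Its y-components are the \<open>Inr\<close> components, because \<delta>_a y^A = - N^A_a
  accounts for the correction term.\<close>

lemma comp_sum:
  assumes "z \<in> prol_fib AM AP \<pi> E p" "p \<in> Q"
  shows "z = (\<Sum>\<alpha>\<in>UNIV. comp p z \<alpha> *\<^sub>R \<epsilon> \<alpha> p)"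
proof -
  have p: "p \<in> W" "\<pi> p \<in> U" using assms(2) by auto
  define s where "s = (\<Sum>a\<in>UNIV. comp p z (Inl a) *\<^sub>R \<delta> a p)"
  have "s \<in> prol_fib AM AP \<pi> E p"
    unfolding s_def
    using h_subset[OF \<delta>_horizontal[OF assms(2)]] subspace_prol_fib[of p]
    by (intro subspace_sum subspace_scale) auto
  moreover have "fst z \<in> Fib E (\<pi> p)"
    using assms(1) by (auto simp: prol_fib_def)
  then have "fst s = fst z"
    using is_basis_sum[OF frame_basis[OF p(2)]] by (simp add: s_def fst_sum fst_\<delta> comp_def)
  ultimately have "z - s \<in> prol_vert AM AP \<pi> E p"
    using assms(1) subspace_diff[OF subspace_prol_fib] by (simp add: prol_vert_def)
  note v = vertical_sum[OF this p(1)]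
  have c: "snd (z - s) (y A) = comp p z (Inr A)" for A
    by (simp add: s_def snd_sum sum_fun_apply \<delta>_y[OF p(1)] comp_def sum_negf mult.commute)
  have "z = s + (\<Sum>A\<in>UNIV. comp p z (Inr A) *\<^sub>R \<V> A p)"
    using v[unfolded c] by (simp only: diff_eq_eq add.commute)
  then show ?thesis
    by (simp add: sum_UNIV_Plus s_def)
qed

lemma comp_frame_sum:
  assumes "p \<in> Q"
  shows "comp p (\<Sum>\<alpha>\<in>UNIV. c \<alpha> *\<^sub>R \<epsilon> \<alpha> p) = c"
proof
  fix \<beta>
  have p: "p \<in> W" "\<pi> p \<in> U" using assms by auto
  have 1: "coeffs (\<lambda>a. e a (\<pi> p)) (fst (\<Sum>\<alpha>\<in>UNIV. c \<alpha> *\<^sub>R \<epsilon> \<alpha> p)) = (\<lambda>a. c (Inl a))"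
    by (rule coeffs_eq[OF frame_basis[OF p(2)]]) (simp add: fst_sum sum_UNIV_Plus fst_\<delta> fst_\<V>)
  show "comp p (\<Sum>\<alpha>\<in>UNIV. c \<alpha> *\<^sub>R \<epsilon> \<alpha> p) \<beta> = c \<beta>"
  proof (cases \<beta>)
    case (Inr A)
    have "snd (\<Sum>\<alpha>\<in>UNIV. c \<alpha> *\<^sub>R \<epsilon> \<alpha> p) (y A) = (\<Sum>a\<in>UNIV. c (Inl a) * - N A a p) + c (Inr A)"
      by (simp add: snd_sum sum_fun_apply sum_UNIV_Plus \<delta>_y[OF p(1)] snd_\<V> dy_y[OF p(1)] if_distrib
          sum.delta cong: if_cong)
    then show ?thesis
      using Inr 1 by (simp add: comp_def sum_negf mult.commute)
  qed (simp add: comp_def 1)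
qed

lemma \<epsilon>_basis:
  assumes "p \<in> Q"
  shows "is_basis (\<lambda>\<alpha>. \<epsilon> \<alpha> p) (prol_fib AM AP \<pi> E p)"
proof (rule is_basisI[OF subspace_prol_fib \<epsilon>_prol_fib[OF assms]])
  show "\<exists>c. z = (\<Sum>\<alpha>\<in>UNIV. c \<alpha> *\<^sub>R \<epsilon> \<alpha> p)" if "z \<in> prol_fib AM AP \<pi> E p" for z
    using comp_sum[OF that assms] by blast
  show "c = (\<lambda>_. 0)" if "(\<Sum>\<alpha>\<in>UNIV. c \<alpha> *\<^sub>R \<epsilon> \<alpha> p) = 0" for c
    using comp_frame_sum[OF assms, of c] comp_frame_sum[OF assms, of "\<lambda>_. 0"] that by simp
qed

lemma comp_eq_coeffs:
  assumes "z \<in> prol_fib AM AP \<pi> E p" "p \<in> Q"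
  shows "comp p z = coeffs (\<lambda>\<alpha>. \<epsilon> \<alpha> p) z"
  using coeffs_eq[OF \<epsilon>_basis[OF assms(2)] comp_sum[OF assms]] by simp

lemma comp_linear:
  assumes "z \<in> prol_fib AM AP \<pi> E p" "z' \<in> prol_fib AM AP \<pi> E p" "p \<in> Q"
  shows "comp p (r *\<^sub>R z + s *\<^sub>R z') \<alpha> = r * comp p z \<alpha> + s * comp p z' \<alpha>"
proof -
  have "r *\<^sub>R z + s *\<^sub>R z' \<in> prol_fib AM AP \<pi> E p"
    using assms subspace_prol_fib by (intro subspace_add subspace_scale) auto
  then show ?thesis
    using comp_eq_coeffs assms coeffs_linear[OF \<epsilon>_basis[OF assms(3)] assms(1,2)] by metis
qed

lemma comp_add:
  assumes "z \<in> prol_fib AM AP \<pi> E p" "z' \<in> prol_fib AM AP \<pi> E p" "p \<in> Q"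
  shows "comp p (z + z') \<alpha> = comp p z \<alpha> + comp p z' \<alpha>"
  using comp_linear[OF assms, of 1 1] by simp

lemma comp_scale:
  assumes "z \<in> prol_fib AM AP \<pi> E p" "p \<in> Q"
  shows "comp p (r *\<^sub>R z) \<alpha> = r * comp p z \<alpha>"
  using comp_linear[OF assms(1,1,2), of r 0] by simp

lemma comp_\<epsilon>: "p \<in> Q \<Longrightarrow> comp p (\<epsilon> \<beta> p) \<alpha> = (if \<alpha> = \<beta> then 1 else 0)"
  using comp_eq_coeffs[OF \<epsilon>_prol_fib] coeffs_basis[OF \<epsilon>_basis] by simp

text \<open>If \<open>z\<close> is horizontal, so is its vertical part in the expansion, and the two
  subspaces meet only in 0.\<close>

lemma comp_horizontal:
  assumes "z \<in> prol_fib AM AP \<pi> E p" "p \<in> Q"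
  shows "z \<in> h p \<longleftrightarrow> (\<forall>A. comp p z (Inr A) = 0)"
proof -
  let ?u = "\<Sum>a\<in>UNIV. comp p z (Inl a) *\<^sub>R \<delta> a p" and ?w = "\<Sum>A\<in>UNIV. comp p z (Inr A) *\<^sub>R \<V> A p"
  have z: "z = ?u + ?w"
    using comp_sum[OF assms] by (simp add: sum_UNIV_Plus)
  have u: "?u \<in> h p"
    using \<delta>_horizontal[OF assms(2)] subspace_h[of p] by (intro subspace_sum subspace_scale) auto
  have w: "?w \<in> prol_vert AM AP \<pi> E p"
    using \<V>_prol_vert assms(2) subspace_prol_vert[of p] by (intro subspace_sum subspace_scale) auto
  show ?thesis
  proof
    assume "z \<in> h p"
    then have "z - ?u \<in> h p"
      using u subspace_diff[OF subspace_h] by blast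
    moreover have "z - ?u = ?w"
      unfolding diff_eq_eq by (rule trans[OF z add.commute])
    ultimately have "?w = (\<Sum>A\<in>UNIV. 0 *\<^sub>R \<V> A p)"
      using h_vert_disjoint w by simp
    from is_basis_unique[OF \<V>_basis this] show "\<forall>A. comp p z (Inr A) = 0"
      using assms(2) by (auto simp: fun_eq_iff)
  next
    assume "\<forall>A. comp p z (Inr A) = 0"
    then have "?u + ?w = ?u" by simp
    from trans[OF z this] show "z \<in> h p"
      by (rule ssubst) (rule u)
  qed
qed

lemma comp_vertical:
  assumes "z \<in> prol_fib AM AP \<pi> E p" "p \<in> Q"
  shows "z \<in> prol_vert AM AP \<pi> E p \<longleftrightarrow> (\<forall>a. comp p z (Inl a) = 0)"
proof -
  have z: "fst z = (\<Sum>a\<in>UNIV. comp p z (Inl a) *\<^sub>R e a (\<pi> p))"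
    by (subst comp_sum[OF assms]) (simp add: fst_sum sum_UNIV_Plus fst_\<delta> fst_\<V>)
  show ?thesis
  proof
    assume "z \<in> prol_vert AM AP \<pi> E p"
    then have "(\<Sum>a\<in>UNIV. comp p z (Inl a) *\<^sub>R e a (\<pi> p)) = (\<Sum>a\<in>UNIV. 0 *\<^sub>R e a (\<pi> p))"
      using z by (simp add: prol_vert_def)
    from is_basis_unique[OF frame_basis this] show "\<forall>a. comp p z (Inl a) = 0"
      using assms(2) by (auto simp: fun_eq_iff)
  next
    assume "\<forall>a. comp p z (Inl a) = 0"
    then show "z \<in> prol_vert AM AP \<pi> E p"
      using z assms(1) by (simp add: prol_vert_def)
  qed
qed

lemma \<delta>_basis:
  assumes "p \<in> Q"
  shows "is_basis (\<lambda>a. \<delta> a p) (h p)"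
proof (rule is_basisI[OF subspace_h \<delta>_horizontal[OF assms]])
  show "\<exists>c. z = (\<Sum>a\<in>UNIV. c a *\<^sub>R \<delta> a p)" if "z \<in> h p" for z
    using comp_sum[OF h_subset[OF that] assms] comp_horizontal[OF h_subset[OF that] assms] that
    by (auto simp: sum_UNIV_Plus)
  show "c = (\<lambda>_. 0)" if "(\<Sum>a\<in>UNIV. c a *\<^sub>R \<delta> a p) = 0" for c
  proof -
    have "(\<Sum>a\<in>UNIV. c a *\<^sub>R e a (\<pi> p)) = fst (\<Sum>a\<in>UNIV. c a *\<^sub>R \<delta> a p)"
      by (simp add: fst_sum fst_\<delta>)
    also have "\<dots> = (\<Sum>a\<in>UNIV. 0 *\<^sub>R e a (\<pi> p))"
      using that by simp
    finally show ?thesis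
      by (rule is_basis_unique[OF frame_basis, rotated]) (use assms in auto)
  qed
qed

text \<open>Horizontal vectors with the same E-component differ by a vertical one, hence not at all.
  So \<delta>_a is determined by the splitting and the frame alone, whatever the chart.\<close>

lemma \<delta>_unique:
  assumes "p \<in> Q" "z \<in> h p" "fst z = e a (\<pi> p)"
  shows "z = \<delta> a p"
proof -
  have "z - \<delta> a p \<in> h p"
    using assms \<delta>_horizontal subspace_diff[OF subspace_h] by blast
  moreover from this have "z - \<delta> a p \<in> prol_vert AM AP \<pi> E p"
    using h_subset assms(3) by (simp add: prol_vert_def fst_\<delta>)
  ultimately show ?thesis
    using h_vert_disjoint by fastforce
qed

section \<open>Smoothness of the adapted frame and of components\<close>

lemma anchor_coeff_smooth: "smooth_fun AM (V \<inter> U) (anchor_coeff E (V, \<phi>) e a i)"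
proof -
  have "bundle_section AM E (V \<inter> U) (e a)"
    using frame_section[of a] unfolding bundle_section_def
    by (fastforce intro: M.smooth_fun_subset)
  moreover have "smooth_fun AM (V \<inter> U) (\<lambda>z. \<phi> z $ i)"
    using M.smooth_fun_subset[OF M.smooth_fun_coord[OF M_chart, of "axis i 1"]]
    by (simp add: cart_eq_inner_axis)
  ultimately have "smooth_fun AM (V \<inter> U) (\<lambda>x. Anchor E x (e a x) (\<lambda>z. \<phi> z $ i))"
    using M.chart_open[OF M_chart] U_open by (intro Anchor_smooth) auto
  moreover have "(\<lambda>x. Anchor E x (e a x) (\<lambda>z. \<phi> z $ i)) = anchor_coeff E (V, \<phi>) e a i"
    by (auto simp: anchor_coeff_def)
  ultimately show ?thesis by simp
qed

lemma \<rho>_smooth: "smooth_fun AP Q (\<rho> a i)"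
  by (rule P.smooth_fun_subset[OF smooth_fun_pullback[OF _ anchor_coeff_smooth]])
     (use M.chart_open[OF M_chart] U_open chart_maps in auto)

lemma \<rho>_vertical:
  assumes "p \<in> Q"
  shows "dy A p (\<rho> a i) = 0"
proof -
  have "smooth_near AM (\<pi> p) (anchor_coeff E (V, \<phi>) e a i)"
    using M.smooth_nearI[OF _ _ anchor_coeff_smooth] M.chart_open[OF M_chart] U_open chart_maps assms
    by auto
  from vertical_pullback[OF \<V>_prol_vert this] show ?thesis
    using assms by (auto simp: snd_\<V>)
qed

lemma N_smooth: "smooth_fun AP Q (N A a)"
proof -
  have "\<forall>c\<in>fibred_charts AM AP \<pi>. \<forall>U e. local_frame AM E U e \<longrightarrow>
        (\<forall>A a. smooth_fun AP (fdom c \<inter> \<pi> -` U) (N_coeff AP \<pi> E h c e A a))"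
    using N_conn unfolding N_connection_def by (elim conjE)
  then have "smooth_fun AP (fdom chart \<inter> \<pi> -` U) (N A a)"
    using fibred frame by blast
  then show ?thesis by simp
qed

lemma \<epsilon>_smooth:
  assumes "open S" "S \<subseteq> Q" "smooth_fun AP S u"
  shows "smooth_fun AP S (\<lambda>p. snd (\<epsilon> \<alpha> p) u)"
proof (cases \<alpha>)
  case (Inl a)
  have "smooth_fun AP S (\<lambda>p. (\<Sum>i\<in>UNIV. \<rho> a i p * dx i p u) - (\<Sum>A\<in>UNIV. N A a p * dy A p u))"
    using assms
    by (intro P.smooth_fun_diff P.smooth_fun_sum P.smooth_fun_mult P.smooth_fun_chart_vec[OF P_chart]
        P.smooth_fun_subset[OF \<rho>_smooth] P.smooth_fun_subset[OF N_smooth]) auto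
  then show ?thesis
    by (simp add: Inl snd_\<delta>)
next
  case (Inr A)
  then show ?thesis
    using P.smooth_fun_chart_vec[OF P_chart assms(1) _ assms(3)] assms(2) by (simp add: snd_\<V>)
qed

lemma prol_section_frame_sum:
  assumes "open S" "S \<subseteq> Q" "\<And>\<alpha>. smooth_fun AP S (z \<alpha>)"
  shows "prol_section AM AP \<pi> E S (\<lambda>p. \<Sum>\<alpha>\<in>UNIV. z \<alpha> p *\<^sub>R \<epsilon> \<alpha> p)"
  unfolding prol_section_def
proof (intro conjI ballI allI impI)
  show "(\<Sum>\<alpha>\<in>UNIV. z \<alpha> p *\<^sub>R \<epsilon> \<alpha> p) \<in> prol_fib AM AP \<pi> E p" if "p \<in> S" for p
    using \<epsilon>_prol_fib that assms(2) subspace_prol_fib[of p] by (intro subspace_sum subspace_scale) auto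
  show "case Ue of (U', e') \<Rightarrow> \<forall>a. smooth_fun AP (S \<inter> \<pi> -` U')
      (\<lambda>p. coeffs (\<lambda>a. e' a (\<pi> p)) (fst (\<Sum>\<alpha>\<in>UNIV. z \<alpha> p *\<^sub>R \<epsilon> \<alpha> p)) a)"
    if Ue: "Ue \<in> Frames E" for Ue
  proof (cases Ue)
    case (Pair U' e')
    have U': "(U', e') \<in> Frames E" using Pair Ue by simp
    have "smooth_fun AP (S \<inter> \<pi> -` U')
      (\<lambda>p. coeffs (\<lambda>a. e' a (\<pi> p)) (fst (\<Sum>\<alpha>\<in>UNIV. z \<alpha> p *\<^sub>R \<epsilon> \<alpha> p)) b)" for b
    proof (rule P.smooth_fun_cong)
      show o: "open (S \<inter> \<pi> -` U')"
        using assms(1) open_preimage[OF Frames_open[OF U']] by blast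
      show "smooth_fun AP (S \<inter> \<pi> -` U') (\<lambda>p. \<Sum>a\<in>UNIV. z (Inl a) p * coeffs (\<lambda>a. e' a (\<pi> p)) (e a (\<pi> p)) b)"
        using assms(2)
        by (intro P.smooth_fun_sum P.smooth_fun_mult o P.smooth_fun_subset[OF assms(3)]
            P.smooth_fun_subset[OF frame_transition_smooth[OF U']]) auto
      fix p assume p: "p \<in> S \<inter> \<pi> -` U'"
      have "fst (\<Sum>\<alpha>\<in>UNIV. z \<alpha> p *\<^sub>R \<epsilon> \<alpha> p) = (\<Sum>a\<in>UNIV. z (Inl a) p *\<^sub>R e a (\<pi> p))"
        by (simp add: fst_sum sum_UNIV_Plus fst_\<delta> fst_\<V>)
      moreover have "coeffs (\<lambda>a. e' a (\<pi> p)) (\<Sum>a\<in>UNIV. z (Inl a) p *\<^sub>R e a (\<pi> p)) b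
          = (\<Sum>a\<in>UNIV. z (Inl a) p * coeffs (\<lambda>a. e' a (\<pi> p)) (e a (\<pi> p)) b)"
      proof (rule coeffs_sum[OF Frames_basis[OF U'] finite])
        show "e a (\<pi> p) \<in> Fib E (\<pi> p)" for a
          using is_basis_mem[OF frame_basis] p assms(2) by blast
      qed (use p in auto)
      ultimately show "(\<Sum>a\<in>UNIV. z (Inl a) p * coeffs (\<lambda>a. e' a (\<pi> p)) (e a (\<pi> p)) b)
          = coeffs (\<lambda>a. e' a (\<pi> p)) (fst (\<Sum>\<alpha>\<in>UNIV. z \<alpha> p *\<^sub>R \<epsilon> \<alpha> p)) b"
        by simp
    qed
    then show ?thesis using Pair by simp
  qed
  show "smooth_fun AP T (\<lambda>p. snd (\<Sum>\<alpha>\<in>UNIV. z \<alpha> p *\<^sub>R \<epsilon> \<alpha> p) f)"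
    if T: "open T" "T \<subseteq> S" "smooth_fun AP T f" for T f
  proof -
    have "smooth_fun AP T (\<lambda>p. \<Sum>\<alpha>\<in>UNIV. z \<alpha> p * snd (\<epsilon> \<alpha> p) f)"
      using T assms(2) by (intro P.smooth_fun_sum P.smooth_fun_mult P.smooth_fun_subset[OF assms(3)] \<epsilon>_smooth) auto
    then show ?thesis
      by (simp add: snd_sum sum_fun_apply)
  qed
qed

lemma \<epsilon>_section: "prol_section AM AP \<pi> E Q (\<epsilon> \<beta>)"
  by (rule prol_section_cong[OF open_Q _
        prol_section_frame_sum[OF open_Q order_refl, of "\<lambda>\<alpha> _. if \<alpha> = \<beta> then 1 else 0"]])
     (simp_all add: if_distrib[of "\<lambda>c. c *\<^sub>R _"] sum.delta cong: if_cong)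

text \<open>Converse of \<open>prol_section_frame_sum\<close>: smooth sections are the combinations
  of the adapted frame with smooth coefficients.\<close>

lemma comp_smooth:
  assumes "open S" "S \<subseteq> Q" "prol_section AM AP \<pi> E S Z"
  shows "smooth_fun AP S (\<lambda>p. comp p (Z p) \<alpha>)"
proof -
  have 1: "smooth_fun AP S (\<lambda>p. coeffs (\<lambda>a. e a (\<pi> p)) (fst (Z p)) a)" for a
    using section_coeffs_smooth assms by blast
  show ?thesis
  proof (cases \<alpha>)
    case (Inr A)
    have "smooth_fun AP S (\<lambda>p. snd (Z p) (y A) +
        (\<Sum>a\<in>UNIV. N A a p * coeffs (\<lambda>a. e a (\<pi> p)) (fst (Z p)) a))"
      using assms(1,2)
      by (intro P.smooth_fun_add P.smooth_fun_sum P.smooth_fun_mult 1 P.smooth_fun_subset[OF N_smooth]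
          prol_section_smooth[OF assms(3)] P.smooth_fun_subset[OF y_smooth]) auto
    then show ?thesis by (simp add: comp_def Inr)
  qed (simp add: comp_def 1)
qed

text \<open>In terms of vector fields: \<open>[\<delta>\<^sub>a, V\<^sub>B] = (V\<^sub>B N\<^sup>A\<^sub>a) V\<^sub>A\<close>.\<close>

lemma \<delta>_\<V>_commutator:
  assumes "p \<in> Q" "smooth_near AP p u"
  shows "snd (\<delta> a p) (\<lambda>q. snd (\<V> B q) u) - snd (\<V> B p) (\<lambda>q. snd (\<delta> a q) u)
    = (\<Sum>A\<in>UNIV. snd (\<V> B p) (N A a) * snd (\<V> A p) u)"
proof -
  have p: "p \<in> W" using assms(1) by auto
  from assms(2) obtain S' where S': "open S'" "p \<in> S'" "smooth_fun AP S' u"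
    unfolding smooth_near_def by blast
  define S where "S = S' \<inter> Q"
  have S: "open S" "p \<in> S" "S \<subseteq> Q" "smooth_fun AP S u"
    using S' open_Q assms(1) P.smooth_fun_subset[OF S'(3)] by (auto simp: S_def)
  have near: "smooth_near AP p (\<lambda>q. chart_vec AP (W, \<psi>) q w u)" for w
    by (rule P.smooth_nearI[OF S(1,2) P.smooth_fun_chart_vec[OF P_chart S(1) _ S(4)]]) (use S(3) in auto)
  have near_N: "smooth_near AP p (N A a)" for A
    by (rule P.smooth_nearI[OF open_Q assms(1) N_smooth])
  have near_\<rho>: "smooth_near AP p (\<rho> a i)" for i
    by (rule P.smooth_nearI[OF open_Q assms(1) \<rho>_smooth])
  have t: "dy B p \<in> tangent_space AP p"
    by (rule P.chart_vec_tangent[OF P_chart p])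
  have mult: "dy B p (\<lambda>q. f q * chart_vec AP (W, \<psi>) q w u)
      = f p * dy B p (\<lambda>q. chart_vec AP (W, \<psi>) q w u) + dy B p f * chart_vec AP (W, \<psi>) p w u"
    if "smooth_near AP p f" for f w
    by (rule P.tangent_mult[OF t that near])
  \<comment> \<open>The Leibniz rule produces no derivative of \<open>\<rho>\<close>, which is
    constant along the fibres; only the derivatives of N will remain.\<close>
  have 1: "dy B p (\<lambda>q. \<Sum>i\<in>UNIV. \<rho> a i q * dx i q u) = (\<Sum>i\<in>UNIV. \<rho> a i p * dy B p (\<lambda>q. dx i q u))"
    by (simp add: P.tangent_sum[OF t P.smooth_near_mult[OF near_\<rho> near]] mult[OF near_\<rho>] \<rho>_vertical[OF assms(1)])
  have 2: "dy B p (\<lambda>q. \<Sum>A\<in>UNIV. - N A a q * dy A q u)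
      = (\<Sum>A\<in>UNIV. - N A a p * dy B p (\<lambda>q. dy A q u) - dy B p (N A a) * dy A p u)"
  proof -
    have n: "smooth_near AP p (\<lambda>q. - N A a q)" for A
      using P.smooth_near_mult[OF P.smooth_near_const[of p "-1"] near_N[of A]] by simp
    have d: "dy B p (\<lambda>q. - N A a q) = - dy B p (N A a)" for A
      by (rule P.tangent_uminus[OF t near_N])
    show ?thesis
      unfolding P.tangent_sum[OF t P.smooth_near_mult[OF n near]] mult[OF n] d by simp
  qed
  have s1: "smooth_near AP p (\<lambda>q. \<Sum>i\<in>UNIV. \<rho> a i q * dx i q u)"
    by (intro P.smooth_near_sum P.smooth_near_mult near near_\<rho>)
  have s2: "smooth_near AP p (\<lambda>q. \<Sum>A\<in>UNIV. - N A a q * dy A q u)"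
    using P.smooth_near_mult[OF P.smooth_near_const[of p "-1"] near_N] by (intro P.smooth_near_sum P.smooth_near_mult near) simp
  have "snd (\<V> B p) (\<lambda>q. snd (\<delta> a q) u)
      = dy B p (\<lambda>q. (\<Sum>i\<in>UNIV. \<rho> a i q * dx i q u) + (\<Sum>A\<in>UNIV. - N A a q * dy A q u))"
    by (simp add: snd_\<delta> snd_\<V> sum_negf)
  also have "\<dots> = (\<Sum>i\<in>UNIV. \<rho> a i p * dy B p (\<lambda>q. dx i q u))
      + (\<Sum>A\<in>UNIV. - N A a p * dy B p (\<lambda>q. dy A q u) - dy B p (N A a) * dy A p u)"
    unfolding P.tangent_add[OF t s1 s2] 1 2 ..
  \<comment> \<open>Interchanging the partial derivatives turns the second-order terms into
    \<delta>_a applied to V_B u.\<close>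
  also have "\<dots> = snd (\<delta> a p) (\<lambda>q. dy B q u) - (\<Sum>A\<in>UNIV. dy B p (N A a) * dy A p u)"
    by (simp add: snd_\<delta> P.chart_vec_commute[OF P_chart p assms(2), of "(0, axis B 1)"] sum_subtractf sum_negf)
  finally show ?thesis
    by (simp add: snd_\<V>)
qed

end

section \<open>The canonical coefficients\<close>

text \<open>Index raising as a total function, arbitrary for a degenerate matrix, so that the
  canonical coefficients are given by one formula on all conceivable data.\<close>

definition raise :: "('i::finite \<Rightarrow> 'i \<Rightarrow> real) \<Rightarrow> ('i \<Rightarrow> real) \<Rightarrow> 'i \<Rightarrow> real" where
  "raise G \<omega> a = (\<Sum>d\<in>UNIV. matrix_inv (\<chi> i j. G i j) $ a $ d * \<omega> d)"

definition nondegenerate :: "('i::finite \<Rightarrow> 'i \<Rightarrow> real) \<Rightarrow> bool" where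
  "nondegenerate G \<longleftrightarrow> (\<forall>x. (\<forall>i. (\<Sum>j\<in>UNIV. G i j * x j) = 0) \<longrightarrow> (\<forall>j. x j = 0))"

lemma nondegenerate_invertible:
  fixes G :: "'i::finite \<Rightarrow> 'i \<Rightarrow> real"
  assumes "nondegenerate G"
  shows "invertible ((\<chi> i j. G i j) :: real ^ 'i ^ 'i)"
proof -
  have "x = 0" if "(\<chi> i j. G i j) *v x = 0" for x :: "real ^ 'i"
  proof -
    have "\<forall>i. (\<Sum>j\<in>UNIV. G i j * x $ j) = 0"
      using that by (simp add: vec_eq_iff matrix_vector_mult_def)
    then show ?thesis
      using assms unfolding nondegenerate_def by (simp add: vec_eq_iff)
  qed
  then have "\<exists>B. B ** ((\<chi> i j. G i j) :: real ^ 'i ^ 'i) = mat 1"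
    by (simp only: matrix_left_invertible_ker) blast
  then show ?thesis
    by (simp add: invertible_left_inverse)
qed

lemma raise_vector: "(\<chi> a. raise G \<omega> a) = matrix_inv (\<chi> i j. G i j) *v (\<chi> d. \<omega> d)"
  by (simp add: vec_eq_iff raise_def matrix_vector_mult_def)

lemma raise_iff:
  fixes G :: "'i::finite \<Rightarrow> 'i \<Rightarrow> real"
  assumes "nondegenerate G"
  shows "L = raise G \<omega> \<longleftrightarrow> (\<forall>d. (\<Sum>a\<in>UNIV. G d a * L a) = \<omega> d)"
proof -
  let ?M = "(\<chi> i j. G i j) :: real ^ 'i ^ 'i"
  have inv: "?M ** matrix_inv ?M = mat 1" "matrix_inv ?M ** ?M = mat 1"
    using someI_ex[OF nondegenerate_invertible[OF assms, unfolded invertible_def]]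
    unfolding matrix_inv_def by auto
  have "L = raise G \<omega> \<longleftrightarrow> (\<chi> a. L a) = matrix_inv ?M *v (\<chi> d. \<omega> d)"
    unfolding raise_vector[symmetric] by (simp add: vec_eq_iff fun_eq_iff)
  also have "\<dots> \<longleftrightarrow> ?M *v (\<chi> a. L a) = (\<chi> d. \<omega> d)"
    using inv by (metis matrix_vector_mul_assoc matrix_vector_mul_lid)
  also have "\<dots> \<longleftrightarrow> (\<forall>d. (\<Sum>a\<in>UNIV. G d a * L a) = \<omega> d)"
    by (simp add: vec_eq_iff matrix_vector_mult_def)
  finally show ?thesis .
qed

lemma lower_raise:
  "nondegenerate G \<Longrightarrow> (\<Sum>a\<in>UNIV. G d a * raise G \<omega> a) = \<omega> d"
  using raise_iff by blast

text \<open>\<open>LH\<close> and \<open>BV\<close> are Christoffel symbols. \<open>LV\<close> is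
  [\<delta>_f, V_B] plus half of the raised Lie derivative of the vertical metric along \<delta>_f;
  the two sums are the bracket terms of that Lie derivative. In \<open>BH\<close> the frame
  \<delta>_b counts as constant along V_C, so only the derivative of the metric is left.\<close>

definition canonical_coeffs :: "('n, 'k::finite, 'r::finite) local_data \<Rightarrow> ('k, 'r) conn_coeffs" where
  "canonical_coeffs \<D> = \<lparr>
     LH = (\<lambda>a b f. raise (gH \<D>) (\<lambda>d. (dgH \<D> (Inl f) b d + dgH \<D> (Inl b) f d - dgH \<D> (Inl d) b f) / 2) a),
     LV = (\<lambda>A B f. dNN \<D> (Inr B) A f + raise (gV \<D>) (\<lambda>E. (dgV \<D> (Inl f) B E
       - (\<Sum>D\<in>UNIV. gV \<D> E D * dNN \<D> (Inr B) D f) - (\<Sum>D\<in>UNIV. gV \<D> B D * dNN \<D> (Inr E) D f)) / 2) A),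
     BH = (\<lambda>a b C. raise (gH \<D>) (\<lambda>d. dgH \<D> (Inr C) b d / 2) a),
     BV = (\<lambda>A B C. raise (gV \<D>) (\<lambda>E. (dgV \<D> (Inr C) B E + dgV \<D> (Inr B) C E - dgV \<D> (Inr E) B C) / 2) A) \<rparr>"

text \<open>What a d-metric guarantees at each point, separated from the manifold so that the linear
  algebra below concerns arrays of numbers.\<close>

definition regular_data :: "('n, 'k::finite, 'r::finite) local_data \<Rightarrow> bool" where
  "regular_data \<D> \<longleftrightarrow> nondegenerate (gH \<D>) \<and> nondegenerate (gV \<D>) \<and>
     (\<forall>a b. gH \<D> a b = gH \<D> b a) \<and> (\<forall>A B. gV \<D> A B = gV \<D> B A) \<and>
     (\<forall>\<gamma> a b. dgH \<D> \<gamma> a b = dgH \<D> \<gamma> b a) \<and> (\<forall>\<gamma> A B. dgV \<D> \<gamma> A B = dgV \<D> \<gamma> B A)"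

text \<open>The equation D g = 0 on the adapted frame, one clause for each block and each kind of
  direction.\<close>

definition metric_coeffs :: "('n, 'k::finite, 'r::finite) local_data \<Rightarrow> ('k, 'r) conn_coeffs \<Rightarrow> bool" where
  "metric_coeffs \<D> \<Gamma> \<longleftrightarrow>
     (\<forall>f a b. dgH \<D> (Inl f) a b = (\<Sum>d\<in>UNIV. gH \<D> b d * LH \<Gamma> d a f) + (\<Sum>d\<in>UNIV. gH \<D> a d * LH \<Gamma> d b f)) \<and>
     (\<forall>C a b. dgH \<D> (Inr C) a b = (\<Sum>d\<in>UNIV. gH \<D> b d * BH \<Gamma> d a C) + (\<Sum>d\<in>UNIV. gH \<D> a d * BH \<Gamma> d b C)) \<and>
     (\<forall>f A B. dgV \<D> (Inl f) A B = (\<Sum>D\<in>UNIV. gV \<D> B D * LV \<Gamma> D A f) + (\<Sum>D\<in>UNIV. gV \<D> A D * LV \<Gamma> D B f)) \<and>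
     (\<forall>C A B. dgV \<D> (Inr C) A B = (\<Sum>D\<in>UNIV. gV \<D> B D * BV \<Gamma> D A C) + (\<Sum>D\<in>UNIV. gV \<D> A D * BV \<Gamma> D B C))"

text \<open>Besides the vanishing of the torsions, the symmetry of the mixed coefficients: \<open>D\<^sub>V \<delta>\<close> is
  self-adjoint, and so is \<open>D\<^sub>\<delta> V - [\<delta>, V]\<close>.\<close>

definition symmetric_coeffs :: "('n, 'k::finite, 'r::finite) local_data \<Rightarrow> ('k, 'r) conn_coeffs \<Rightarrow> bool" where
  "symmetric_coeffs \<D> \<Gamma> \<longleftrightarrow>
     (\<forall>a b f. LH \<Gamma> a b f = LH \<Gamma> a f b) \<and>
     (\<forall>A B C. BV \<Gamma> A B C = BV \<Gamma> A C B) \<and>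
     (\<forall>a b C. (\<Sum>d\<in>UNIV. gH \<D> a d * BH \<Gamma> d b C) = (\<Sum>d\<in>UNIV. gH \<D> b d * BH \<Gamma> d a C)) \<and>
     (\<forall>A B f. (\<Sum>D\<in>UNIV. gV \<D> A D * (LV \<Gamma> D B f - dNN \<D> (Inr B) D f))
            = (\<Sum>D\<in>UNIV. gV \<D> B D * (LV \<Gamma> D A f - dNN \<D> (Inr A) D f)))"

text \<open>In the \<open>LH\<close> and \<open>BV\<close> blocks this is the Koszul argument: the
  cyclic combination of three metric equations leaves twice the lowered coefficient once the lower
  indices may be exchanged. In the mixed blocks a single metric equation gives the lowered matrix
  plus its transpose, and self-adjointness makes the two summands equal.\<close>

lemma canonical_coeffs_unique:
  assumes reg: "regular_data \<D>" and met: "metric_coeffs \<D> \<Gamma>" and sym: "symmetric_coeffs \<D> \<Gamma>"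
  shows "\<Gamma> = canonical_coeffs \<D>"
proof (rule conn_coeffs.equality)
  have nH: "nondegenerate (gH \<D>)" and nV: "nondegenerate (gV \<D>)"
    using reg by (auto simp: regular_data_def)
  have mLH: "dgH \<D> (Inl f) a b = (\<Sum>d\<in>UNIV. gH \<D> b d * LH \<Gamma> d a f) + (\<Sum>d\<in>UNIV. gH \<D> a d * LH \<Gamma> d b f)"
    and mBH: "dgH \<D> (Inr C) a b = (\<Sum>d\<in>UNIV. gH \<D> b d * BH \<Gamma> d a C) + (\<Sum>d\<in>UNIV. gH \<D> a d * BH \<Gamma> d b C)"
    and mLV: "dgV \<D> (Inl f) A B = (\<Sum>D\<in>UNIV. gV \<D> B D * LV \<Gamma> D A f) + (\<Sum>D\<in>UNIV. gV \<D> A D * LV \<Gamma> D B f)"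
    and mBV: "dgV \<D> (Inr C) A B = (\<Sum>D\<in>UNIV. gV \<D> B D * BV \<Gamma> D A C) + (\<Sum>D\<in>UNIV. gV \<D> A D * BV \<Gamma> D B C)"
    for a b f A B C
    using met unfolding metric_coeffs_def by blast+
  have sLH: "LH \<Gamma> a b f = LH \<Gamma> a f b" and sBV: "BV \<Gamma> A B C = BV \<Gamma> A C B"
    and sBH: "(\<Sum>d\<in>UNIV. gH \<D> a d * BH \<Gamma> d b C) = (\<Sum>d\<in>UNIV. gH \<D> b d * BH \<Gamma> d a C)"
    and sLV: "(\<Sum>D\<in>UNIV. gV \<D> A D * (LV \<Gamma> D B f - dNN \<D> (Inr B) D f))
            = (\<Sum>D\<in>UNIV. gV \<D> B D * (LV \<Gamma> D A f - dNN \<D> (Inr A) D f))"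
    for a b f A B C
    using sym unfolding symmetric_coeffs_def by blast+
  show "LH \<Gamma> = LH (canonical_coeffs \<D>)"
  proof (intro ext)
    fix a b f
    have "(\<lambda>a. LH \<Gamma> a b f) = raise (gH \<D>) (\<lambda>d. (dgH \<D> (Inl f) b d + dgH \<D> (Inl b) f d - dgH \<D> (Inl d) b f) / 2)"
      unfolding raise_iff[OF nH] mLH
    proof
      fix d
      show "(\<Sum>a\<in>UNIV. gH \<D> d a * LH \<Gamma> a b f) =
        ((\<Sum>a\<in>UNIV. gH \<D> d a * LH \<Gamma> a b f) + (\<Sum>a\<in>UNIV. gH \<D> b a * LH \<Gamma> a d f)
         + ((\<Sum>a\<in>UNIV. gH \<D> d a * LH \<Gamma> a f b) + (\<Sum>a\<in>UNIV. gH \<D> f a * LH \<Gamma> a d b))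
         - ((\<Sum>a\<in>UNIV. gH \<D> f a * LH \<Gamma> a b d) + (\<Sum>a\<in>UNIV. gH \<D> b a * LH \<Gamma> a f d))) / 2"
        unfolding sLH[of _ f b] sLH[of _ d b] sLH[of _ f d] by simp
    qed
    from fun_cong[OF this, of a] show "LH \<Gamma> a b f = LH (canonical_coeffs \<D>) a b f"
      by (simp add: canonical_coeffs_def)
  qed
  show "BV \<Gamma> = BV (canonical_coeffs \<D>)"
  proof (intro ext)
    fix A B C
    have "(\<lambda>A. BV \<Gamma> A B C) = raise (gV \<D>) (\<lambda>E. (dgV \<D> (Inr C) B E + dgV \<D> (Inr B) C E - dgV \<D> (Inr E) B C) / 2)"
      unfolding raise_iff[OF nV] mBV
    proof
      fix E
      show "(\<Sum>A\<in>UNIV. gV \<D> E A * BV \<Gamma> A B C) =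
        ((\<Sum>A\<in>UNIV. gV \<D> E A * BV \<Gamma> A B C) + (\<Sum>A\<in>UNIV. gV \<D> B A * BV \<Gamma> A E C)
         + ((\<Sum>A\<in>UNIV. gV \<D> E A * BV \<Gamma> A C B) + (\<Sum>A\<in>UNIV. gV \<D> C A * BV \<Gamma> A E B))
         - ((\<Sum>A\<in>UNIV. gV \<D> C A * BV \<Gamma> A B E) + (\<Sum>A\<in>UNIV. gV \<D> B A * BV \<Gamma> A C E))) / 2"
        unfolding sBV[of _ C B] sBV[of _ E B] sBV[of _ C E] by simp
    qed
    from fun_cong[OF this, of A] show "BV \<Gamma> A B C = BV (canonical_coeffs \<D>) A B C"
      by (simp add: canonical_coeffs_def)
  qed
  show "BH \<Gamma> = BH (canonical_coeffs \<D>)"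
  proof (intro ext)
    fix a b C
    have "(\<lambda>a. BH \<Gamma> a b C) = raise (gH \<D>) (\<lambda>d. dgH \<D> (Inr C) b d / 2)"
      unfolding raise_iff[OF nH] mBH by (simp add: sBH[of b])
    from fun_cong[OF this, of a] show "BH \<Gamma> a b C = BH (canonical_coeffs \<D>) a b C"
      by (simp add: canonical_coeffs_def)
  qed
  show "LV \<Gamma> = LV (canonical_coeffs \<D>)"
  proof (intro ext)
    fix A B f
    \<comment> \<open>The self-adjoint matrix is the difference from the bracket coefficients V_B N,
      so the equation is solved for that difference.\<close>
    have "(\<lambda>A. LV \<Gamma> A B f - dNN \<D> (Inr B) A f) = raise (gV \<D>) (\<lambda>E. (dgV \<D> (Inl f) B E
       - (\<Sum>D\<in>UNIV. gV \<D> E D * dNN \<D> (Inr B) D f) - (\<Sum>D\<in>UNIV. gV \<D> B D * dNN \<D> (Inr E) D f)) / 2)"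
      unfolding raise_iff[OF nV] mLV
    proof
      fix E
      show "(\<Sum>A\<in>UNIV. gV \<D> E A * (LV \<Gamma> A B f - dNN \<D> (Inr B) A f))
        = ((\<Sum>D\<in>UNIV. gV \<D> E D * LV \<Gamma> D B f) + (\<Sum>D\<in>UNIV. gV \<D> B D * LV \<Gamma> D E f)
          - (\<Sum>D\<in>UNIV. gV \<D> E D * dNN \<D> (Inr B) D f) - (\<Sum>D\<in>UNIV. gV \<D> B D * dNN \<D> (Inr E) D f)) / 2"
        using sLV[of E B f] by (simp add: right_diff_distrib sum_subtractf)
    qed
    from fun_cong[OF this, of A] show "LV \<Gamma> A B f = LV (canonical_coeffs \<D>) A B f"
      by (simp add: canonical_coeffs_def)
  qed
qed simp

lemma canonical_coeffs_metric:
  assumes reg: "regular_data \<D>"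
  shows "metric_coeffs \<D> (canonical_coeffs \<D>)"
proof -
  have nH: "nondegenerate (gH \<D>)" and nV: "nondegenerate (gV \<D>)"
    and dH: "dgH \<D> \<gamma> a b = dgH \<D> \<gamma> b a" and dV: "dgV \<D> \<gamma> A B = dgV \<D> \<gamma> B A" for \<gamma> a b A B
    using reg by (auto simp: regular_data_def)
  \<comment> \<open>The full term V_B N outside \<open>raise\<close> meets minus one half of itself
    inside. What remains of the bracket terms is skew in A and B and cancels in the metric
    equation.\<close>
  have LV: "(\<Sum>D\<in>UNIV. gV \<D> B D * LV (canonical_coeffs \<D>) D A f)
      = (dgV \<D> (Inl f) A B + (\<Sum>D\<in>UNIV. gV \<D> B D * dNN \<D> (Inr A) D f) - (\<Sum>D\<in>UNIV. gV \<D> A D * dNN \<D> (Inr B) D f)) / 2"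
    for A B f
    by (simp add: canonical_coeffs_def distrib_left sum.distrib lower_raise[OF nV] field_simps)
  show ?thesis
    unfolding metric_coeffs_def LV
    by (auto simp: canonical_coeffs_def lower_raise[OF nH] lower_raise[OF nV] field_simps)
       (use dH dV in \<open>auto simp: algebra_simps\<close>)
qed

lemma canonical_coeffs_symmetric:
  assumes reg: "regular_data \<D>"
  shows "symmetric_coeffs \<D> (canonical_coeffs \<D>)"
proof -
  have nH: "nondegenerate (gH \<D>)" and nV: "nondegenerate (gV \<D>)"
    and dH: "dgH \<D> \<gamma> a b = dgH \<D> \<gamma> b a" and dV: "dgV \<D> \<gamma> A B = dgV \<D> \<gamma> B A" for \<gamma> a b A B
    using reg by (auto simp: regular_data_def)
  have "LH (canonical_coeffs \<D>) a b f = LH (canonical_coeffs \<D>) a f b" for a b f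
    unfolding canonical_coeffs_def conn_coeffs.simps by (subst dH[of _ f b]) (simp only: add.commute)
  moreover have "BV (canonical_coeffs \<D>) A B C = BV (canonical_coeffs \<D>) A C B" for A B C
    unfolding canonical_coeffs_def conn_coeffs.simps by (subst dV[of _ C B]) (simp only: add.commute)
  moreover have "(\<Sum>d\<in>UNIV. gH \<D> a d * BH (canonical_coeffs \<D>) d b C)
      = (\<Sum>d\<in>UNIV. gH \<D> b d * BH (canonical_coeffs \<D>) d a C)" for a b C
    by (simp add: canonical_coeffs_def lower_raise[OF nH] dH[of _ a b])
  moreover have "(\<Sum>D\<in>UNIV. gV \<D> A D * (LV (canonical_coeffs \<D>) D B f - dNN \<D> (Inr B) D f))
      = (\<Sum>D\<in>UNIV. gV \<D> B D * (LV (canonical_coeffs \<D>) D A f - dNN \<D> (Inr A) D f))" for A B f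
    by (simp add: canonical_coeffs_def lower_raise[OF nV] dV[of _ A B])
  ultimately show ?thesis
    unfolding symmetric_coeffs_def by blast
qed

text \<open>All four families as one array over the index type of the whole frame: upper index,
  index of the differentiated section, direction. The zero entries between the blocks encode that
  the splitting is preserved.\<close>

definition total_coeffs :: "('k, 'r) conn_coeffs \<Rightarrow> 'r + 'k \<Rightarrow> 'r + 'k \<Rightarrow> 'r + 'k \<Rightarrow> real" where
  "total_coeffs \<Gamma> \<alpha> \<beta> \<gamma> = (case (\<alpha>, \<beta>) of
     (Inl a, Inl b) \<Rightarrow> case_sum (LH \<Gamma> a b) (BH \<Gamma> a b) \<gamma>
   | (Inr A, Inr B) \<Rightarrow> case_sum (LV \<Gamma> A B) (BV \<Gamma> A B) \<gamma>
   | _ \<Rightarrow> 0)"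

lemma total_coeffs_simps [simp]:
  "total_coeffs \<Gamma> (Inl a) (Inl b) (Inl f) = LH \<Gamma> a b f"
  "total_coeffs \<Gamma> (Inl a) (Inl b) (Inr C) = BH \<Gamma> a b C"
  "total_coeffs \<Gamma> (Inr A) (Inr B) (Inl f) = LV \<Gamma> A B f"
  "total_coeffs \<Gamma> (Inr A) (Inr B) (Inr C) = BV \<Gamma> A B C"
  "total_coeffs \<Gamma> (Inl a) (Inr B) \<gamma> = 0"
  "total_coeffs \<Gamma> (Inr A) (Inl b) \<gamma> = 0"
  by (simp_all add: total_coeffs_def)

section \<open>The connection with prescribed adapted coefficients\<close>

context charted_n_connection
begin

definition conn :: "('p \<Rightarrow> ('k, 'r) conn_coeffs)
    \<Rightarrow> ('p \<Rightarrow> ('e, 'p) prol) \<Rightarrow> ('p \<Rightarrow> ('e, 'p) prol) \<Rightarrow> 'p \<Rightarrow> ('e, 'p) prol" where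
  "conn \<Gamma> Y Z p = (\<Sum>\<alpha>\<in>UNIV. (snd (Y p) (\<lambda>q. comp q (Z q) \<alpha>)
     + (\<Sum>\<beta>\<in>UNIV. \<Sum>\<gamma>\<in>UNIV. total_coeffs (\<Gamma> p) \<alpha> \<beta> \<gamma> * comp p (Z p) \<beta> * comp p (Y p) \<gamma>)) *\<^sub>R \<epsilon> \<alpha> p)"

lemma comp_conn:
  "p \<in> Q \<Longrightarrow> comp p (conn \<Gamma> Y Z p) \<alpha> = snd (Y p) (\<lambda>q. comp q (Z q) \<alpha>)
     + (\<Sum>\<beta>\<in>UNIV. \<Sum>\<gamma>\<in>UNIV. total_coeffs (\<Gamma> p) \<alpha> \<beta> \<gamma> * comp p (Z p) \<beta> * comp p (Y p) \<gamma>)"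
  unfolding conn_def by (simp only: comp_frame_sum)

lemma conn_prol_fib: "p \<in> Q \<Longrightarrow> conn \<Gamma> Y Z p \<in> prol_fib AM AP \<pi> E p"
  unfolding conn_def using \<epsilon>_prol_fib subspace_prol_fib[of p] by (intro subspace_sum subspace_scale) auto

lemma section_tangent:
  "prol_section AM AP \<pi> E S Y \<Longrightarrow> p \<in> S \<Longrightarrow> snd (Y p) \<in> tangent_space AP p"
  by (rule prol_fib_tangent[OF prol_section_mem])

lemma comp_smooth_near:
  "open S \<Longrightarrow> S \<subseteq> Q \<Longrightarrow> prol_section AM AP \<pi> E S Z \<Longrightarrow> p \<in> S \<Longrightarrow>
    smooth_near AP p (\<lambda>q. comp q (Z q) \<alpha>)"
  using P.smooth_nearI comp_smooth by blast

text \<open>Apart from values at \<open>p\<close>, \<open>conn\<close> sees a section only through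
  derivatives of its components, and tangent vectors are local.\<close>

lemma conn_local:
  assumes "open S" "S \<subseteq> Q" "prol_section AM AP \<pi> E S Y" "p \<in> S" "\<forall>p\<in>S. Y p = Y' p \<and> Z p = Z' p"
  shows "conn \<Gamma> Y Z p = conn \<Gamma> Y' Z' p"
proof -
  have "snd (Y p) (\<lambda>q. comp q (Z q) \<alpha>) = snd (Y p) (\<lambda>q. comp q (Z' q) \<alpha>)" for \<alpha>
    by (rule P.tangent_cong[OF section_tangent[OF assms(3,4)] assms(1,4)]) (use assms(5) in simp)
  then show ?thesis
    unfolding conn_def using assms(4,5) by simp
qed

lemma conn_section:
  assumes "open S" "S \<subseteq> Q" "prol_section AM AP \<pi> E S Y" "prol_section AM AP \<pi> E S Z"
    and "\<And>\<alpha> \<beta> \<gamma>. smooth_fun AP Q (\<lambda>p. total_coeffs (\<Gamma> p) \<alpha> \<beta> \<gamma>)"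
  shows "prol_section AM AP \<pi> E S (conn \<Gamma> Y Z)"
  unfolding conn_def[abs_def]
  by (intro prol_section_frame_sum P.smooth_fun_add P.smooth_fun_sum P.smooth_fun_mult assms(1,2)
      P.smooth_fun_subset[OF assms(5,2)] comp_smooth assms(3,4)
      prol_section_smooth[OF assms(3,1) order_refl])

lemma conn_add_right:
  assumes "open S" "S \<subseteq> Q" "prol_section AM AP \<pi> E S Y"
    "prol_section AM AP \<pi> E S Z" "prol_section AM AP \<pi> E S Z'" "p \<in> S"
  shows "conn \<Gamma> Y (\<lambda>q. Z q + Z' q) p = conn \<Gamma> Y Z p + conn \<Gamma> Y Z' p"
proof -
  have c: "comp q (Z q + Z' q) \<alpha> = comp q (Z q) \<alpha> + comp q (Z' q) \<alpha>" if "q \<in> S" for q \<alpha>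
    using that assms(2) prol_section_mem[OF assms(4)] prol_section_mem[OF assms(5)] by (auto intro: comp_add)
  have t: "snd (Y p) \<in> tangent_space AP p"
    by (rule section_tangent[OF assms(3,6)])
  have "snd (Y p) (\<lambda>q. comp q (Z q + Z' q) \<alpha>)
      = snd (Y p) (\<lambda>q. comp q (Z q) \<alpha>) + snd (Y p) (\<lambda>q. comp q (Z' q) \<alpha>)" for \<alpha>
    unfolding P.tangent_add[OF t comp_smooth_near[OF assms(1,2,4,6)] comp_smooth_near[OF assms(1,2,5,6)], symmetric]
    by (rule P.tangent_cong[OF t assms(1,6) c])
  then show ?thesis
    by (simp add: conn_def c[OF assms(6)] algebra_simps sum.distrib)
qed

lemma conn_scale_right:
  assumes "open S" "S \<subseteq> Q" "prol_section AM AP \<pi> E S Y"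
    "prol_section AM AP \<pi> E S Z" "smooth_fun AP S f" "p \<in> S"
  shows "conn \<Gamma> Y (\<lambda>q. f q *\<^sub>R Z q) p = f p *\<^sub>R conn \<Gamma> Y Z p + snd (Y p) f *\<^sub>R Z p"
proof -
  have c: "comp q (f q *\<^sub>R Z q) \<alpha> = f q * comp q (Z q) \<alpha>" if "q \<in> S" for q \<alpha>
    using that assms(2) prol_section_mem[OF assms(4)] by (auto intro: comp_scale)
  have t: "snd (Y p) \<in> tangent_space AP p"
    by (rule section_tangent[OF assms(3,6)])
  have d: "snd (Y p) (\<lambda>q. comp q (f q *\<^sub>R Z q) \<alpha>)
      = f p * snd (Y p) (\<lambda>q. comp q (Z q) \<alpha>) + snd (Y p) f * comp p (Z p) \<alpha>" for \<alpha>
    unfolding P.tangent_mult[OF t P.smooth_nearI[OF assms(1,6,5)] comp_smooth_near[OF assms(1,2,4,6)], symmetric]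
    by (rule P.tangent_cong[OF t assms(1,6) c])
  have "snd (Y p) f *\<^sub>R Z p = (\<Sum>\<alpha>\<in>UNIV. (snd (Y p) f * comp p (Z p) \<alpha>) *\<^sub>R \<epsilon> \<alpha> p)"
    by (subst comp_sum[OF prol_section_mem[OF assms(4,6)]])
       (use assms(2,6) in \<open>auto simp: scaleR_sum_right\<close>)
  then have "f p *\<^sub>R conn \<Gamma> Y Z p + snd (Y p) f *\<^sub>R Z p = (\<Sum>\<alpha>\<in>UNIV. (f p * (snd (Y p) (\<lambda>q. comp q (Z q) \<alpha>)
     + (\<Sum>\<beta>\<in>UNIV. \<Sum>\<gamma>\<in>UNIV. total_coeffs (\<Gamma> p) \<alpha> \<beta> \<gamma> * comp p (Z p) \<beta> * comp p (Y p) \<gamma>))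
     + snd (Y p) f * comp p (Z p) \<alpha>) *\<^sub>R \<epsilon> \<alpha> p)"
    by (simp only: conn_def scaleR_sum_right scaleR_scaleR sum.distrib[symmetric] scaleR_left_distrib[symmetric])
  also have "\<dots> = conn \<Gamma> Y (\<lambda>q. f q *\<^sub>R Z q) p"
    unfolding conn_def d c[OF assms(6)]
    by (rule sum.cong[OF refl]) (simp add: distrib_left sum_distrib_left mult.left_commute mult.assoc)
  finally show ?thesis ..
qed

lemma conn_d_connection:
  assumes "\<And>\<alpha> \<beta> \<gamma>. smooth_fun AP Q (\<lambda>p. total_coeffs (\<Gamma> p) \<alpha> \<beta> \<gamma>)"
  shows "d_connection AM AP \<pi> E h Q (conn \<Gamma>)"
  unfolding d_connection_def
proof (intro conjI allI impI ballI)
  fix S Y Z assume S: "open S" "S \<subseteq> Q" and Y: "prol_section AM AP \<pi> E S Y"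
  show "prol_section AM AP \<pi> E S (conn \<Gamma> Y Z)" if "prol_section AM AP \<pi> E S Z"
    by (rule conn_section[OF S Y that assms])
  show "conn \<Gamma> Y Z p = conn \<Gamma> Y' Z' p" if "\<forall>p\<in>S. Y p = Y' p \<and> Z p = Z' p" "p \<in> S" for Y' Z' p
    by (rule conn_local[OF S Y that(2,1)])
  show "conn \<Gamma> (\<lambda>q. Y q + Y' q) Z p = conn \<Gamma> Y Z p + conn \<Gamma> Y' Z p"
    if "prol_section AM AP \<pi> E S Y'" "p \<in> S" for Y' p
  proof -
    have "comp p (Y p + Y' p) \<alpha> = comp p (Y p) \<alpha> + comp p (Y' p) \<alpha>" for \<alpha>
      using that S prol_section_mem[OF Y] prol_section_mem[OF that(1)] by (auto intro: comp_add)
    then show ?thesis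
      by (simp add: conn_def algebra_simps sum.distrib)
  qed
  show "conn \<Gamma> (\<lambda>q. f q *\<^sub>R Y q) Z p = f p *\<^sub>R conn \<Gamma> Y Z p" if "p \<in> S" for f p
  proof -
    have "comp p (f p *\<^sub>R Y p) \<alpha> = f p * comp p (Y p) \<alpha>" for \<alpha>
      using that S prol_section_mem[OF Y] by (auto intro: comp_scale)
    then show ?thesis
      by (simp add: conn_def scaleR_sum_right sum_distrib_left algebra_simps)
  qed
  show "conn \<Gamma> Y (\<lambda>q. Z q + Z' q) p = conn \<Gamma> Y Z p + conn \<Gamma> Y Z' p"
    if "prol_section AM AP \<pi> E S Z" "prol_section AM AP \<pi> E S Z'" "p \<in> S" for Z' p
    by (rule conn_add_right[OF S Y that])
  show "conn \<Gamma> Y (\<lambda>q. f q *\<^sub>R Z q) p = f p *\<^sub>R conn \<Gamma> Y Z p + snd (Y p) f *\<^sub>R Z p"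
    if "prol_section AM AP \<pi> E S Z" "smooth_fun AP S f" "p \<in> S" for f p
    by (rule conn_scale_right[OF S Y that])
  \<comment> \<open>Common core of both preservation properties: a component that vanishes
    identically is not created by differentiation, and the block form of \<open>total_coeffs\<close>
    feeds nothing into it from the other block.\<close>
  have zero: "comp p (conn \<Gamma> Y Z p) \<alpha> = 0"
    if "\<And>q. q \<in> S \<Longrightarrow> comp q (Z q) \<alpha> = 0" "p \<in> S"
      "\<And>\<beta> \<gamma>. total_coeffs (\<Gamma> p) \<alpha> \<beta> \<gamma> = 0 \<or> comp p (Z p) \<beta> = 0" for p \<alpha>
  proof -
    have t: "snd (Y p) \<in> tangent_space AP p"
      by (rule section_tangent[OF Y that(2)])
    have "snd (Y p) (\<lambda>q. comp q (Z q) \<alpha>) = snd (Y p) (\<lambda>q. 0)"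
      by (rule P.tangent_cong[OF t S(1) that(2)]) (rule that(1))
    moreover have "(\<Sum>\<beta>\<in>UNIV. \<Sum>\<gamma>\<in>UNIV. total_coeffs (\<Gamma> p) \<alpha> \<beta> \<gamma> * comp p (Z p) \<beta> * comp p (Y p) \<gamma>) = 0"
      using that(3) by (intro sum.neutral ballI) auto
    moreover have "p \<in> Q" using that(2) S(2) by blast
    ultimately show ?thesis
      by (simp add: comp_conn P.tangent_const[OF t])
  qed
  show "conn \<Gamma> Y Z p \<in> h p"
    if "prol_section AM AP \<pi> E S Z" "\<forall>p\<in>S. Z p \<in> h p" "p \<in> S" for p
  proof -
    have "comp q (Z q) (Inr A) = 0" if "q \<in> S" for q A
      using comp_horizontal[OF prol_section_mem] \<open>prol_section AM AP \<pi> E S Z\<close> \<open>\<forall>p\<in>S. Z p \<in> h p\<close> that S(2)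
      by blast
    moreover have "total_coeffs (\<Gamma> p) (Inr A) \<beta> \<gamma> = 0 \<or> comp p (Z p) \<beta> = 0" for A \<beta> \<gamma>
      using calculation[OF that(3)] by (cases \<beta>) auto
    moreover have "p \<in> Q" using that(3) S(2) by blast
    ultimately show ?thesis
      using comp_horizontal[OF conn_prol_fib] zero[OF _ that(3)] by blast
  qed
  show "conn \<Gamma> Y Z p \<in> prol_vert AM AP \<pi> E p"
    if "prol_section AM AP \<pi> E S Z" "\<forall>p\<in>S. Z p \<in> prol_vert AM AP \<pi> E p" "p \<in> S" for p
  proof -
    have "comp q (Z q) (Inl a) = 0" if "q \<in> S" for q a
      using comp_vertical[OF prol_section_mem] \<open>prol_section AM AP \<pi> E S Z\<close>
        \<open>\<forall>p\<in>S. Z p \<in> prol_vert AM AP \<pi> E p\<close> that S(2)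
      by blast
    moreover have "total_coeffs (\<Gamma> p) (Inl a) \<beta> \<gamma> = 0 \<or> comp p (Z p) \<beta> = 0" for a \<beta> \<gamma>
      using calculation[OF that(3)] by (cases \<beta>) auto
    moreover have "p \<in> Q" using that(3) S(2) by blast
    ultimately show ?thesis
      using comp_vertical[OF conn_prol_fib] zero[OF _ that(3)] by blast
  qed
qed

end

section \<open>The canonical d-connection in a fibred chart\<close>

lemma sum_rotate3: "(\<Sum>m\<in>A. \<Sum>b\<in>B. \<Sum>c\<in>C. f m b c) = (\<Sum>b\<in>B. \<Sum>c\<in>C. \<Sum>m\<in>A. f m b c)"
  by (subst sum.swap, intro sum.cong refl) (rule sum.swap)

lemma sum_rotate:
  "(\<Sum>m\<in>M. \<Sum>b\<in>B. \<Sum>a\<in>A. \<Sum>c\<in>C. f m b a c) = (\<Sum>a\<in>A. \<Sum>b\<in>B. \<Sum>c\<in>C. \<Sum>m\<in>M. f m b a c)"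
proof -
  have "(\<Sum>m\<in>M. \<Sum>b\<in>B. \<Sum>a\<in>A. \<Sum>c\<in>C. f m b a c) = (\<Sum>m\<in>M. \<Sum>a\<in>A. \<Sum>b\<in>B. \<Sum>c\<in>C. f m b a c)"
    by (rule sum.cong[OF refl]) (rule sum.swap)
  also have "\<dots> = (\<Sum>a\<in>A. \<Sum>m\<in>M. \<Sum>b\<in>B. \<Sum>c\<in>C. f m b a c)"
    by (rule sum.swap)
  also have "\<dots> = (\<Sum>a\<in>A. \<Sum>b\<in>B. \<Sum>c\<in>C. \<Sum>m\<in>M. f m b a c)"
    by (intro sum.cong refl) (rule sum_rotate3)
  finally show ?thesis .
qed

section \<open>The d-metric on the fibres and its matrix in the adapted frame\<close>

locale framed_d_metric = framed_n_connection AM AP \<pi> E h U e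
  for AM :: "('m::topological_space, real ^ 'n::finite) atlas"
    and AP :: "('p::topological_space, (real ^ 'n) \<times> (real ^ 'k::finite)) atlas"
    and \<pi> :: "'p \<Rightarrow> 'm"
    and E :: "('m, 'e::real_vector, 'r::finite) algebroid"
    and h :: "'p \<Rightarrow> ('e, 'p) prol set"
    and U :: "'m set" and e :: "'r \<Rightarrow> 'm \<Rightarrow> 'e" +
  fixes g :: "'p \<Rightarrow> ('e, 'p) prol \<Rightarrow> ('e, 'p) prol \<Rightarrow> real"
  assumes metric: "d_metric AM AP \<pi> E h g"
begin

lemmas metric_axioms = metric[unfolded d_metric_def]

lemma g_sym: "u \<in> prol_fib AM AP \<pi> E p \<Longrightarrow> v \<in> prol_fib AM AP \<pi> E p \<Longrightarrow> g p u v = g p v u"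
  using metric_axioms[THEN conjunct1] by simp

lemma g_linear_left:
  "u \<in> prol_fib AM AP \<pi> E p \<Longrightarrow> v \<in> prol_fib AM AP \<pi> E p \<Longrightarrow> w \<in> prol_fib AM AP \<pi> E p \<Longrightarrow>
    g p (r *\<^sub>R u + s *\<^sub>R v) w = r * g p u w + s * g p v w"
  using metric_axioms[THEN conjunct2, THEN conjunct1] by simp

lemma g_nondegenerate:
  "u \<in> prol_fib AM AP \<pi> E p \<Longrightarrow> (\<And>v. v \<in> prol_fib AM AP \<pi> E p \<Longrightarrow> g p u v = 0) \<Longrightarrow> u = 0"
  using metric_axioms[THEN conjunct2, THEN conjunct2, THEN conjunct1] by simp

lemma g_h_vert: "u \<in> h p \<Longrightarrow> v \<in> prol_vert AM AP \<pi> E p \<Longrightarrow> g p u v = 0"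
  using metric_axioms[THEN conjunct2, THEN conjunct2, THEN conjunct2, THEN conjunct1] by simp

lemma g_smooth:
  "open S \<Longrightarrow> prol_section AM AP \<pi> E S Y \<Longrightarrow> prol_section AM AP \<pi> E S Z \<Longrightarrow>
    smooth_fun AP S (\<lambda>p. g p (Y p) (Z p))"
  using metric_axioms[THEN conjunct2, THEN conjunct2, THEN conjunct2, THEN conjunct2] by simp

lemma g_sum_left:
  assumes "finite I" "\<And>i. i \<in> I \<Longrightarrow> u i \<in> prol_fib AM AP \<pi> E p" "w \<in> prol_fib AM AP \<pi> E p"
  shows "g p (\<Sum>i\<in>I. r i *\<^sub>R u i) w = (\<Sum>i\<in>I. r i * g p (u i) w)"
  using assms(1,2)
proof (induction I)
  case empty
  show ?case
    using g_linear_left[OF assms(3,3,3), of 0 0] by simp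
next
  case (insert i I)
  have "(\<Sum>i\<in>I. r i *\<^sub>R u i) \<in> prol_fib AM AP \<pi> E p"
    using insert.prems subspace_prol_fib[of p] by (intro subspace_sum subspace_scale) auto
  from g_linear_left[OF _ this assms(3), of "u i" "r i" 1] insert show ?case by simp
qed

lemma g_sum_right:
  assumes "finite I" "\<And>i. i \<in> I \<Longrightarrow> u i \<in> prol_fib AM AP \<pi> E p" "w \<in> prol_fib AM AP \<pi> E p"
  shows "g p w (\<Sum>i\<in>I. r i *\<^sub>R u i) = (\<Sum>i\<in>I. r i * g p w (u i))"
proof -
  have "(\<Sum>i\<in>I. r i *\<^sub>R u i) \<in> prol_fib AM AP \<pi> E p"
    using assms subspace_prol_fib[of p] by (intro subspace_sum subspace_scale) auto
  then have "g p w (\<Sum>i\<in>I. r i *\<^sub>R u i) = (\<Sum>i\<in>I. r i * g p (u i) w)"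
    using g_sym[OF assms(3)] g_sum_left[OF assms] by simp
  also have "\<dots> = (\<Sum>i\<in>I. r i * g p w (u i))"
    using g_sym[OF assms(3) assms(2)] by (intro sum.cong) auto
  finally show ?thesis .
qed

end

locale charted_d_metric = charted_n_connection AM AP \<pi> E h U e V \<phi> W \<psi> + framed_d_metric AM AP \<pi> E h U e g
  for AM :: "('m::topological_space, real ^ 'n::finite) atlas"
    and AP :: "('p::topological_space, (real ^ 'n) \<times> (real ^ 'k::finite)) atlas"
    and \<pi> :: "'p \<Rightarrow> 'm"
    and E :: "('m, 'e::real_vector, 'r::finite) algebroid"
    and h :: "'p \<Rightarrow> ('e, 'p) prol set"
    and U :: "'m set" and e :: "'r \<Rightarrow> 'm \<Rightarrow> 'e"
    and V :: "'m set" and \<phi> :: "'m \<Rightarrow> real ^ 'n" and W :: "'p set" and \<psi> :: "'p \<Rightarrow> (real ^ 'n) \<times> (real ^ 'k)"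
    and g :: "'p \<Rightarrow> ('e, 'p) prol \<Rightarrow> ('e, 'p) prol \<Rightarrow> real"
begin

definition gram :: "'r + 'k \<Rightarrow> 'r + 'k \<Rightarrow> 'p \<Rightarrow> real" where
  "gram \<alpha> \<beta> = (\<lambda>p. g p (\<epsilon> \<alpha> p) (\<epsilon> \<beta> p))"

abbreviation data :: "'p \<Rightarrow> ('n, 'k, 'r) local_data" where
  "data \<equiv> local_data_at AP \<pi> E h g chart e"

lemma data_simps:
  "gH (data p) a b = gram (Inl a) (Inl b) p"
  "gV (data p) A B = gram (Inr A) (Inr B) p"
  "dgH (data p) \<gamma> a b = snd (\<epsilon> \<gamma> p) (gram (Inl a) (Inl b))"
  "dgV (data p) \<gamma> A B = snd (\<epsilon> \<gamma> p) (gram (Inr A) (Inr B))"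
  "dNN (data p) \<gamma> A a = snd (\<epsilon> \<gamma> p) (N A a)"
  by (simp_all add: local_data_at_def gram_def Let_def)

lemma gram_smooth: "smooth_fun AP Q (gram \<alpha> \<beta>)"
  unfolding gram_def by (rule g_smooth[OF open_Q \<epsilon>_section \<epsilon>_section])

lemma gram_smooth_near: "p \<in> Q \<Longrightarrow> smooth_near AP p (gram \<alpha> \<beta>)"
  by (rule P.smooth_nearI[OF open_Q _ gram_smooth])

lemma gram_sym: "p \<in> Q \<Longrightarrow> gram \<alpha> \<beta> p = gram \<beta> \<alpha> p"
  unfolding gram_def by (rule g_sym[OF \<epsilon>_prol_fib \<epsilon>_prol_fib])

lemma gram_mixed:
  assumes "p \<in> Q"
  shows "gram (Inl a) (Inr B) p = 0" "gram (Inr B) (Inl a) p = 0"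
proof -
  show "gram (Inl a) (Inr B) p = 0"
    using g_h_vert[OF \<delta>_horizontal \<V>_prol_vert] assms by (simp add: gram_def)
  then show "gram (Inr B) (Inl a) p = 0"
    using gram_sym[OF assms] by simp
qed

lemma gram_nondegenerate:
  assumes "p \<in> Q"
    and "\<And>\<beta>. (\<Sum>\<alpha>\<in>UNIV. gram \<beta> \<alpha> p * x \<alpha>) = 0"
  shows "x = (\<lambda>_. 0)"
proof -
  let ?u = "\<Sum>\<alpha>\<in>UNIV. x \<alpha> *\<^sub>R \<epsilon> \<alpha> p"
  have u: "?u \<in> prol_fib AM AP \<pi> E p"
    using \<epsilon>_prol_fib[OF assms(1)] subspace_prol_fib[of p] by (intro subspace_sum subspace_scale) auto
  have 0: "g p ?u (\<epsilon> \<beta> p) = 0" for \<beta>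
  proof -
    have "g p ?u (\<epsilon> \<beta> p) = (\<Sum>\<alpha>\<in>UNIV. x \<alpha> * gram \<alpha> \<beta> p)"
      using \<epsilon>_prol_fib[OF assms(1)] by (simp add: g_sum_left gram_def)
    also have "\<dots> = (\<Sum>\<alpha>\<in>UNIV. gram \<beta> \<alpha> p * x \<alpha>)"
      by (simp add: gram_sym[OF assms(1), of \<beta>] mult.commute)
    finally show ?thesis using assms(2) by simp
  qed
  have "?u = 0"
  proof (rule g_nondegenerate[OF u])
    fix z assume z: "z \<in> prol_fib AM AP \<pi> E p"
    have "g p ?u (\<Sum>\<beta>\<in>UNIV. comp p z \<beta> *\<^sub>R \<epsilon> \<beta> p) = 0"
      using \<epsilon>_prol_fib[OF assms(1)] u by (simp add: g_sum_right 0)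
    then show "g p ?u z = 0"
      using comp_sum[OF z assms(1)] by simp
  qed
  then have "?u = (\<Sum>\<alpha>\<in>UNIV. 0 *\<^sub>R \<epsilon> \<alpha> p)" by simp
  from is_basis_unique[OF \<epsilon>_basis[OF assms(1)] this] show ?thesis .
qed

text \<open>Each block is nondegenerate because a kernel vector of one block, extended by 0, is a
  kernel vector of the whole Gram matrix: the mixed entries vanish. Symmetry of the derivatives
  holds since the Gram matrix is symmetric on a neighbourhood.\<close>

lemma regular:
  assumes "p \<in> Q"
  shows "regular_data (data p)"
proof -
  have t: "snd (\<epsilon> \<gamma> p) \<in> tangent_space AP p" for \<gamma>
    by (rule \<epsilon>_tangent[OF assms])
  have "nondegenerate (gH (data p))"
    unfolding nondegenerate_def
  proof (rule allI, rule impI, rule allI)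
    fix x j assume "\<forall>i. (\<Sum>j\<in>UNIV. gH (data p) i j * x j) = 0"
    then have "(\<Sum>\<alpha>\<in>UNIV. gram \<beta> \<alpha> p * case_sum x (\<lambda>_. 0) \<alpha>) = 0" for \<beta>
      by (cases \<beta>) (simp_all add: sum_UNIV_Plus data_simps gram_mixed[OF assms])
    from fun_cong[OF gram_nondegenerate[OF assms this], of "Inl j"] show "x j = 0" by simp
  qed
  moreover have "nondegenerate (gV (data p))"
    unfolding nondegenerate_def
  proof (rule allI, rule impI, rule allI)
    fix x j assume "\<forall>i. (\<Sum>j\<in>UNIV. gV (data p) i j * x j) = 0"
    then have "(\<Sum>\<alpha>\<in>UNIV. gram \<beta> \<alpha> p * case_sum (\<lambda>_. 0) x \<alpha>) = 0" for \<beta>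
      by (cases \<beta>) (simp_all add: sum_UNIV_Plus data_simps gram_mixed[OF assms])
    from fun_cong[OF gram_nondegenerate[OF assms this], of "Inr j"] show "x j = 0" by simp
  qed
  moreover have "snd (\<epsilon> \<gamma> p) (gram \<alpha> \<beta>) = snd (\<epsilon> \<gamma> p) (gram \<beta> \<alpha>)" for \<alpha> \<beta> \<gamma>
    by (rule P.tangent_cong[OF t open_Q assms gram_sym])
  ultimately show ?thesis
    unfolding regular_data_def data_simps using gram_sym[OF assms] by blast
qed

text \<open>The four clauses of \<open>metric_coeffs\<close> merged into one formula over the total
  index. For mixed indices both sides are 0: the Gram entry vanishes on all of \<open>Q\<close>, and
  on the right each product contains a zero factor.\<close>

lemma gram_derivative:
  assumes "p \<in> Q" "metric_coeffs (data p) \<Gamma>"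
  shows "snd (\<epsilon> \<gamma> p) (gram \<alpha> \<beta>) = (\<Sum>\<mu>\<in>UNIV. total_coeffs \<Gamma> \<mu> \<alpha> \<gamma> * gram \<mu> \<beta> p)
    + (\<Sum>\<mu>\<in>UNIV. total_coeffs \<Gamma> \<mu> \<beta> \<gamma> * gram \<alpha> \<mu> p)"
proof -
  note m = assms(2)[unfolded metric_coeffs_def data_simps]
  have 0: "snd (\<epsilon> \<gamma> p) (gram \<alpha> \<beta>) = 0" if "\<And>q. q \<in> Q \<Longrightarrow> gram \<alpha> \<beta> q = 0" for \<alpha> \<beta> \<gamma>
    using P.tangent_cong[OF \<epsilon>_tangent[OF assms(1)] open_Q assms(1) that]
      P.tangent_const[OF \<epsilon>_tangent[OF assms(1)]] by simp
  have mixed: "snd (\<epsilon> \<gamma> p) (gram (Inl a) (Inr B)) = 0" "snd (\<epsilon> \<gamma> p) (gram (Inr B) (Inl a)) = 0" for a B \<gamma>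
    by (rule 0, erule gram_mixed)+
  show ?thesis
  proof (cases \<alpha>; cases \<beta>; cases \<gamma>)
    fix a b f assume "\<alpha> = Inl a" "\<beta> = Inl b" "\<gamma> = Inl f"
    then show ?thesis
      using m by (simp add: sum_UNIV_Plus gram_sym[OF assms(1), of _ "Inl b"] mult.commute)
  next
    fix a b C assume "\<alpha> = Inl a" "\<beta> = Inl b" "\<gamma> = Inr C"
    then show ?thesis
      using m by (simp add: sum_UNIV_Plus gram_sym[OF assms(1), of _ "Inl b"] mult.commute)
  next
    fix A B f assume "\<alpha> = Inr A" "\<beta> = Inr B" "\<gamma> = Inl f"
    then show ?thesis
      using m by (simp add: sum_UNIV_Plus gram_sym[OF assms(1), of _ "Inr B"] mult.commute)
  next
    fix A B C assume "\<alpha> = Inr A" "\<beta> = Inr B" "\<gamma> = Inr C"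
    then show ?thesis
      using m by (simp add: sum_UNIV_Plus gram_sym[OF assms(1), of _ "Inr B"] mult.commute)
  qed (simp_all add: mixed[of "Inl _", simplified] mixed[of "Inr _", simplified] gram_mixed[OF assms(1)] sum_UNIV_Plus)
qed

lemma g_comp:
  assumes "p \<in> Q" "u \<in> prol_fib AM AP \<pi> E p" "w \<in> prol_fib AM AP \<pi> E p"
  shows "g p u w = (\<Sum>\<alpha>\<in>UNIV. \<Sum>\<beta>\<in>UNIV. comp p u \<alpha> * comp p w \<beta> * gram \<alpha> \<beta> p)"
proof -
  have "g p u w = g p (\<Sum>\<alpha>\<in>UNIV. comp p u \<alpha> *\<^sub>R \<epsilon> \<alpha> p) (\<Sum>\<alpha>\<in>UNIV. comp p w \<alpha> *\<^sub>R \<epsilon> \<alpha> p)"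
    using comp_sum[OF assms(2,1)] comp_sum[OF assms(3,1)] by simp
  also have "\<dots> = (\<Sum>\<alpha>\<in>UNIV. comp p u \<alpha> * g p (\<epsilon> \<alpha> p) (\<Sum>\<alpha>\<in>UNIV. comp p w \<alpha> *\<^sub>R \<epsilon> \<alpha> p))"
    using \<epsilon>_prol_fib[OF assms(1)] subspace_prol_fib[of p]
    by (intro g_sum_left subspace_sum subspace_scale) auto
  also have "\<dots> = (\<Sum>\<alpha>\<in>UNIV. comp p u \<alpha> * (\<Sum>\<beta>\<in>UNIV. comp p w \<beta> * gram \<alpha> \<beta> p))"
    using \<epsilon>_prol_fib[OF assms(1)] by (simp add: g_sum_right gram_def)
  finally show ?thesis
    by (simp add: sum_distrib_left mult.assoc)
qed

lemma tangent_comp: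
  assumes "p \<in> Q" "z \<in> prol_fib AM AP \<pi> E p"
  shows "snd z f = (\<Sum>\<gamma>\<in>UNIV. comp p z \<gamma> * snd (\<epsilon> \<gamma> p) f)"
  by (subst comp_sum[OF assms(2,1)]) (simp add: snd_sum sum_fun_apply)

text \<open>Write g(Y, Z) as a sum of components times Gram entries and apply the Leibniz rule. By
  \<open>gram_derivative\<close> the derivatives of the Gram entries are the connection terms of the
  right-hand side; the rest is reordering of finite sums.\<close>

lemma conn_metric_compatible:
  assumes "\<And>p. p \<in> Q \<Longrightarrow> metric_coeffs (data p) (\<Gamma> p)"
  shows "metric_compatible AM AP \<pi> E g Q (conn \<Gamma>)"
  unfolding metric_compatible_def
proof (intro allI impI ballI)
  fix S X Y Z p
  assume S: "open S" "S \<subseteq> Q" and X: "prol_section AM AP \<pi> E S X" and Y: "prol_section AM AP \<pi> E S Y"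
    and Z: "prol_section AM AP \<pi> E S Z" and p: "p \<in> S"
  have pQ: "p \<in> Q" using p S by blast
  have t: "snd (X p) \<in> tangent_space AP p"
    by (rule section_tangent[OF X p])
  let ?x = "comp p (X p)" and ?y = "comp p (Y p)" and ?z = "comp p (Z p)"
  let ?dy = "\<lambda>\<alpha>. snd (X p) (\<lambda>q. comp q (Y q) \<alpha>)" and ?dz = "\<lambda>\<alpha>. snd (X p) (\<lambda>q. comp q (Z q) \<alpha>)"
  let ?T = "total_coeffs (\<Gamma> p)" and ?g = "\<lambda>\<alpha> \<beta>. gram \<alpha> \<beta> p"
  have nY: "smooth_near AP p (\<lambda>q. comp q (Y q) \<alpha>)" and nZ: "smooth_near AP p (\<lambda>q. comp q (Z q) \<alpha>)" for \<alpha>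
    using comp_smooth_near[OF S _ p] Y Z by blast+
  note nYZ = P.smooth_near_mult[OF nY nZ]
  note nYZg = P.smooth_near_mult[OF nYZ gram_smooth_near[OF pQ]]
  have dg: "snd (X p) (gram \<alpha> \<beta>) = (\<Sum>\<gamma>\<in>UNIV. ?x \<gamma> * ((\<Sum>\<mu>\<in>UNIV. ?T \<mu> \<alpha> \<gamma> * ?g \<mu> \<beta>)
      + (\<Sum>\<mu>\<in>UNIV. ?T \<mu> \<beta> \<gamma> * ?g \<alpha> \<mu>)))" for \<alpha> \<beta>
    using tangent_comp[OF pQ prol_section_mem[OF X p]] gram_derivative[OF pQ assms[OF pQ]] by simp
  have "snd (X p) (\<lambda>q. g q (Y q) (Z q))
      = snd (X p) (\<lambda>q. \<Sum>\<alpha>\<in>UNIV. \<Sum>\<beta>\<in>UNIV. comp q (Y q) \<alpha> * comp q (Z q) \<beta> * gram \<alpha> \<beta> q)"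
    by (rule P.tangent_cong[OF t S(1) p])
       (use S(2) prol_section_mem[OF Y] prol_section_mem[OF Z] in \<open>auto intro!: g_comp\<close>)
  also have "\<dots> = (\<Sum>\<alpha>\<in>UNIV. \<Sum>\<beta>\<in>UNIV. ?y \<alpha> * ?z \<beta> * snd (X p) (gram \<alpha> \<beta>)
      + (?y \<alpha> * ?dz \<beta> + ?dy \<alpha> * ?z \<beta>) * ?g \<alpha> \<beta>)"
    by (simp only: P.tangent_sum[OF t P.smooth_near_sum[OF nYZg]] P.tangent_sum[OF t nYZg]
        P.tangent_mult[OF t nYZ gram_smooth_near[OF pQ]] P.tangent_mult[OF t nY nZ])
  also have "\<dots> = (\<Sum>\<alpha>\<in>UNIV. \<Sum>\<beta>\<in>UNIV. ?dy \<alpha> * ?z \<beta> * ?g \<alpha> \<beta>)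
      + (\<Sum>\<alpha>\<in>UNIV. \<Sum>\<beta>\<in>UNIV. ?y \<alpha> * ?dz \<beta> * ?g \<alpha> \<beta>)
      + (\<Sum>\<alpha>\<in>UNIV. \<Sum>\<beta>\<in>UNIV. \<Sum>\<gamma>\<in>UNIV. \<Sum>\<mu>\<in>UNIV. ?y \<alpha> * ?z \<beta> * ?x \<gamma> * ?T \<mu> \<alpha> \<gamma> * ?g \<mu> \<beta>)
      + (\<Sum>\<alpha>\<in>UNIV. \<Sum>\<beta>\<in>UNIV. \<Sum>\<gamma>\<in>UNIV. \<Sum>\<mu>\<in>UNIV. ?y \<alpha> * ?z \<beta> * ?x \<gamma> * ?T \<mu> \<beta> \<gamma> * ?g \<alpha> \<mu>)"
    by (simp add: dg sum.distrib sum_distrib_left algebra_simps)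
  finally have lhs: "snd (X p) (\<lambda>q. g q (Y q) (Z q)) = \<dots>" .
  have "g p (conn \<Gamma> X Y p) (Z p) = (\<Sum>\<mu>\<in>UNIV. \<Sum>\<beta>\<in>UNIV. comp p (conn \<Gamma> X Y p) \<mu> * ?z \<beta> * ?g \<mu> \<beta>)"
    by (rule g_comp[OF pQ conn_prol_fib[OF pQ] prol_section_mem[OF Z p]])
  also have "\<dots> = (\<Sum>\<mu>\<in>UNIV. \<Sum>\<beta>\<in>UNIV. ?dy \<mu> * ?z \<beta> * ?g \<mu> \<beta>)
      + (\<Sum>\<mu>\<in>UNIV. \<Sum>\<beta>\<in>UNIV. \<Sum>\<alpha>\<in>UNIV. \<Sum>\<gamma>\<in>UNIV. ?y \<alpha> * ?z \<beta> * ?x \<gamma> * ?T \<mu> \<alpha> \<gamma> * ?g \<mu> \<beta>)"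
    by (simp add: comp_conn[OF pQ] sum.distrib sum_distrib_left sum_distrib_right algebra_simps)
  finally have r1: "g p (conn \<Gamma> X Y p) (Z p) = \<dots>" .
  have rot1: "(\<Sum>\<mu>\<in>UNIV. \<Sum>\<beta>\<in>UNIV. \<Sum>\<alpha>\<in>UNIV. \<Sum>\<gamma>\<in>UNIV. ?y \<alpha> * ?z \<beta> * ?x \<gamma> * ?T \<mu> \<alpha> \<gamma> * ?g \<mu> \<beta>)
      = (\<Sum>\<alpha>\<in>UNIV. \<Sum>\<beta>\<in>UNIV. \<Sum>\<gamma>\<in>UNIV. \<Sum>\<mu>\<in>UNIV. ?y \<alpha> * ?z \<beta> * ?x \<gamma> * ?T \<mu> \<alpha> \<gamma> * ?g \<mu> \<beta>)"
    by (rule sum_rotate)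
  have "g p (Y p) (conn \<Gamma> X Z p) = (\<Sum>\<alpha>\<in>UNIV. \<Sum>\<mu>\<in>UNIV. ?y \<alpha> * comp p (conn \<Gamma> X Z p) \<mu> * ?g \<alpha> \<mu>)"
    by (rule g_comp[OF pQ prol_section_mem[OF Y p] conn_prol_fib[OF pQ]])
  also have "\<dots> = (\<Sum>\<alpha>\<in>UNIV. \<Sum>\<mu>\<in>UNIV. ?y \<alpha> * ?dz \<mu> * ?g \<alpha> \<mu>)
      + (\<Sum>\<alpha>\<in>UNIV. \<Sum>\<mu>\<in>UNIV. \<Sum>\<beta>\<in>UNIV. \<Sum>\<gamma>\<in>UNIV. ?y \<alpha> * ?z \<beta> * ?x \<gamma> * ?T \<mu> \<beta> \<gamma> * ?g \<alpha> \<mu>)"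
    by (simp add: comp_conn[OF pQ] sum.distrib sum_distrib_left sum_distrib_right algebra_simps)
  finally have r2: "g p (Y p) (conn \<Gamma> X Z p) = \<dots>" .
  have rot2: "(\<Sum>\<alpha>\<in>UNIV. \<Sum>\<mu>\<in>UNIV. \<Sum>\<beta>\<in>UNIV. \<Sum>\<gamma>\<in>UNIV. ?y \<alpha> * ?z \<beta> * ?x \<gamma> * ?T \<mu> \<beta> \<gamma> * ?g \<alpha> \<mu>)
      = (\<Sum>\<alpha>\<in>UNIV. \<Sum>\<beta>\<in>UNIV. \<Sum>\<gamma>\<in>UNIV. \<Sum>\<mu>\<in>UNIV. ?y \<alpha> * ?z \<beta> * ?x \<gamma> * ?T \<mu> \<beta> \<gamma> * ?g \<alpha> \<mu>)"
    by (rule sum.cong[OF refl], rule sum_rotate3)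
  show "snd (X p) (\<lambda>q. g q (Y q) (Z q)) = g p (conn \<Gamma> X Y p) (Z p) + g p (Y p) (conn \<Gamma> X Z p)"
    unfolding lhs r1 r2 rot1 rot2 by simp
qed

text \<open>The raised vector solves a linear system with smooth coefficients, so Cramer's rule
  applies and no smoothness of \<open>matrix_inv\<close> has to be discussed.\<close>

lemma raise_smooth:
  assumes "\<And>i j. smooth_fun AP Q (\<lambda>p. G p i j)" "\<And>i. smooth_fun AP Q (\<lambda>p. \<omega> p i)"
    and "\<And>p. p \<in> Q \<Longrightarrow> nondegenerate (G p)"
  shows "smooth_fun AP Q (\<lambda>p. raise (G p) (\<omega> p) i)"
proof -
  have "smooth_fun AP Q (\<lambda>p. (\<chi> i. raise (G p) (\<omega> p) i) $ i)"
    by (rule P.smooth_fun_linear_system[OF open_Q, where M = "\<lambda>p. \<chi> i j. G p i j" and b = "\<lambda>p. \<chi> i. \<omega> p i"])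
       (use assms in \<open>simp_all add: nondegenerate_invertible vec_eq_iff matrix_vector_mult_def lower_raise\<close>)
  then show ?thesis by simp
qed

lemma canonical_smooth: "smooth_fun AP Q (\<lambda>p. total_coeffs (canonical_coeffs (data p)) \<alpha> \<beta> \<gamma>)"
proof -
  have n: "nondegenerate (gH (data p))" "nondegenerate (gV (data p))" if "p \<in> Q" for p
    using regular[OF that] by (auto simp: regular_data_def)
  have G: "smooth_fun AP Q (\<lambda>p. gH (data p) a b)" "smooth_fun AP Q (\<lambda>p. gV (data p) A B)" for a b A B
    by (simp_all add: data_simps gram_smooth)
  have d: "smooth_fun AP Q (\<lambda>p. dgH (data p) \<gamma> a b)" "smooth_fun AP Q (\<lambda>p. dgV (data p) \<gamma> A B)"
    "smooth_fun AP Q (\<lambda>p. dNN (data p) \<gamma> A a)" for \<gamma> a b A B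
    by (simp_all add: data_simps \<epsilon>_smooth[OF open_Q order_refl] gram_smooth N_smooth)
  have half: "smooth_fun AP Q (\<lambda>p. f p / 2)" if "smooth_fun AP Q f" for f
    by (rule P.smooth_fun_divide[OF open_Q that P.smooth_fun_const]) simp
  have LH: "smooth_fun AP Q (\<lambda>p. LH (canonical_coeffs (data p)) a b f)" for a b f
    unfolding canonical_coeffs_def conn_coeffs.simps
    by (intro raise_smooth n half P.smooth_fun_add P.smooth_fun_diff G d open_Q)
  moreover have "smooth_fun AP Q (\<lambda>p. BH (canonical_coeffs (data p)) a b C)" for a b C
    unfolding canonical_coeffs_def conn_coeffs.simps
    by (intro raise_smooth n half G d open_Q)
  moreover have "smooth_fun AP Q (\<lambda>p. BV (canonical_coeffs (data p)) A B C)" for A B C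
    unfolding canonical_coeffs_def conn_coeffs.simps
    by (intro raise_smooth n half P.smooth_fun_add P.smooth_fun_diff G d open_Q)
  moreover have "smooth_fun AP Q (\<lambda>p. LV (canonical_coeffs (data p)) A B f)" for A B f
    unfolding canonical_coeffs_def conn_coeffs.simps
    by (intro raise_smooth n half P.smooth_fun_add P.smooth_fun_diff P.smooth_fun_sum P.smooth_fun_mult G d open_Q)
  ultimately show ?thesis
    by (cases \<alpha>; cases \<beta>; cases \<gamma>) simp_all
qed

abbreviation D\<^sub>c :: "('p \<Rightarrow> ('e, 'p) prol) \<Rightarrow> ('p \<Rightarrow> ('e, 'p) prol) \<Rightarrow> 'p \<Rightarrow> ('e, 'p) prol" where
  "D\<^sub>c \<equiv> conn (\<lambda>p. canonical_coeffs (data p))"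

lemma canonical_d_connection: "d_connection AM AP \<pi> E h Q D\<^sub>c"
  by (rule conn_d_connection[OF canonical_smooth])

lemma canonical_metric_compatible: "metric_compatible AM AP \<pi> E g Q D\<^sub>c"
  by (rule conn_metric_compatible[OF canonical_coeffs_metric[OF regular]])

end

section \<open>Expansion of an arbitrary d-connection in the adapted frame\<close>

lemmas d_connection_axioms = d_connection_def[THEN iffD1]
lemmas d_connection_section = d_connection_axioms[THEN conjunct1, rule_format]
lemmas d_connection_local = d_connection_axioms[THEN conjunct2, THEN conjunct1, rule_format]
lemmas d_connection_add_left = d_connection_axioms[THEN conjunct2, THEN conjunct2, THEN conjunct1, rule_format]
lemmas d_connection_scale_left = d_connection_axioms[THEN conjunct2, THEN conjunct2, THEN conjunct2,
    THEN conjunct1, rule_format]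
lemmas d_connection_add_right = d_connection_axioms[THEN conjunct2, THEN conjunct2, THEN conjunct2,
    THEN conjunct2, THEN conjunct1, rule_format]
lemmas d_connection_scale_right = d_connection_axioms[THEN conjunct2, THEN conjunct2, THEN conjunct2,
    THEN conjunct2, THEN conjunct2, THEN conjunct1, rule_format]
lemmas d_connection_horizontal = d_connection_axioms[THEN conjunct2, THEN conjunct2, THEN conjunct2,
    THEN conjunct2, THEN conjunct2, THEN conjunct2, THEN conjunct1, rule_format]
lemmas d_connection_vertical = d_connection_axioms[THEN conjunct2, THEN conjunct2, THEN conjunct2,
    THEN conjunct2, THEN conjunct2, THEN conjunct2, THEN conjunct2, rule_format]

lemma metric_compatibleD:
  "metric_compatible AM AP \<pi> E g Q D \<Longrightarrow> open S \<Longrightarrow> S \<subseteq> Q \<Longrightarrow> prol_section AM AP \<pi> E S X \<Longrightarrow>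
    prol_section AM AP \<pi> E S Y \<Longrightarrow> prol_section AM AP \<pi> E S Z \<Longrightarrow> p \<in> S \<Longrightarrow>
    snd (X p) (\<lambda>q. g q (Y q) (Z q)) = g p (D X Y p) (Z p) + g p (Y p) (D X Z p)"
  unfolding metric_compatible_def by simp

context charted_n_connection
begin

text \<open>Additivity of a connection is extended to sums by induction on the index set, and each
  partial sum must be known to be a section.\<close>

lemma partial_frame_section:
  assumes "open S" "S \<subseteq> Q" "\<And>\<alpha>. smooth_fun AP S (z \<alpha>)"
  shows "prol_section AM AP \<pi> E S (\<lambda>p. \<Sum>\<alpha>\<in>I. z \<alpha> p *\<^sub>R \<epsilon> \<alpha> p)"
proof -
  have "prol_section AM AP \<pi> E S (\<lambda>p. \<Sum>\<alpha>\<in>UNIV. (if \<alpha> \<in> I then z \<alpha> p else 0) *\<^sub>R \<epsilon> \<alpha> p)"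
  proof (rule prol_section_frame_sum[OF assms(1,2)])
    show "smooth_fun AP S (\<lambda>p. if \<alpha> \<in> I then z \<alpha> p else 0)" for \<alpha>
      using assms(3) by (cases "\<alpha> \<in> I") auto
  qed
  then show ?thesis
    by (simp add: if_distrib[of "\<lambda>c. c *\<^sub>R _"] sum.If_cases cong: if_cong)
qed

text \<open>\<open>R\<close> is kept apart from \<open>Q\<close> because the connection of one chart
  will be expanded in the frame of another.\<close>

context
  fixes D R
  assumes d: "d_connection AM AP \<pi> E h R D" and R: "open R"
begin

lemma D_sum_right:
  assumes S: "open S" "S \<subseteq> R" "S \<subseteq> Q" and Y: "prol_section AM AP \<pi> E S Y"
    and z: "\<And>\<alpha>. smooth_fun AP S (z \<alpha>)" and p: "p \<in> S"
  shows "D Y (\<lambda>q. \<Sum>\<alpha>\<in>UNIV. z \<alpha> q *\<^sub>R \<epsilon> \<alpha> q) p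
    = (\<Sum>\<alpha>\<in>UNIV. z \<alpha> p *\<^sub>R D Y (\<epsilon> \<alpha>) p + snd (Y p) (z \<alpha>) *\<^sub>R \<epsilon> \<alpha> p)"
proof -
  have t: "snd (Y p) \<in> tangent_space AP p"
    by (rule section_tangent[OF Y p])
  have \<epsilon>: "prol_section AM AP \<pi> E S (\<epsilon> \<alpha>)" for \<alpha>
    by (rule prol_section_subset[OF \<epsilon>_section S(3)])
  have "D Y (\<lambda>q. \<Sum>\<alpha>\<in>I. z \<alpha> q *\<^sub>R \<epsilon> \<alpha> q) p
    = (\<Sum>\<alpha>\<in>I. z \<alpha> p *\<^sub>R D Y (\<epsilon> \<alpha>) p + snd (Y p) (z \<alpha>) *\<^sub>R \<epsilon> \<alpha> p)" if "finite I" for I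
    using that
  proof (induction I)
    case empty
    \<comment> \<open>The empty sum is the section 0, written as 0 times \<open>Y\<close> so that
      the Leibniz rule evaluates its derivative.\<close>
    have "D Y (\<lambda>q. 0 *\<^sub>R Y q) p = 0 *\<^sub>R D Y Y p + snd (Y p) (\<lambda>_. 0) *\<^sub>R Y p"
      by (rule d_connection_scale_right[OF d S(1,2) Y Y P.smooth_fun_const p])
    then show ?case by (simp add: P.tangent_const[OF t])
  next
    case (insert \<alpha> I)
    have "prol_section AM AP \<pi> E S (\<lambda>q. z \<alpha> q *\<^sub>R \<epsilon> \<alpha> q)"
      using partial_frame_section[OF S(1,3) z, where I = "{\<alpha>}"] by simp
    from d_connection_add_right[OF d S(1,2) Y this partial_frame_section[OF S(1,3) z] p]
      d_connection_scale_right[OF d S(1,2) Y \<epsilon> z p] insert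
    show ?case by simp
  qed
  then show ?thesis by simp
qed

lemma D_sum_left:
  assumes S: "open S" "S \<subseteq> R" "S \<subseteq> Q" and Z: "prol_section AM AP \<pi> E S Z"
    and w: "\<And>\<alpha>. smooth_fun AP S (w \<alpha>)" and p: "p \<in> S"
  shows "D (\<lambda>q. \<Sum>\<alpha>\<in>UNIV. w \<alpha> q *\<^sub>R \<epsilon> \<alpha> q) Z p = (\<Sum>\<alpha>\<in>UNIV. w \<alpha> p *\<^sub>R D (\<epsilon> \<alpha>) Z p)"
proof -
  have \<epsilon>: "prol_section AM AP \<pi> E S (\<epsilon> \<alpha>)" for \<alpha>
    by (rule prol_section_subset[OF \<epsilon>_section S(3)])
  have "D (\<lambda>q. \<Sum>\<alpha>\<in>I. w \<alpha> q *\<^sub>R \<epsilon> \<alpha> q) Z p = (\<Sum>\<alpha>\<in>I. w \<alpha> p *\<^sub>R D (\<epsilon> \<alpha>) Z p)" if "finite I" for I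
    using that
  proof (induction I)
    case empty
    have "D (\<lambda>q. 0 *\<^sub>R Z q) Z p = 0 *\<^sub>R D Z Z p"
      by (rule d_connection_scale_left[OF d S(1,2) Z Z P.smooth_fun_const p])
    then show ?case by simp
  next
    case (insert \<alpha> I)
    have "prol_section AM AP \<pi> E S (\<lambda>q. w \<alpha> q *\<^sub>R \<epsilon> \<alpha> q)"
      using partial_frame_section[OF S(1,3) w, where I = "{\<alpha>}"] by simp
    from d_connection_add_left[OF d S(1,2) this partial_frame_section[OF S(1,3) w] Z p]
      d_connection_scale_left[OF d S(1,2) \<epsilon> Z w p] insert
    show ?case by simp
  qed
  then show ?thesis by simp
qed

abbreviation \<Gamma>\<^sub>D :: "'p \<Rightarrow> ('k, 'r) conn_coeffs" where
  "\<Gamma>\<^sub>D \<equiv> adapted_coeffs AP \<pi> E h chart e D"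

text \<open>Preservation of the splitting places the derivative of \<delta>_b in \<open>h\<close>
  and that of V_B in the vertical space, so the four families of adapted coefficients describe it
  completely.\<close>

lemma D_frame:
  assumes "p \<in> R" "p \<in> Q"
  shows "D (\<epsilon> \<gamma>) (\<epsilon> \<beta>) p = (\<Sum>\<alpha>\<in>UNIV. total_coeffs (\<Gamma>\<^sub>D p) \<alpha> \<beta> \<gamma> *\<^sub>R \<epsilon> \<alpha> p)"
proof -
  have S: "open (R \<inter> Q)" "R \<inter> Q \<subseteq> R" "p \<in> R \<inter> Q"
    using R open_Q assms by auto
  have \<epsilon>: "prol_section AM AP \<pi> E (R \<inter> Q) (\<epsilon> \<alpha>)" for \<alpha>
    by (rule prol_section_subset[OF \<epsilon>_section]) blast
  show ?thesis
  proof (cases \<beta>)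
    case (Inl b)
    have "D (\<epsilon> \<gamma>) (\<epsilon> (Inl b)) p \<in> h p"
      by (rule d_connection_horizontal[OF d S(1,2) \<epsilon> \<epsilon> _ S(3)]) (simp add: \<delta>_horizontal)
    from is_basis_sum[OF \<delta>_basis[OF assms(2)] this] show ?thesis
      using Inl by (cases \<gamma>) (simp_all add: sum_UNIV_Plus adapted_coeffs_def Let_def)
  next
    case (Inr B)
    have "D (\<epsilon> \<gamma>) (\<epsilon> (Inr B)) p \<in> prol_vert AM AP \<pi> E p"
      by (rule d_connection_vertical[OF d S(1,2) \<epsilon> \<epsilon> _ S(3)]) (simp add: \<V>_prol_vert)
    moreover have "p \<in> W" using assms(2) by simp
    ultimately show ?thesis
      using is_basis_sum[OF \<V>_basis, of p "D (\<epsilon> \<gamma>) (\<epsilon> (Inr B)) p"] Inr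
      by (cases \<gamma>) (simp_all add: sum_UNIV_Plus adapted_coeffs_def Let_def)
  qed
qed

text \<open>A d-connection is recovered from its adapted coefficients, so uniqueness of the
  coefficients becomes uniqueness of the connection.\<close>

lemma D_eq_conn:
  assumes S: "open S" "S \<subseteq> R" "S \<subseteq> Q" and Y: "prol_section AM AP \<pi> E S Y"
    and Z: "prol_section AM AP \<pi> E S Z" and p: "p \<in> S"
  shows "D Y Z p = conn \<Gamma>\<^sub>D Y Z p"
proof -
  let ?T = "total_coeffs (\<Gamma>\<^sub>D p)"
  have pRQ: "p \<in> R" "p \<in> Q" using S p by auto
  have \<epsilon>: "prol_section AM AP \<pi> E S (\<epsilon> \<alpha>)" for \<alpha>
    by (rule prol_section_subset[OF \<epsilon>_section S(3)])
  have Y': "Y q = (\<Sum>\<alpha>\<in>UNIV. comp q (Y q) \<alpha> *\<^sub>R \<epsilon> \<alpha> q)" and Z': "Z q = (\<Sum>\<alpha>\<in>UNIV. comp q (Z q) \<alpha> *\<^sub>R \<epsilon> \<alpha> q)"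
    if "q \<in> S" for q
    using comp_sum[OF prol_section_mem[OF Y that]] comp_sum[OF prol_section_mem[OF Z that]] that S(3) by blast+
  have 1: "D Y (\<epsilon> \<beta>) p = (\<Sum>\<gamma>\<in>UNIV. comp p (Y p) \<gamma> *\<^sub>R (\<Sum>\<alpha>\<in>UNIV. ?T \<alpha> \<beta> \<gamma> *\<^sub>R \<epsilon> \<alpha> p))" for \<beta>
  proof -
    have "D Y (\<epsilon> \<beta>) p = D (\<lambda>q. \<Sum>\<alpha>\<in>UNIV. comp q (Y q) \<alpha> *\<^sub>R \<epsilon> \<alpha> q) (\<epsilon> \<beta>) p"
      by (rule d_connection_local[OF d S(1,2) Y \<epsilon> _ p]) (use Y' in simp)
    also have "\<dots> = (\<Sum>\<gamma>\<in>UNIV. comp p (Y p) \<gamma> *\<^sub>R D (\<epsilon> \<gamma>) (\<epsilon> \<beta>) p)"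
      by (rule D_sum_left[OF S \<epsilon> comp_smooth[OF S(1,3) Y] p])
    finally show ?thesis
      by (simp only: D_frame[OF pRQ])
  qed
  have "D Y Z p = D Y (\<lambda>q. \<Sum>\<alpha>\<in>UNIV. comp q (Z q) \<alpha> *\<^sub>R \<epsilon> \<alpha> q) p"
    by (rule d_connection_local[OF d S(1,2) Y Z _ p]) (use Z' in simp)
  also have "\<dots> = (\<Sum>\<beta>\<in>UNIV. comp p (Z p) \<beta> *\<^sub>R D Y (\<epsilon> \<beta>) p + snd (Y p) (\<lambda>q. comp q (Z q) \<beta>) *\<^sub>R \<epsilon> \<beta> p)"
    by (rule D_sum_right[OF S Y comp_smooth[OF S(1,3) Z] p])
  also have "\<dots> = (\<Sum>\<beta>\<in>UNIV. \<Sum>\<gamma>\<in>UNIV. \<Sum>\<alpha>\<in>UNIV. (?T \<alpha> \<beta> \<gamma> * comp p (Z p) \<beta> * comp p (Y p) \<gamma>) *\<^sub>R \<epsilon> \<alpha> p)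
      + (\<Sum>\<alpha>\<in>UNIV. snd (Y p) (\<lambda>q. comp q (Z q) \<alpha>) *\<^sub>R \<epsilon> \<alpha> p)"
    unfolding 1 by (simp add: sum.distrib scaleR_sum_right mult.commute mult.left_commute)
  also have "(\<Sum>\<beta>\<in>UNIV. \<Sum>\<gamma>\<in>UNIV. \<Sum>\<alpha>\<in>UNIV. (?T \<alpha> \<beta> \<gamma> * comp p (Z p) \<beta> * comp p (Y p) \<gamma>) *\<^sub>R \<epsilon> \<alpha> p)
      = (\<Sum>\<alpha>\<in>UNIV. \<Sum>\<beta>\<in>UNIV. \<Sum>\<gamma>\<in>UNIV. (?T \<alpha> \<beta> \<gamma> * comp p (Z p) \<beta> * comp p (Y p) \<gamma>) *\<^sub>R \<epsilon> \<alpha> p)"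
    by (rule sum_rotate3[symmetric])
  finally show ?thesis
    by (simp add: conn_def scaleR_left_distrib scaleR_sum_left sum.distrib add.commute)
qed

end

text \<open>The components of a frame section are constant, hence the derivative term drops
  out.\<close>

lemma conn_frame:
  assumes "p \<in> Q"
  shows "conn \<Gamma> (\<epsilon> \<gamma>) (\<epsilon> \<beta>) p = (\<Sum>\<alpha>\<in>UNIV. total_coeffs (\<Gamma> p) \<alpha> \<beta> \<gamma> *\<^sub>R \<epsilon> \<alpha> p)"
proof -
  have "snd (\<epsilon> \<gamma> p) (\<lambda>q. comp q (\<epsilon> \<beta> q) \<alpha>) = snd (\<epsilon> \<gamma> p) (\<lambda>_. if \<alpha> = \<beta> then 1 else 0)" for \<alpha>
    by (rule P.tangent_cong[OF \<epsilon>_tangent[OF assms] open_Q assms comp_\<epsilon>])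
  then have "snd (\<epsilon> \<gamma> p) (\<lambda>q. comp q (\<epsilon> \<beta> q) \<alpha>) = 0" for \<alpha>
    using P.tangent_const[OF \<epsilon>_tangent[OF assms]] by simp
  then show ?thesis
    by (simp only: conn_def comp_\<epsilon>[OF assms]) (simp add: if_distrib[of "\<lambda>c. _ * c"] sum.delta cong: if_cong)
qed

text \<open>Stated for any \<open>D\<close> that agrees with \<open>conn\<close> on frame sections
  at \<open>p\<close>, in order to apply to the glued connection.\<close>

lemma adapted_coeffs_conn:
  assumes "p \<in> Q" "\<And>\<gamma> \<beta>. D (\<epsilon> \<gamma>) (\<epsilon> \<beta>) p = conn \<Gamma> (\<epsilon> \<gamma>) (\<epsilon> \<beta>) p"
  shows "adapted_coeffs AP \<pi> E h chart e D p = \<Gamma> p"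
proof (rule conn_coeffs.equality)
  have p: "p \<in> W" using assms(1) by simp
  note D = assms(2)[unfolded conn_frame[OF assms(1)]]
  show "LH (adapted_coeffs AP \<pi> E h chart e D p) = LH (\<Gamma> p)"
    using D[of "Inl _" "Inl _"]
    by (simp add: adapted_coeffs_def Let_def sum_UNIV_Plus coeffs_eq[OF \<delta>_basis[OF assms(1)] refl])
  show "LV (adapted_coeffs AP \<pi> E h chart e D p) = LV (\<Gamma> p)"
    using D[of "Inl _" "Inr _"]
    by (simp add: adapted_coeffs_def Let_def sum_UNIV_Plus coeffs_eq[OF \<V>_basis[OF p] refl])
  show "BH (adapted_coeffs AP \<pi> E h chart e D p) = BH (\<Gamma> p)"
    using D[of "Inr _" "Inl _"]
    by (simp add: adapted_coeffs_def Let_def sum_UNIV_Plus coeffs_eq[OF \<delta>_basis[OF assms(1)] refl])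
  show "BV (adapted_coeffs AP \<pi> E h chart e D p) = BV (\<Gamma> p)"
    using D[of "Inr _" "Inr _"]
    by (simp add: adapted_coeffs_def Let_def sum_UNIV_Plus coeffs_eq[OF \<V>_basis[OF p] refl])
qed simp

end

context charted_d_metric
begin

lemma D_metric_coeffs:
  assumes d: "d_connection AM AP \<pi> E h R D" and R: "open R"
    and m: "metric_compatible AM AP \<pi> E g R D" and p: "p \<in> R" "p \<in> Q"
  shows "metric_coeffs (data p) (adapted_coeffs AP \<pi> E h chart e D p)"
proof -
  let ?T = "total_coeffs (adapted_coeffs AP \<pi> E h chart e D p)"
  have S: "open (R \<inter> Q)" "R \<inter> Q \<subseteq> R" "p \<in> R \<inter> Q"
    using R open_Q p by auto
  have \<epsilon>: "prol_section AM AP \<pi> E (R \<inter> Q) (\<epsilon> \<alpha>)" for \<alpha>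
    by (rule prol_section_subset[OF \<epsilon>_section]) blast
  have *: "snd (\<epsilon> \<gamma> p) (gram \<alpha> \<beta>) = (\<Sum>\<mu>\<in>UNIV. ?T \<mu> \<alpha> \<gamma> * gram \<beta> \<mu> p) + (\<Sum>\<mu>\<in>UNIV. ?T \<mu> \<beta> \<gamma> * gram \<alpha> \<mu> p)"
    for \<alpha> \<beta> \<gamma>
  proof -
    have "snd (\<epsilon> \<gamma> p) (gram \<alpha> \<beta>) = g p (D (\<epsilon> \<gamma>) (\<epsilon> \<alpha>) p) (\<epsilon> \<beta> p) + g p (\<epsilon> \<alpha> p) (D (\<epsilon> \<gamma>) (\<epsilon> \<beta>) p)"
      unfolding gram_def by (rule metric_compatibleD[OF m S(1,2) \<epsilon> \<epsilon> \<epsilon> S(3)])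
    also have "\<dots> = (\<Sum>\<mu>\<in>UNIV. ?T \<mu> \<alpha> \<gamma> * gram \<mu> \<beta> p) + (\<Sum>\<mu>\<in>UNIV. ?T \<mu> \<beta> \<gamma> * gram \<alpha> \<mu> p)"
      unfolding D_frame[OF d R p] gram_def
      by (simp only: g_sum_left[OF finite \<epsilon>_prol_fib[OF p(2)] \<epsilon>_prol_fib[OF p(2)]]
          g_sum_right[OF finite \<epsilon>_prol_fib[OF p(2)] \<epsilon>_prol_fib[OF p(2)]])
    finally show ?thesis
      by (simp only: gram_sym[OF p(2), of \<beta>])
  qed
  show ?thesis
    unfolding metric_coeffs_def data_simps *
    by (simp add: sum_UNIV_Plus mult.commute)
qed

end

section \<open>Independence of the fibred chart\<close>

locale two_charts =
  C1: charted_d_metric AM AP \<pi> E h U e V \<phi> W \<psi> g + C2: charted_d_metric AM AP \<pi> E h U e V' \<phi>' W' \<psi>' g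
  for AM :: "('m::topological_space, real ^ 'n::finite) atlas"
    and AP :: "('p::topological_space, (real ^ 'n) \<times> (real ^ 'k::finite)) atlas"
    and \<pi> :: "'p \<Rightarrow> 'm"
    and E :: "('m, 'e::real_vector, 'r::finite) algebroid"
    and h :: "'p \<Rightarrow> ('e, 'p) prol set"
    and U :: "'m set" and e :: "'r \<Rightarrow> 'm \<Rightarrow> 'e"
    and V :: "'m set" and \<phi> :: "'m \<Rightarrow> real ^ 'n" and W :: "'p set" and \<psi> :: "'p \<Rightarrow> (real ^ 'n) \<times> (real ^ 'k)"
    and V' :: "'m set" and \<phi>' :: "'m \<Rightarrow> real ^ 'n" and W' :: "'p set" and \<psi>' :: "'p \<Rightarrow> (real ^ 'n) \<times> (real ^ 'k)"
    and g :: "'p \<Rightarrow> ('e, 'p) prol \<Rightarrow> ('e, 'p) prol \<Rightarrow> real"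
begin

abbreviation "O\<^sub>2 \<equiv> W \<inter> W' \<inter> \<pi> -` U"

lemma O_open: "open O\<^sub>2"
proof -
  have "O\<^sub>2 = (W \<inter> \<pi> -` U) \<inter> W'" by blast
  then show ?thesis
    using open_Int[OF C1.open_Q C2.open_W] by simp
qed

lemma \<delta>_eq: "p \<in> O\<^sub>2 \<Longrightarrow> C2.\<delta> a p = C1.\<delta> a p"
  by (rule C1.\<delta>_unique) (use C2.\<delta>_horizontal[of p a] C2.fst_\<delta>[of a p] in auto)

definition J :: "'k \<Rightarrow> 'k \<Rightarrow> 'p \<Rightarrow> real" where
  "J A B = (\<lambda>p. snd (C2.\<V> B p) (C1.y A))"

lemma \<V>_eq: "p \<in> O\<^sub>2 \<Longrightarrow> C2.\<V> B p = (\<Sum>A\<in>UNIV. J A B p *\<^sub>R C1.\<V> A p)"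
  unfolding J_def by (rule C1.vertical_sum[OF C2.\<V>_prol_vert]) auto

lemma \<V>_derivative: "p \<in> O\<^sub>2 \<Longrightarrow> snd (C2.\<V> B p) f = (\<Sum>A\<in>UNIV. J A B p * snd (C1.\<V> A p) f)"
  by (simp add: \<V>_eq snd_sum sum_fun_apply)

lemma y_smooth_near: "p \<in> O\<^sub>2 \<Longrightarrow> smooth_near AP p (C1.y A)"
  by (rule C1.y_smooth_near) auto

lemma comp_\<V>:
  assumes "p \<in> O\<^sub>2"
  shows "C1.comp p (C2.\<V> B p) \<alpha> = (case \<alpha> of Inl a \<Rightarrow> 0 | Inr A \<Rightarrow> J A B p)"
proof -
  have p: "p \<in> W \<inter> \<pi> -` U" "p \<in> W'" using assms by auto
  have "C2.\<V> B p = (\<Sum>\<alpha>\<in>UNIV. (case \<alpha> of Inl a \<Rightarrow> 0 | Inr A \<Rightarrow> J A B p) *\<^sub>R C1.\<epsilon> \<alpha> p)"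
    by (simp add: sum_UNIV_Plus \<V>_eq[OF assms])
  then have "C1.comp p (C2.\<V> B p) = (\<lambda>\<alpha>. case \<alpha> of Inl a \<Rightarrow> 0 | Inr A \<Rightarrow> J A B p)"
    by (simp only: C1.comp_frame_sum[OF p(1)])
  then show ?thesis by simp
qed

lemma comp_\<delta>: "p \<in> O\<^sub>2 \<Longrightarrow> C1.comp p (C2.\<delta> b p) \<alpha> = (if \<alpha> = Inl b then 1 else 0)"
  using C1.comp_\<epsilon>[of p "Inl b" \<alpha>] \<delta>_eq[of p b] by auto

lemma sections: "prol_section AM AP \<pi> E O\<^sub>2 (C2.\<epsilon> \<alpha>)" "prol_section AM AP \<pi> E O\<^sub>2 (C1.\<epsilon> \<alpha>)"
  by (rule C1.prol_section_subset[OF C2.\<epsilon>_section], blast,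
      rule C1.prol_section_subset[OF C1.\<epsilon>_section], blast)

lemma tangent: "p \<in> O\<^sub>2 \<Longrightarrow> snd (C2.\<epsilon> \<gamma> p) \<in> tangent_space AP p"
  using C2.\<epsilon>_tangent[of p \<gamma>] by auto

abbreviation "K p \<equiv> canonical_coeffs (C1.data p)"

lemma K_symmetric: "p \<in> O\<^sub>2 \<Longrightarrow> symmetric_coeffs (C1.data p) (K p)"
  by (rule canonical_coeffs_symmetric[OF C1.regular]) auto

lemma D_\<delta>_\<delta>:
  assumes "p \<in> O\<^sub>2"
  shows "C1.D\<^sub>c (C2.\<delta> f) (C2.\<delta> b) p = (\<Sum>a\<in>UNIV. LH (K p) a b f *\<^sub>R C1.\<delta> a p)"
proof -
  have "C1.D\<^sub>c (C2.\<delta> f) (C2.\<delta> b) p = C1.D\<^sub>c (C1.\<delta> f) (C1.\<delta> b) p"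
    by (rule C1.conn_local[OF O_open _ sections(1)[of "Inl f", simplified] assms]) (auto simp: \<delta>_eq)
  then show ?thesis
    using C1.conn_frame[of p _ "Inl f" "Inl b"] assms by (simp add: sum_UNIV_Plus)
qed

text \<open>\<delta>_b has constant components in the first frame as well, so no derivative of
  \<open>J\<close> appears and the result is linear in the direction.\<close>

lemma D_\<V>_\<delta>:
  assumes "p \<in> O\<^sub>2"
  shows "C1.D\<^sub>c (C2.\<V> C) (C2.\<delta> b) p = (\<Sum>a\<in>UNIV. (\<Sum>D\<in>UNIV. J D C p * BH (K p) a b D) *\<^sub>R C1.\<delta> a p)"
proof -
  have t: "snd (C2.\<V> C p) \<in> tangent_space AP p"
    using tangent[OF assms, of "Inr C"] by simp
  have "snd (C2.\<V> C p) (\<lambda>q. C1.comp q (C2.\<delta> b q) \<alpha>) = snd (C2.\<V> C p) (\<lambda>_. if \<alpha> = Inl b then 1 else 0)" for \<alpha>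
    by (rule C1.P.tangent_cong[OF t O_open assms comp_\<delta>])
  then have 0: "snd (C2.\<V> C p) (\<lambda>q. C1.comp q (C2.\<delta> b q) \<alpha>) = 0" for \<alpha>
    using C1.P.tangent_const[OF t] by simp
  have if_sum: "(\<Sum>i\<in>I. if P then f i else 0) = (if P then sum f I else 0)" for P I and f :: "'k \<Rightarrow> real"
    by simp
  show ?thesis
    unfolding C1.conn_def 0 comp_\<delta>[OF assms] comp_\<V>[OF assms]
    by (simp add: if_sum sum_UNIV_Plus if_distrib[of "\<lambda>c. _ * c"] if_distrib[of "\<lambda>c. c * _"] sum.delta
        mult.commute cong: if_cong)
qed

lemma D_\<V>:
  assumes "p \<in> O\<^sub>2"
  shows "C1.D\<^sub>c (C2.\<epsilon> \<gamma>) (C2.\<V> B) p = (\<Sum>A\<in>UNIV. (snd (C2.\<epsilon> \<gamma> p) (J A B)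
    + (\<Sum>B'\<in>UNIV. \<Sum>\<gamma>'\<in>UNIV. total_coeffs (K p) (Inr A) (Inr B') \<gamma>' * J B' B p * C1.comp p (C2.\<epsilon> \<gamma> p) \<gamma>'))
    *\<^sub>R C1.\<V> A p)"
proof -
  note t = tangent[OF assms, of \<gamma>]
  have J: "snd (C2.\<epsilon> \<gamma> p) (\<lambda>q. C1.comp q (C2.\<V> B q) (Inr A)) = snd (C2.\<epsilon> \<gamma> p) (J A B)" for A
    by (rule C1.P.tangent_cong[OF t O_open assms]) (simp add: comp_\<V>)
  have "snd (C2.\<epsilon> \<gamma> p) (\<lambda>q. C1.comp q (C2.\<V> B q) (Inl a)) = snd (C2.\<epsilon> \<gamma> p) (\<lambda>_. 0)" for a
    by (rule C1.P.tangent_cong[OF t O_open assms]) (simp add: comp_\<V>)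
  then have 0: "snd (C2.\<epsilon> \<gamma> p) (\<lambda>q. C1.comp q (C2.\<V> B q) (Inl a)) = 0" for a
    using C1.P.tangent_const[OF t] by simp
  show ?thesis
    unfolding C1.conn_def sum_UNIV_Plus[of "\<lambda>\<alpha>. _ \<alpha> *\<^sub>R C1.\<epsilon> \<alpha> p"] sum_UNIV_Plus[of "\<lambda>\<beta>. \<Sum>\<gamma>\<in>UNIV. _ \<beta> \<gamma>"]
      J 0 comp_\<V>[OF assms]
    by simp
qed

text \<open>Since \<open>J A B\<close> is V'_B y^A, its derivative along V'_C is a second partial
  derivative of y^A in the second chart and symmetric in B and C. The remaining term is symmetric
  because \<open>BV\<close> is.\<close>

lemma D_\<V>_\<V>_symmetric:
  assumes "p \<in> O\<^sub>2"
  shows "C1.D\<^sub>c (C2.\<V> C) (C2.\<V> B) p = C1.D\<^sub>c (C2.\<V> B) (C2.\<V> C) p"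
proof -
  have p: "p \<in> W'" using assms by simp
  have D: "C1.D\<^sub>c (C2.\<V> C) (C2.\<V> B) p = (\<Sum>A\<in>UNIV. (snd (C2.\<V> C p) (J A B)
    + (\<Sum>B'\<in>UNIV. \<Sum>C'\<in>UNIV. BV (K p) A B' C' * J B' B p * J C' C p)) *\<^sub>R C1.\<V> A p)" for B C
    using D_\<V>[OF assms, of "Inr C" B] by (simp add: sum_UNIV_Plus comp_\<V>[OF assms])
  have "snd (C2.\<V> C p) (J A B) = snd (C2.\<V> B p) (J A C)" for A
    unfolding J_def C2.snd_\<V>
    by (rule C1.P.chart_vec_commute[OF C2.P_chart p y_smooth_near[OF assms]])
  moreover have "(\<Sum>B'\<in>UNIV. \<Sum>C'\<in>UNIV. BV (K p) A B' C' * J B' B p * J C' C p)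
      = (\<Sum>B'\<in>UNIV. \<Sum>C'\<in>UNIV. BV (K p) A B' C' * J B' C p * J C' B p)" for A
  proof -
    have "BV (K p) A B' C' = BV (K p) A C' B'" for B' C'
      using K_symmetric[OF assms] unfolding symmetric_coeffs_def by blast
    then have "(\<Sum>B'\<in>UNIV. \<Sum>C'\<in>UNIV. BV (K p) A B' C' * J B' B p * J C' C p)
        = (\<Sum>B'\<in>UNIV. \<Sum>C'\<in>UNIV. BV (K p) A C' B' * J C' C p * J B' B p)"
      by (simp add: mult.commute mult.left_commute)
    also have "\<dots> = (\<Sum>C'\<in>UNIV. \<Sum>B'\<in>UNIV. BV (K p) A C' B' * J C' C p * J B' B p)"
      by (rule sum.swap)
    finally show ?thesis .
  qed
  ultimately show ?thesis
    unfolding D by simp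
qed

text \<open>The matrix of D_\<delta> V - [\<delta>, V] in the vertical frame of the first chart; the
  last clause of \<open>symmetric_coeffs\<close> says that it is self-adjoint.\<close>

definition M :: "'p \<Rightarrow> 'r \<Rightarrow> 'k \<Rightarrow> 'k \<Rightarrow> real" where
  "M p f A B = LV (K p) A B f - snd (C1.\<V> B p) (C1.N A f)"

text \<open>\<open>D\<^sub>\<delta> V - [\<delta>, V]\<close> is linear in the vertical vector \<open>V\<close>.\<close>

lemma D_\<delta>_\<V>:
  assumes "p \<in> O\<^sub>2"
  shows "C1.D\<^sub>c (C2.\<delta> f) (C2.\<V> B) p - (\<Sum>D\<in>UNIV. snd (C2.\<V> B p) (C2.N D f) *\<^sub>R C2.\<V> D p)
    = (\<Sum>A\<in>UNIV. (\<Sum>B'\<in>UNIV. J B' B p * M p f A B') *\<^sub>R C1.\<V> A p)"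
proof -
  have p: "p \<in> W \<inter> \<pi> -` U" "p \<in> W' \<inter> \<pi> -` U" using assms by auto
  have t: "snd (C2.\<V> B p) \<in> tangent_space AP p"
    using tangent[OF assms, of "Inr B"] by simp
  have 1: "C1.D\<^sub>c (C2.\<delta> f) (C2.\<V> B) p = (\<Sum>A\<in>UNIV. (snd (C2.\<delta> f p) (J A B)
    + (\<Sum>B'\<in>UNIV. LV (K p) A B' f * J B' B p)) *\<^sub>R C1.\<V> A p)"
    using D_\<V>[OF assms, of "Inl f" B]
    by (simp add: sum_UNIV_Plus comp_\<delta>[OF assms] if_distrib[of "\<lambda>c. _ * c"] sum.delta cong: if_cong)
  have 2: "(\<Sum>D\<in>UNIV. snd (C2.\<V> B p) (C2.N D f) *\<^sub>R C2.\<V> D p)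
      = (\<Sum>A\<in>UNIV. (\<Sum>D\<in>UNIV. snd (C2.\<V> B p) (C2.N D f) * J A D p) *\<^sub>R C1.\<V> A p)"
  proof -
    have "(\<Sum>D\<in>UNIV. snd (C2.\<V> B p) (C2.N D f) *\<^sub>R C2.\<V> D p)
        = (\<Sum>D\<in>UNIV. \<Sum>A\<in>UNIV. (snd (C2.\<V> B p) (C2.N D f) * J A D p) *\<^sub>R C1.\<V> A p)"
      by (simp only: \<V>_eq[OF assms] scaleR_sum_right scaleR_scaleR)
    also have "\<dots> = (\<Sum>A\<in>UNIV. \<Sum>D\<in>UNIV. (snd (C2.\<V> B p) (C2.N D f) * J A D p) *\<^sub>R C1.\<V> A p)"
      by (rule sum.swap)
    finally show ?thesis
      by (simp only: scaleR_sum_left)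
  qed
  \<comment> \<open>Apply the commutator formula of the second chart to y^A of the first. As
    \<delta>_f is the same in both charts, \<delta>_f y^A is minus the N of the first chart, so all
    derivatives of \<open>J\<close> are exchanged for derivatives of that N.\<close>
  have 3: "snd (C2.\<delta> f p) (J A B) - (\<Sum>D\<in>UNIV. snd (C2.\<V> B p) (C2.N D f) * J A D p)
      = - (\<Sum>B'\<in>UNIV. J B' B p * snd (C1.\<V> B' p) (C1.N A f))" for A
  proof -
    have "snd (C2.\<V> B p) (\<lambda>q. snd (C2.\<delta> f q) (C1.y A)) = snd (C2.\<V> B p) (\<lambda>q. - C1.N A f q)"
      by (rule C1.P.tangent_cong[OF t O_open assms]) (use \<delta>_eq C1.\<delta>_y in auto)
    also have "\<dots> = - snd (C2.\<V> B p) (C1.N A f)"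
      by (rule C1.P.tangent_uminus[OF t C1.P.smooth_nearI[OF C1.open_Q p(1) C1.N_smooth]])
    also have "snd (C2.\<V> B p) (C1.N A f) = (\<Sum>B'\<in>UNIV. J B' B p * snd (C1.\<V> B' p) (C1.N A f))"
      by (rule \<V>_derivative[OF assms])
    finally show ?thesis
      using C2.\<delta>_\<V>_commutator[OF p(2) y_smooth_near[OF assms], of f B A] unfolding J_def by simp
  qed
  have "snd (C2.\<delta> f p) (J A B) + (\<Sum>B'\<in>UNIV. LV (K p) A B' f * J B' B p)
      - (\<Sum>D\<in>UNIV. snd (C2.\<V> B p) (C2.N D f) * J A D p) = (\<Sum>B'\<in>UNIV. J B' B p * M p f A B')" for A
    using 3[of A] by (simp add: M_def right_diff_distrib sum_subtractf mult.commute)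
  then show ?thesis
    unfolding 1 2 by (simp add: sum_subtractf[symmetric] scaleR_left_diff_distrib[symmetric])
qed

text \<open>Each lowered expression is a value of the metric on the second frame. In the mixed
  blocks the operator involved is linear in its vertical argument, so its lowered matrix is that of
  the first chart contracted with \<open>J\<close> and inherits the symmetry.\<close>

lemma D_symmetric:
  assumes "p \<in> O\<^sub>2"
  shows "symmetric_coeffs (C2.data p) (adapted_coeffs AP \<pi> E h C2.chart e C1.D\<^sub>c p)"
    (is "symmetric_coeffs _ ?\<Gamma>")
proof -
  have p: "p \<in> W \<inter> \<pi> -` U" "p \<in> W' \<inter> \<pi> -` U" using assms by auto
  note frame = C2.D_frame[OF C1.canonical_d_connection C1.open_Q p]
  have K: "LH (K p) a b f = LH (K p) a f b"
    "(\<Sum>d\<in>UNIV. gH (C1.data p) a d * BH (K p) d b C) = (\<Sum>d\<in>UNIV. gH (C1.data p) b d * BH (K p) d a C)"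
    "(\<Sum>D\<in>UNIV. gV (C1.data p) A D * M p f D B) = (\<Sum>D\<in>UNIV. gV (C1.data p) B D * M p f D A)" for a b f A B C
    using K_symmetric[OF assms] unfolding symmetric_coeffs_def M_def C1.data_simps by auto
  have fib: "C1.\<delta> a p \<in> prol_fib AM AP \<pi> E p" "C1.\<V> A p \<in> prol_fib AM AP \<pi> E p"
    "C2.\<V> A p \<in> prol_fib AM AP \<pi> E p" for a A
    using C1.\<epsilon>_prol_fib[OF p(1), of "Inl a"] C1.\<epsilon>_prol_fib[OF p(1), of "Inr A"]
      C2.\<epsilon>_prol_fib[OF p(2), of "Inr A"] by simp_all
  have LH: "LH ?\<Gamma> a b f = LH ?\<Gamma> a f b" for a b f
    by (simp add: adapted_coeffs_def Let_def D_\<delta>_\<delta>[OF assms] K(1)[of _ b f])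
  have BV: "BV ?\<Gamma> A B C = BV ?\<Gamma> A C B" for A B C
    by (simp add: adapted_coeffs_def Let_def D_\<V>_\<V>_symmetric[OF assms, of B C])
  \<comment> \<open>The frame \<delta> is common to both charts, so only the direction index picks
    up a factor \<open>J\<close>.\<close>
  have BH: "(\<Sum>d\<in>UNIV. gH (C2.data p) a d * BH ?\<Gamma> d b C)
      = (\<Sum>D\<in>UNIV. J D C p * (\<Sum>d\<in>UNIV. gH (C1.data p) a d * BH (K p) d b D))" for a b C
  proof -
    have "(\<Sum>d\<in>UNIV. gH (C2.data p) a d * BH ?\<Gamma> d b C) = g p (C1.\<delta> a p) (\<Sum>d\<in>UNIV. BH ?\<Gamma> d b C *\<^sub>R C1.\<delta> d p)"
      by (simp add: C1.g_sum_right fib C2.data_simps C2.gram_def \<delta>_eq[OF assms] mult.commute)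
    also have "(\<Sum>d\<in>UNIV. BH ?\<Gamma> d b C *\<^sub>R C1.\<delta> d p) = C1.D\<^sub>c (C2.\<V> C) (C2.\<delta> b) p"
      using frame[of "Inr C" "Inl b"] by (simp add: sum_UNIV_Plus \<delta>_eq[OF assms])
    also have "\<dots> = (\<Sum>a\<in>UNIV. (\<Sum>D\<in>UNIV. J D C p * BH (K p) a b D) *\<^sub>R C1.\<delta> a p)"
      by (rule D_\<V>_\<delta>[OF assms])
    also have "g p (C1.\<delta> a p) \<dots> = (\<Sum>d\<in>UNIV. \<Sum>D\<in>UNIV. J D C p * (gH (C1.data p) a d * BH (K p) d b D))"
      by (simp add: C1.g_sum_right fib C1.data_simps C1.gram_def sum_distrib_left sum_distrib_right mult_ac)
    also have "\<dots> = (\<Sum>D\<in>UNIV. \<Sum>d\<in>UNIV. J D C p * (gH (C1.data p) a d * BH (K p) d b D))"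
      by (rule sum.swap)
    finally show ?thesis
      by (simp only: sum_distrib_left)
  qed
  \<comment> \<open>Both vertical indices transform, which gives a bilinear expression in
    \<open>J\<close>.\<close>
  have LV: "(\<Sum>D\<in>UNIV. gV (C2.data p) A D * (LV ?\<Gamma> D B f - dNN (C2.data p) (Inr B) D f))
      = (\<Sum>A'\<in>UNIV. \<Sum>B'\<in>UNIV. J A' A p * J B' B p * (\<Sum>D\<in>UNIV. gV (C1.data p) A' D * M p f D B'))" for A B f
  proof -
    have "(\<Sum>D\<in>UNIV. gV (C2.data p) A D * (LV ?\<Gamma> D B f - dNN (C2.data p) (Inr B) D f))
        = g p (C2.\<V> A p) (\<Sum>D\<in>UNIV. (LV ?\<Gamma> D B f - dNN (C2.data p) (Inr B) D f) *\<^sub>R C2.\<V> D p)"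
      by (simp add: C1.g_sum_right fib C2.data_simps C2.gram_def mult.commute)
    also have "(\<Sum>D\<in>UNIV. (LV ?\<Gamma> D B f - dNN (C2.data p) (Inr B) D f) *\<^sub>R C2.\<V> D p)
        = C1.D\<^sub>c (C2.\<delta> f) (C2.\<V> B) p - (\<Sum>D\<in>UNIV. snd (C2.\<V> B p) (C2.N D f) *\<^sub>R C2.\<V> D p)"
      using frame[of "Inl f" "Inr B"]
      by (simp add: sum_UNIV_Plus C2.data_simps scaleR_left_diff_distrib sum_subtractf)
    also have "\<dots> = (\<Sum>D\<in>UNIV. (\<Sum>B'\<in>UNIV. J B' B p * M p f D B') *\<^sub>R C1.\<V> D p)"
      by (rule D_\<delta>_\<V>[OF assms])
    also have "g p (C2.\<V> A p) \<dots> = (\<Sum>D\<in>UNIV. (\<Sum>B'\<in>UNIV. J B' B p * M p f D B') * g p (C2.\<V> A p) (C1.\<V> D p))"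
      by (rule C1.g_sum_right[OF finite fib(2,3)])
    also have "\<dots> = (\<Sum>D\<in>UNIV. \<Sum>A'\<in>UNIV. \<Sum>B'\<in>UNIV. J A' A p * J B' B p * (gV (C1.data p) A' D * M p f D B'))"
    proof (rule sum.cong[OF refl])
      fix D
      have "g p (C2.\<V> A p) (C1.\<V> D p) = (\<Sum>A'\<in>UNIV. J A' A p * gV (C1.data p) A' D)"
        unfolding \<V>_eq[OF assms] C1.g_sum_left[OF finite fib(2,2)] by (simp add: C1.data_simps C1.gram_def)
      then show "(\<Sum>B'\<in>UNIV. J B' B p * M p f D B') * g p (C2.\<V> A p) (C1.\<V> D p)
          = (\<Sum>A'\<in>UNIV. \<Sum>B'\<in>UNIV. J A' A p * J B' B p * (gV (C1.data p) A' D * M p f D B'))"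
        by (simp add: sum_distrib_left sum_distrib_right mult_ac)
    qed
    also have "\<dots> = (\<Sum>A'\<in>UNIV. \<Sum>B'\<in>UNIV. \<Sum>D\<in>UNIV. J A' A p * J B' B p * (gV (C1.data p) A' D * M p f D B'))"
      by (rule sum_rotate3)
    finally show ?thesis
      by (simp only: sum_distrib_left)
  qed
  \<comment> \<open>Rename the two summation indices and use self-adjointness of \<open>M\<close>
    for the metric of the first chart.\<close>
  have LV_sym: "(\<Sum>A'\<in>UNIV. \<Sum>B'\<in>UNIV. J A' A p * J B' B p * (\<Sum>D\<in>UNIV. gV (C1.data p) A' D * M p f D B'))
      = (\<Sum>A'\<in>UNIV. \<Sum>B'\<in>UNIV. J A' B p * J B' A p * (\<Sum>D\<in>UNIV. gV (C1.data p) A' D * M p f D B'))" for A B f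
    by (subst sum.swap, intro sum.cong refl) (rule arg_cong2[of _ _ _ _ "(*)", OF mult.commute K(3)])
  show ?thesis
    unfolding symmetric_coeffs_def LV BH
    using LH BV K(2) LV_sym by auto
qed

lemma D_chart_independent:
  assumes S: "open S" "S \<subseteq> O\<^sub>2" and Y: "prol_section AM AP \<pi> E S Y" and Z: "prol_section AM AP \<pi> E S Z"
    and "p \<in> S"
  shows "C1.D\<^sub>c Y Z p = C2.D\<^sub>c Y Z p"
proof -
  have p: "p \<in> O\<^sub>2" "p \<in> W \<inter> \<pi> -` U" "p \<in> W' \<inter> \<pi> -` U"
    using assms by auto
  have "adapted_coeffs AP \<pi> E h C2.chart e C1.D\<^sub>c p = canonical_coeffs (C2.data p)"
    by (rule canonical_coeffs_unique[OF C2.regular[OF p(3)]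
          C2.D_metric_coeffs[OF C1.canonical_d_connection C1.open_Q C1.canonical_metric_compatible p(2,3)]
          D_symmetric[OF p(1)]])
  \<comment> \<open>\<open>conn\<close> uses the coefficients at \<open>p\<close> only, so their
    equality at this one point finishes the comparison.\<close>
  moreover have "C1.D\<^sub>c Y Z p = C2.conn (adapted_coeffs AP \<pi> E h C2.chart e C1.D\<^sub>c) Y Z p"
    by (rule C2.D_eq_conn[OF C1.canonical_d_connection C1.open_Q S(1) _ _ Y Z assms(5)]) (use S in auto)
  ultimately show ?thesis
    by (simp add: C2.conn_def)
qed

end

section \<open>Gluing over the fibred charts\<close>

context framed_d_metric
begin

definition chart_at :: "'p \<Rightarrow> ('m, 'p, 'n, 'k) fchart" where
  "chart_at p = (SOME c. c \<in> fibred_charts AM AP \<pi> \<and> p \<in> fdom c)"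

text \<open>Each point uses its own chosen chart, and neighbouring points may use different ones;
  \<open>canonical_connection_eq\<close> removes this dependence.\<close>

definition canonical_connection ::
  "('p \<Rightarrow> ('e, 'p) prol) \<Rightarrow> ('p \<Rightarrow> ('e, 'p) prol) \<Rightarrow> 'p \<Rightarrow> ('e, 'p) prol" where
  "canonical_connection Y Z p = (case chart_at p of ((V, \<phi>), (W, \<psi>)) \<Rightarrow>
     charted_n_connection.conn AP \<pi> E h e V \<phi> W \<psi>
       (\<lambda>p. canonical_coeffs (local_data_at AP \<pi> E h g ((V, \<phi>), (W, \<psi>)) e p)) Y Z p)"

lemma chart_at_obtain:
  obtains V \<phi> W \<psi> where "chart_at p = ((V, \<phi>), (W, \<psi>))" "((V, \<phi>), (W, \<psi>)) \<in> fibred_charts AM AP \<pi>" "p \<in> W"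
proof -
  have "\<exists>c. c \<in> fibred_charts AM AP \<pi> \<and> p \<in> fdom c"
    using fibration unfolding fibration_def by blast
  then have "chart_at p \<in> fibred_charts AM AP \<pi> \<and> p \<in> fdom (chart_at p)"
    unfolding chart_at_def by (rule someI_ex)
  moreover obtain V \<phi> W \<psi> where "chart_at p = ((V, \<phi>), (W, \<psi>))"
    by (metis prod.collapse)
  ultimately show ?thesis using that by simp
qed

lemma charted_d_metricI:
  "((V, \<phi>), (W, \<psi>)) \<in> fibred_charts AM AP \<pi> \<Longrightarrow> charted_d_metric AM AP \<pi> E h U e V \<phi> W \<psi> g"
  by unfold_locales

end

text \<open>Chart independence is applied to the present chart and the one chosen at
  \<open>p\<close>, on the part of \<open>S\<close> inside both.\<close>

lemma (in charted_d_metric) canonical_connection_eq: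
  assumes "open S" "S \<subseteq> Q" "prol_section AM AP \<pi> E S Y" "prol_section AM AP \<pi> E S Z" "p \<in> S"
  shows "canonical_connection Y Z p = D\<^sub>c Y Z p"
proof -
  obtain V' \<phi>' W' \<psi>' where c: "chart_at p = ((V', \<phi>'), (W', \<psi>'))"
    "((V', \<phi>'), (W', \<psi>')) \<in> fibred_charts AM AP \<pi>" "p \<in> W'"
    by (rule chart_at_obtain)
  interpret C: two_charts AM AP \<pi> E h U e V' \<phi>' W' \<psi>' V \<phi> W \<psi> g
    by (intro two_charts.intro charted_d_metricI c(2) fibred)
  have "C.C1.D\<^sub>c Y Z p = D\<^sub>c Y Z p"
  proof (rule C.D_chart_independent[of "S \<inter> W'"])
    show "open (S \<inter> W')"
      using assms(1) C.C1.open_W by blast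
    show "prol_section AM AP \<pi> E (S \<inter> W') Y" "prol_section AM AP \<pi> E (S \<inter> W') Z"
      using assms(3,4) by (auto intro: prol_section_subset)
  qed (use assms(2,5) c(3) in auto)
  then show ?thesis
    by (simp add: canonical_connection_def c(1))
qed

context framed_d_metric
begin

text \<open>At a fixed point the glued connection is the connection of one chart for all pairs of
  sections at once. This transfers every pointwise property, after shrinking \<open>S\<close> to the
  chart.\<close>

lemma chart_reduction:
  assumes "open S" "S \<subseteq> \<pi> -` U" "p \<in> S"
  obtains V \<phi> W \<psi> where "charted_d_metric AM AP \<pi> E h U e V \<phi> W \<psi> g"
    "\<And>Y Z. canonical_connection Y Z p = charted_n_connection.conn AP \<pi> E h e V \<phi> W \<psi>
       (\<lambda>p. canonical_coeffs (local_data_at AP \<pi> E h g ((V, \<phi>), (W, \<psi>)) e p)) Y Z p"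
    "open (S \<inter> W)" "S \<inter> W \<subseteq> W \<inter> \<pi> -` U" "p \<in> S \<inter> W"
proof -
  obtain V \<phi> W \<psi> where c: "chart_at p = ((V, \<phi>), (W, \<psi>))"
    "((V, \<phi>), (W, \<psi>)) \<in> fibred_charts AM AP \<pi>" "p \<in> W"
    by (rule chart_at_obtain)
  interpret C: charted_d_metric AM AP \<pi> E h U e V \<phi> W \<psi> g
    by (rule charted_d_metricI[OF c(2)])
  show ?thesis
    by (rule that[OF C.charted_d_metric_axioms])
       (use c assms C.open_W in \<open>auto simp: canonical_connection_def\<close>)
qed

text \<open>Smoothness involves neighbouring points, whose chosen charts may differ, so here the
  agreement with a single chart on a whole neighbourhood is essential.\<close>

lemma canonical_connection_section:
  assumes S: "open S" "S \<subseteq> \<pi> -` U" and Y: "prol_section AM AP \<pi> E S Y" and Z: "prol_section AM AP \<pi> E S Z"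
  shows "prol_section AM AP \<pi> E S (canonical_connection Y Z)"
proof (rule prol_section_local)
  fix p assume p: "p \<in> S"
  obtain V \<phi> W \<psi> where C: "charted_d_metric AM AP \<pi> E h U e V \<phi> W \<psi> g"
    "open (S \<inter> W)" "S \<inter> W \<subseteq> W \<inter> \<pi> -` U" "p \<in> S \<inter> W"
    by (rule chart_reduction[OF S p]) blast
  interpret C: charted_d_metric AM AP \<pi> E h U e V \<phi> W \<psi> g
    by (rule C(1))
  have YZ: "prol_section AM AP \<pi> E (S \<inter> W) Y" "prol_section AM AP \<pi> E (S \<inter> W) Z"
    using Y Z by (auto intro: prol_section_subset)
  have "prol_section AM AP \<pi> E (S \<inter> W) (canonical_connection Y Z)"
    by (rule prol_section_cong[OF C(2) C.canonical_connection_eq[OF C(2,3) YZ, symmetric]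
          d_connection_section[OF C.canonical_d_connection C(2,3) YZ]])
  then show "\<exists>T. open T \<and> p \<in> T \<and> prol_section AM AP \<pi> E T (canonical_connection Y Z)"
    using C(2,4) by blast
qed

text \<open>The remaining axioms are pointwise, so they are inherited from the connection of one chart.\<close>

lemma canonical_connection_d_connection:
  "d_connection AM AP \<pi> E h (\<pi> -` U) canonical_connection"
  unfolding d_connection_def
proof (intro conjI allI impI ballI)
  fix S Y Z
  assume S: "open S" "S \<subseteq> \<pi> -` U" and Y: "prol_section AM AP \<pi> E S Y"
  show "prol_section AM AP \<pi> E S (canonical_connection Y Z)" if "prol_section AM AP \<pi> E S Z"
    by (rule canonical_connection_section[OF S Y that])
  fix p assume p: "p \<in> S"
  obtain V \<phi> W \<psi> where C: "charted_d_metric AM AP \<pi> E h U e V \<phi> W \<psi> g"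
    and eq: "\<And>Y Z. canonical_connection Y Z p = charted_n_connection.conn AP \<pi> E h e V \<phi> W \<psi>
       (\<lambda>p. canonical_coeffs (local_data_at AP \<pi> E h g ((V, \<phi>), (W, \<psi>)) e p)) Y Z p"
    and T: "open (S \<inter> W)" "S \<inter> W \<subseteq> W \<inter> \<pi> -` U" "p \<in> S \<inter> W"
    by (rule chart_reduction[OF S p]) blast
  interpret C: charted_d_metric AM AP \<pi> E h U e V \<phi> W \<psi> g
    by (rule C)
  note d = C.canonical_d_connection
  have res: "prol_section AM AP \<pi> E (S \<inter> W) X" if "prol_section AM AP \<pi> E S X" for X
    using that by (rule prol_section_subset) blast
  show "canonical_connection Y Z p = canonical_connection Y' Z' p"
    if "prol_section AM AP \<pi> E S Z" "\<forall>p\<in>S. Y p = Y' p \<and> Z p = Z' p" for Y' Z'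
    unfolding eq
    by (rule d_connection_local[OF d T(1,2) res[OF Y] res[OF that(1)] _ T(3)]) (use that(2) in auto)
  show "canonical_connection (\<lambda>q. Y q + Y' q) Z p = canonical_connection Y Z p + canonical_connection Y' Z p"
    if "prol_section AM AP \<pi> E S Y'" "prol_section AM AP \<pi> E S Z" for Y'
    unfolding eq by (rule d_connection_add_left[OF d T(1,2) res[OF Y] res[OF that(1)] res[OF that(2)] T(3)])
  show "canonical_connection (\<lambda>q. f q *\<^sub>R Y q) Z p = f p *\<^sub>R canonical_connection Y Z p"
    if "prol_section AM AP \<pi> E S Z" "smooth_fun AP S f" for f
    unfolding eq
    by (rule d_connection_scale_left[OF d T(1,2) res[OF Y] res[OF that(1)] _ T(3)])
       (rule P.smooth_fun_subset[OF that(2)], blast)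
  show "canonical_connection Y (\<lambda>q. Z q + Z' q) p = canonical_connection Y Z p + canonical_connection Y Z' p"
    if "prol_section AM AP \<pi> E S Z" "prol_section AM AP \<pi> E S Z'" for Z'
    unfolding eq by (rule d_connection_add_right[OF d T(1,2) res[OF Y] res[OF that(1)] res[OF that(2)] T(3)])
  show "canonical_connection Y (\<lambda>q. f q *\<^sub>R Z q) p = f p *\<^sub>R canonical_connection Y Z p + snd (Y p) f *\<^sub>R Z p"
    if "prol_section AM AP \<pi> E S Z" "smooth_fun AP S f" for f
    unfolding eq
    by (rule d_connection_scale_right[OF d T(1,2) res[OF Y] res[OF that(1)] _ T(3)])
       (rule P.smooth_fun_subset[OF that(2)], blast)
  show "canonical_connection Y Z p \<in> h p"
    if "prol_section AM AP \<pi> E S Z" "\<forall>p\<in>S. Z p \<in> h p"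
    unfolding eq
    by (rule d_connection_horizontal[OF d T(1,2) res[OF Y] res[OF that(1)] _ T(3)]) (use that(2) in auto)
  show "canonical_connection Y Z p \<in> prol_vert AM AP \<pi> E p"
    if "prol_section AM AP \<pi> E S Z" "\<forall>p\<in>S. Z p \<in> prol_vert AM AP \<pi> E p"
    unfolding eq
    by (rule d_connection_vertical[OF d T(1,2) res[OF Y] res[OF that(1)] _ T(3)]) (use that(2) in auto)
qed

lemma canonical_connection_metric_compatible:
  "metric_compatible AM AP \<pi> E g (\<pi> -` U) canonical_connection"
  unfolding metric_compatible_def
proof (intro allI impI ballI)
  fix S X Y Z p
  assume S: "open S" "S \<subseteq> \<pi> -` U" and "prol_section AM AP \<pi> E S X" "prol_section AM AP \<pi> E S Y"
    "prol_section AM AP \<pi> E S Z" and p: "p \<in> S"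
  note XYZ = this(3-5)
  obtain V \<phi> W \<psi> where C: "charted_d_metric AM AP \<pi> E h U e V \<phi> W \<psi> g"
    and eq: "\<And>Y Z. canonical_connection Y Z p = charted_n_connection.conn AP \<pi> E h e V \<phi> W \<psi>
       (\<lambda>p. canonical_coeffs (local_data_at AP \<pi> E h g ((V, \<phi>), (W, \<psi>)) e p)) Y Z p"
    and T: "open (S \<inter> W)" "S \<inter> W \<subseteq> W \<inter> \<pi> -` U" "p \<in> S \<inter> W"
    by (rule chart_reduction[OF S p]) blast
  interpret C: charted_d_metric AM AP \<pi> E h U e V \<phi> W \<psi> g
    by (rule C)
  show "snd (X p) (\<lambda>q. g q (Y q) (Z q))
      = g p (canonical_connection X Y p) (Z p) + g p (Y p) (canonical_connection X Z p)"
    unfolding eq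
    by (rule metric_compatibleD[OF C.canonical_metric_compatible T(1,2) _ _ _ T(3)])
       (rule prol_section_subset[OF XYZ(1)] prol_section_subset[OF XYZ(2)] prol_section_subset[OF XYZ(3)], blast)+
qed

text \<open>Holds in every fibred chart, including those never chosen by \<open>chart_at\<close>,
  again by \<open>canonical_connection_eq\<close>.\<close>

lemma canonical_connection_coeffs:
  assumes "c \<in> fibred_charts AM AP \<pi>" "p \<in> fdom c \<inter> \<pi> -` U"
  shows "adapted_coeffs AP \<pi> E h c e canonical_connection p
      = canonical_coeffs (local_data_at AP \<pi> E h g c e p)"
    and "regular_data (local_data_at AP \<pi> E h g c e p)"
proof -
  obtain V \<phi> W \<psi> where c: "c = ((V, \<phi>), (W, \<psi>))"
    by (metis prod.collapse)
  interpret C: charted_d_metric AM AP \<pi> E h U e V \<phi> W \<psi> g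
    using assms(1) unfolding c by (rule charted_d_metricI)
  have p: "p \<in> W \<inter> \<pi> -` U" using assms(2) c by simp
  show "adapted_coeffs AP \<pi> E h c e canonical_connection p = canonical_coeffs (local_data_at AP \<pi> E h g c e p)"
    unfolding c
    by (rule C.adapted_coeffs_conn[OF p])
       (rule C.canonical_connection_eq[OF C.open_Q order_refl C.\<epsilon>_section C.\<epsilon>_section p])
  show "regular_data (local_data_at AP \<pi> E h g c e p)"
    unfolding c by (rule C.regular[OF p])
qed

end

theorem theorem2p3:
  shows "\<exists>F :: ('n::finite, 'k::finite, 'r::finite) local_data \<Rightarrow> ('k, 'r) conn_coeffs.
    \<forall>(AM :: ('m::{t2_space, second_countable_topology}, real ^ 'n) atlas)
      (AP :: ('p::{t2_space, second_countable_topology}, (real ^ 'n) \<times> (real ^ 'k)) atlas)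
      (\<pi> :: 'p \<Rightarrow> 'm) (E :: ('m, 'e::real_vector, 'r) algebroid)
      (h :: 'p \<Rightarrow> ('e, 'p) prol set)
      (g :: 'p \<Rightarrow> ('e, 'p) prol \<Rightarrow> ('e, 'p) prol \<Rightarrow> real).
      fibration AM AP \<pi> \<longrightarrow> lie_algebroid AM E \<longrightarrow>
      N_connection AM AP \<pi> E h \<longrightarrow> d_metric AM AP \<pi> E h g \<longrightarrow>
      (\<forall>U e. local_frame AM E U e \<longrightarrow>
        (\<exists>D. d_connection AM AP \<pi> E h (\<pi> -` U) D \<and>
             metric_compatible AM AP \<pi> E g (\<pi> -` U) D \<and>
             (\<forall>c\<in>fibred_charts AM AP \<pi>. \<forall>p\<in>fdom c \<inter> \<pi> -` U.
                (\<forall>a b f. h_torsion (adapted_coeffs AP \<pi> E h c e D p)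
                           (\<lambda>a b f. struct_coeff E e a b f (\<pi> p)) a b f
                         = struct_coeff E e a b f (\<pi> p)) \<and>
                (\<forall>A B C. v_torsion (adapted_coeffs AP \<pi> E h c e D p) A B C = 0) \<and>
                adapted_coeffs AP \<pi> E h c e D p = F (local_data_at AP \<pi> E h g c e p))))"
\<comment> \<open>The formula is fixed before any manifold, algebroid, frame or chart is given,
  which is the sense of being completely determined by the data.\<close>
proof (rule exI[of _ canonical_coeffs], intro allI impI)
  fix AM :: "('m, real ^ 'n) atlas" and AP :: "('p, (real ^ 'n) \<times> (real ^ 'k)) atlas"
    and \<pi> :: "'p \<Rightarrow> 'm" and E :: "('m, 'e, 'r) algebroid"
    and h :: "'p \<Rightarrow> ('e, 'p) prol set"
    and g :: "'p \<Rightarrow> ('e, 'p) prol \<Rightarrow> ('e, 'p) prol \<Rightarrow> real" and U e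
  assume "fibration AM AP \<pi>" "lie_algebroid AM E" "N_connection AM AP \<pi> E h" "d_metric AM AP \<pi> E h g"
    "local_frame AM E U e"
  then interpret framed_d_metric AM AP \<pi> E h U e g
    by unfold_locales
  show "\<exists>D. d_connection AM AP \<pi> E h (\<pi> -` U) D \<and>
             metric_compatible AM AP \<pi> E g (\<pi> -` U) D \<and>
             (\<forall>c\<in>fibred_charts AM AP \<pi>. \<forall>p\<in>fdom c \<inter> \<pi> -` U.
                (\<forall>a b f. h_torsion (adapted_coeffs AP \<pi> E h c e D p)
                           (\<lambda>a b f. struct_coeff E e a b f (\<pi> p)) a b f
                         = struct_coeff E e a b f (\<pi> p)) \<and>
                (\<forall>A B C. v_torsion (adapted_coeffs AP \<pi> E h c e D p) A B C = 0) \<and>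
                adapted_coeffs AP \<pi> E h c e D p = canonical_coeffs (local_data_at AP \<pi> E h g c e p))"
  proof (intro exI[of _ canonical_connection] conjI ballI canonical_connection_d_connection
      canonical_connection_metric_compatible)
    fix c p assume c: "c \<in> fibred_charts AM AP \<pi>" "p \<in> fdom c \<inter> \<pi> -` U"
    show eq: "adapted_coeffs AP \<pi> E h c e canonical_connection p
        = canonical_coeffs (local_data_at AP \<pi> E h g c e p)"
      by (rule canonical_connection_coeffs(1)[OF c])
    \<comment> \<open>Symmetry of \<open>LH\<close> and \<open>BV\<close> in the lower indices
      cancels the differences in the torsions: the h-torsion reduces to C and the v-torsion to
      0.\<close>
    note sym = canonical_coeffs_symmetric[OF canonical_connection_coeffs(2)[OF c],
        unfolded symmetric_coeffs_def]
    show "\<forall>a b f. h_torsion (adapted_coeffs AP \<pi> E h c e canonical_connection p)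
        (\<lambda>a b f. struct_coeff E e a b f (\<pi> p)) a b f = struct_coeff E e a b f (\<pi> p)"
      using sym[THEN conjunct1] unfolding eq h_torsion_def by simp
    show "\<forall>A B C. v_torsion (adapted_coeffs AP \<pi> E h c e canonical_connection p) A B C = 0"
      using sym[THEN conjunct2, THEN conjunct1] unfolding eq v_torsion_def by simp
  qed
qed

end
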